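(* Let $A\in\mathbb{R}^{n\times n}$ be a non-singular matrix diagonalizable over $\mathbb{C}$. Then there exist a generic cut-and-project scheme $\Lambda=(\mathcal{L}\subset\mathbb{R}^s,\mathbb{R}^n)$ and a window $\Omega$ such that the cut-and-project set $\Sigma(\Omega)$ satisfies $A\Sigma(\Omega)\subset\Sigma(\Omega)$ if and only if the spectrum of $A$ has the following properties: (P1) every eigenvalue of $A$ is an algebraic integer; (P2) every complex number $\mu$ with $|\mu|>1$ which is algebraically conjugate to an eigenvalue of $A$ is itself an eigenvalue of $A$, and moreover $m_A(\mu)\geq m_A(\nu)$ for all algebraic conjugates $\nu$ of $\mu$, with strict inequality for at least one algebraic conjugate $\nu$ of $\mu$.
   Context: For a matrix $T$ and $\lambda\in\mathbb{C}$, $m_T(\lambda)$ denotes the algebraic multiplicity of $\lambda$ as an eigenvalue of $T$ ($0$ if $\lambda$ is not an eigenvalue); algebraic conjugates of an algebraic number are the roots of its minimal polynomial over $\mathbb{Q}$. A lattice $\mathcal{L}\subset\mathbb{R}^s$ is $\{L\mathbf{r}:\mathbf{r}\in\mathbb{Z}^s\}$ for a non-singular $L\in\mathbb{R}^{s\times s}$. For $1\le n<s$, the cut-and-project scheme $\Lambda=(\mathcal{L}\subset\mathbb{R}^s,\mathbb{R}^n)$ consists of $\mathcal{L}$ with projections $\pi_\parallel(\mathbf{x})=(x_1,\dots,x_n)^\top$, $\pi_\perp(\mathbf{x})=(x_{n+1},\dots,x_s)^\top$; it is generic if $\pi_\parallel|_{\mathcal{L}}$ and $\pi_\perp|_{\mathcal{L}}$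 are injective and $\pi_\perp(\mathcal{L})$ is dense in $\mathbb{R}^{s-n}$. A window is a bounded set $\Omega\subset\mathbb{R}^{s-n}$ with $\overline{\Omega^\circ}=\overline{\Omega}\neq\emptyset$, and the cut-and-project set is $\Sigma(\Omega)=\{\pi_\parallel(\mathbf{l}):\mathbf{l}\in\mathcal{L},\ \pi_\perp(\mathbf{l})\in\Omega\}$. *)

theory Defs
  imports "HOL-Analysis.Analysis" "HOL-Computational_Algebra.Polynomial"
    "Jordan_Normal_Form.Determinant" "Jordan_Normal_Form.Char_Poly"
begin

definition cmat :: "real mat \<Rightarrow> complex mat" where
  "cmat A = map_mat complex_of_real A"

definition diagonalizable_C :: "real mat \<Rightarrow> bool" where
  "diagonalizable_C A \<longleftrightarrow> (\<exists>D. diagonal_mat D \<and> similar_mat (cmat A) D)"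

definition alg_mult :: "real mat \<Rightarrow> complex \<Rightarrow> nat" where
  "alg_mult A z = order z (char_poly (cmat A))"

definition is_min_poly_Q :: "rat poly \<Rightarrow> complex \<Rightarrow> bool" where
  "is_min_poly_Q p x \<longleftrightarrow> lead_coeff p = 1 \<and> poly (map_poly of_rat p) x = 0 \<and>
     (\<forall>q. q \<noteq> 0 \<longrightarrow> poly (map_poly of_rat q) x = 0 \<longrightarrow> degree p \<le> degree q)"

definition alg_conjugate :: "complex \<Rightarrow> complex \<Rightarrow> bool" where
  "alg_conjugate x y \<longleftrightarrow> (\<exists>p. is_min_poly_Q p x \<and> poly (map_poly of_rat p) y = 0)"

definition lattice :: "nat \<Rightarrow> real mat \<Rightarrow> real vec set" where
  "lattice s L = {L *\<^sub>v r | r. r \<in> carrier_vec s \<and> (\<forall>i<s. r $ i \<in> \<int>)}"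

definition pi_par :: "nat \<Rightarrow> real vec \<Rightarrow> real vec" where
  "pi_par n x = vec n (\<lambda>i. x $ i)"

(* internal projection R^s -> R^(s-n) (last s-n coordinates); R^d is represented as
   the topspace of the library topology Euclidean_space d, i.e. functions
   nat => real vanishing from index d on *)
definition pi_perp :: "nat \<Rightarrow> nat \<Rightarrow> real vec \<Rightarrow> (nat \<Rightarrow> real)" where
  "pi_perp s n x = (\<lambda>i. if i < s - n then x $ (n + i) else 0)"

definition generic_cps :: "nat \<Rightarrow> nat \<Rightarrow> real mat \<Rightarrow> bool" where
  "generic_cps s n L \<longleftrightarrow>
     1 \<le> n \<and> n < s \<and> L \<in> carrier_mat s s \<and> det L \<noteq> 0 \<and>
     inj_on (pi_par n) (lattice s L) \<and>
     inj_on (pi_perp s n) (lattice s L) \<and>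
     (Euclidean_space (s - n)) closure_of (pi_perp s n ` lattice s L)
        = topspace (Euclidean_space (s - n))"

definition is_window :: "nat \<Rightarrow> (nat \<Rightarrow> real) set \<Rightarrow> bool" where
  "is_window d \<Omega> \<longleftrightarrow>
     \<Omega> \<subseteq> topspace (Euclidean_space d) \<and>
     (\<exists>B. \<forall>x\<in>\<Omega>. (\<Sum>i<d. (x i)\<^sup>2) \<le> B) \<and>
     (Euclidean_space d) closure_of ((Euclidean_space d) interior_of \<Omega>)
        = (Euclidean_space d) closure_of \<Omega> \<and>
     (Euclidean_space d) closure_of \<Omega> \<noteq> {}"

definition cps_set :: "nat \<Rightarrow> nat \<Rightarrow> real mat \<Rightarrow> (nat \<Rightarrow> real) set \<Rightarrow> real vec set" where
  "cps_set s n L \<Omega> = {pi_par n l | l. l \<in> lattice s L \<and> pi_perp s n l \<in> \<Omega>}"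

end

theory Submission
  imports Defs
begin

unbundle no vec_syntax
hide_const (open) module.smult

text \<open>Since \<open>\<pi>\<^sub>\<parallel>\<close> is injective and lattice points near the window generate \<open>\<L>\<close>, an invariant
  \<open>\<Sigma>(\<Omega>)\<close> turns \<open>A\<close> into an integer matrix \<open>N\<close> acting on \<open>\<L>\<close>, and boundedness of the window makes \<open>N\<close> block
  diagonal, \<open>N \<sim> A \<oplus> B\<close>, with the spectrum of \<open>B\<close> in the closed unit disc. Conjugate numbers have equal
  multiplicity in the characteristic polynomial of \<open>N\<close>; an expanding \<open>\<mu>\<close> has all of its multiplicity in \<open>A\<close>. If all
  conjugates had, then the kernel of the minimal polynomial at \<open>N\<close> would be a rational subspace of \<open>\<real>\<^sup>n\<close>,
  contradicting the injectivity of \<open>\<pi>\<^sub>\<bottom>\<close>.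

  Conversely, give every conjugacy class a multiplicity \<open>k\<close>: the largest multiplicity in \<open>A\<close>, plus one when no
  conjugate is expanding. Take for \<open>N\<close> multiplication by \<open>x\<close> on a sum of rings \<open>\<int>[x]/(f\<^sub>j)\<close>, where the roots of
  \<open>f\<^sub>j\<close> are the \<open>\<nu>\<close> with \<open>k(\<nu>) > j\<close>, and split each \<open>k\<close>-dimensional eigenspace of \<open>N\<close> between \<open>A\<close> and
  the complement \<open>B\<close> along a real orthonormal basis with transcendental entries. Genericity of this basis gives
  injectivity of both projections, and density via integral functionals; on the complement \<open>N\<close> does not
  increase the Euclidean norm, so the open unit ball is a window.\<close>

section \<open>Minimal polynomials and algebraic conjugates\<close>

text \<open>Necessity uses boundedness of the window twice. A linear form that is bounded on the
  lattice points of the window vanishes on the kernel of \<open>pi_perp\<close>, which removes the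
  block of \<open>N\<close> leading from physical to internal space; and since \<open>N\<close> maps
  these lattice points to themselves, an eigenvalue of \<open>B\<close> outside the closed disc
  would give an unbounded orbit.

  The obstacle in the converse is that conjugates may have different multiplicities in
  \<open>A\<close>, so that the physical space takes different numbers of dimensions from conjugate
  eigenspaces. A splitting along the rings themselves could leave integer vectors supported in a
  single ring without any component on one side. With a transcendental basis, all coordinates of a
  nonzero integer vector are nonzero at all conjugates of some \<nu>; so one coordinate on a side,
  anywhere in each conjugacy class, makes the projection to that side injective. The plus one in
  \<open>k\<close> reserves such an internal coordinate for classes in the closed unit disc; an
  expanding class has it by the strict inequality in (P2).\<close>

interpretation of_rat_poly_hom: map_poly_inj_idom_hom "of_rat :: rat \<Rightarrow> complex" ..

lemma min_poly_nonzero: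
  assumes "is_min_poly_Q p x"
  shows "p \<noteq> 0"
  using assms by (auto simp: is_min_poly_Q_def)

lemma min_poly_exists:
  assumes "algebraic x"
  shows "\<exists>p. is_min_poly_Q p x"
proof -
  let ?P = "\<lambda>d. \<exists>q. q \<noteq> 0 \<and> poly (map_poly of_rat q) x = 0 \<and> degree q = d"
  from assms obtain r where r: "\<And>i. coeff r i \<in> \<int>" "r \<noteq> 0" "poly r x = 0"
    by (elim algebraicE) auto
  have "\<forall>i. \<exists>z::int. coeff r i = of_int z"
    using r(1) by (auto elim: Ints_cases)
  then obtain f where f: "\<And>i. coeff r i = of_int (f i)" by metis
  \<comment> \<open>The coefficients of \<open>r\<close> are complex numbers that happen to be
    integers; real part and floor recover them as rationals.\<close>
  define q where "q = map_poly (\<lambda>z. rat_of_int \<lfloor>Re z\<rfloor>) r"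
  have q: "map_poly of_rat q = r"
    by (rule poly_eqI) (simp add: q_def coeff_map_poly f)
  with r have "?P (degree q)"
    by (intro exI[of _ q]) auto
  then obtain d where d: "?P d" and least: "\<And>e. ?P e \<Longrightarrow> d \<le> e"
    using LeastI[of ?P] Least_le[of ?P] by blast
  from d obtain p where p: "p \<noteq> 0" "poly (map_poly of_rat p) x = 0" "degree p = d" by auto
  have "is_min_poly_Q (smult (inverse (lead_coeff p)) p) x"
    unfolding is_min_poly_Q_def
    using p least by (auto simp: of_rat_hom.map_poly_hom_smult)
  then show ?thesis ..
qed

lemma min_poly_dvd:
  assumes "is_min_poly_Q p x" "poly (map_poly of_rat q) x = 0"
  shows "p dvd q"
proof -
  have p: "p \<noteq> 0" "poly (map_poly of_rat p) x = 0" using assms(1)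
    by (auto simp: is_min_poly_Q_def)
  have "map_poly of_rat q = (map_poly of_rat (q div p) * map_poly of_rat p + map_poly of_rat (q mod p) :: complex poly)"
    by (metis div_mult_mod_eq of_rat_poly_hom.hom_add of_rat_poly_hom.hom_mult)
  then have "poly (map_poly of_rat (q mod p)) x = 0"
    using p assms(2) by simp
  with assms(1) have "q mod p = 0 \<or> degree p \<le> degree (q mod p)"
    by (auto simp: is_min_poly_Q_def)
  moreover have "q mod p = 0 \<or> degree (q mod p) < degree p"
    using degree_mod_less[OF p(1), of q] by auto
  ultimately show ?thesis by auto
qed

lemma min_poly_unique:
  assumes "is_min_poly_Q p x" "is_min_poly_Q q x"
  shows "p = q"
proof -
  have "poly (map_poly of_rat q) x = 0" "poly (map_poly of_rat p) x = 0"
    using assms by (auto simp: is_min_poly_Q_def)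
  then have "p dvd q" "q dvd p" using assms min_poly_dvd by blast+
  then show ?thesis using assms
    by (metis is_min_poly_Q_def poly_dvd_antisym)
qed

text \<open>This is irreducibility in disguise. In \<open>p = q * s\<close>, with \<open>q\<close>
  minimal for \<open>y\<close>, one factor vanishes at \<open>x\<close> and is therefore divisible
  by \<open>p\<close>: if it is \<open>q\<close>, then \<open>p = q\<close>; if it is
  \<open>s\<close>, then \<open>q\<close> is constant and cannot vanish at \<open>y\<close>.\<close>

lemma min_poly_conjugate:
  assumes p: "is_min_poly_Q p x" and y: "poly (map_poly of_rat p) y = 0"
  shows "is_min_poly_Q p y"
proof -
  have "algebraic y"
    using y min_poly_nonzero[OF p] by (intro algebraicI'[of "map_poly of_rat p"]) (auto simp: coeff_map_poly)
  then obtain q where q: "is_min_poly_Q q y" using min_poly_exists by blast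
  then have "q dvd p" using y by (rule min_poly_dvd)
  then obtain s where s: "p = q * s" by auto
  have "poly (map_poly of_rat q) x = 0 \<or> poly (map_poly of_rat s) x = 0"
    using p unfolding s by (simp add: is_min_poly_Q_def of_rat_poly_hom.hom_mult)
  then show ?thesis
  proof
    assume "poly (map_poly of_rat q) x = 0"
    then have "p dvd q" using p min_poly_dvd by blast
    with \<open>q dvd p\<close> p q have "p = q" by (metis is_min_poly_Q_def poly_dvd_antisym)
    with q show ?thesis by simp
  next
    assume "poly (map_poly of_rat s) x = 0"
    then have "p dvd s" using p min_poly_dvd by blast
    moreover have "q \<noteq> 0" "s \<noteq> 0" using min_poly_nonzero[OF p] s by auto
    ultimately have "degree q = 0" using s by (metis add_le_same_cancel2 degree_mult_eq dvd_imp_degree_le le_zero_eq)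
    then obtain c where "q = [:c:]" by (meson degree_eq_zeroE)
    with q show ?thesis by (auto simp: is_min_poly_Q_def map_poly_pCons)
  qed
qed

lemma alg_conjugate_sym: "alg_conjugate x y \<Longrightarrow> alg_conjugate y x"
  unfolding alg_conjugate_def by (meson is_min_poly_Q_def min_poly_conjugate)

lemma alg_conjugate_trans: "alg_conjugate x y \<Longrightarrow> alg_conjugate y z \<Longrightarrow> alg_conjugate x z"
  unfolding alg_conjugate_def by (metis min_poly_conjugate min_poly_unique)

lemma alg_conjugate_refl: "algebraic x \<Longrightarrow> alg_conjugate x x"
  unfolding alg_conjugate_def by (metis is_min_poly_Q_def min_poly_exists)

lemma alg_conjugate_cnj: "algebraic x \<Longrightarrow> alg_conjugate x (cnj x)"
proof -
  assume "algebraic x"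
  then obtain p where p: "is_min_poly_Q p x" using min_poly_exists by blast
  have "cnj (of_rat c) = of_rat c" for c
    by (cases c) (simp add: of_rat_rat)
  then have "poly (map_poly of_rat p) (cnj x) = cnj (poly (map_poly of_rat p) x)"
    by (simp add: poly_altdef coeff_map_poly)
  then show ?thesis using p unfolding alg_conjugate_def by (auto simp: is_min_poly_Q_def)
qed

lemma alg_conjugate_root:
  assumes "alg_conjugate x y" "poly (map_poly of_rat q) x = 0"
  shows "poly (map_poly of_rat q) y = 0"
proof -
  obtain p where p: "is_min_poly_Q p x" "poly (map_poly of_rat p) y = 0"
    using assms(1) by (auto simp: alg_conjugate_def)
  then obtain s where "q = p * s" using min_poly_dvd assms(2) by (meson dvdE)
  then show ?thesis using p by (simp add: of_rat_poly_hom.hom_mult)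
qed

lemma finite_alg_conjugates: "finite {y. alg_conjugate x y}"
proof (cases "\<exists>p. is_min_poly_Q p x")
  case True
  then obtain p where p: "is_min_poly_Q p x" ..
  have "{y. alg_conjugate x y} \<subseteq> {y. poly (map_poly of_rat p) y = 0}"
    using min_poly_unique[OF p] by (auto simp: alg_conjugate_def)
  moreover have "map_poly of_rat p \<noteq> (0 :: complex poly)"
    using min_poly_nonzero[OF p] by simp
  ultimately show ?thesis
    by (rule finite_subset[OF _ poly_roots_finite])
qed (auto simp: alg_conjugate_def)

text \<open>Separability in characteristic 0: a common zero of \<open>p\<close> and its derivative
  would make \<open>p\<close> divide a nonzero polynomial of smaller degree.\<close>

lemma min_poly_simple_root:
  assumes "is_min_poly_Q p x"
  shows "order x (map_poly of_rat p) = 1"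
proof -
  have p: "p \<noteq> 0" "poly (map_poly of_rat p) x = 0" using assms
    by (auto simp: is_min_poly_Q_def)
  have d: "degree p \<noteq> 0"
  proof
    assume "degree p = 0"
    then obtain c where "p = [:c:]" by (meson degree_eq_zeroE)
    with p show False by (auto simp: map_poly_pCons)
  qed
  have "poly (pderiv (map_poly of_rat p)) x \<noteq> 0"
  proof
    assume "poly (pderiv (map_poly of_rat p)) x = 0"
    then have "poly (map_poly of_rat (pderiv p)) x = 0"
      by (simp add: of_rat_hom.map_poly_pderiv)
    then have "p dvd pderiv p" using assms min_poly_dvd by blast
    then show False using d by (simp add: not_dvd_pderiv)
  qed
  moreover have "map_poly of_rat p \<noteq> (0::complex poly)" using p by simp
  ultimately show ?thesis
    using order_pderiv[of "map_poly of_rat p" x] p order_root by (metis One_nat_def order_0I)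
qed

text \<open>Dividing out the common minimal polynomial lowers both orders by exactly one, its roots
  being simple. Applied to the characteristic polynomial of an integer matrix, this ties together
  the multiplicities of conjugate eigenvalues.\<close>

lemma order_alg_conjugate:
  assumes "alg_conjugate x y" "f \<noteq> 0"
  shows "order x (map_poly of_rat f) = order y (map_poly of_rat f)"
  using assms(2)
proof (induction "degree f" arbitrary: f rule: less_induct)
  case (less f)
  obtain p where p: "is_min_poly_Q p x" "is_min_poly_Q p y"
    using assms(1) min_poly_conjugate by (auto simp: alg_conjugate_def)
  show ?case
  proof (cases "p dvd f")
    case True
    then obtain g where g: "f = p * g" by auto
    then have nz: "p \<noteq> 0" "g \<noteq> 0" using less.prems by auto
    have "degree p \<noteq> 0"
    proof
      assume "degree p = 0"
      then obtain c where "p = [:c:]" by (meson degree_eq_zeroE)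
      with p show False by (auto simp: is_min_poly_Q_def map_poly_pCons)
    qed
    then have "degree g < degree f" using nz by (simp add: g degree_mult_eq)
    from less.hyps[OF this nz(2)] nz show ?thesis
      by (simp add: g of_rat_poly_hom.hom_mult order_mult min_poly_simple_root[OF p(1)] min_poly_simple_root[OF p(2)])
  next
    case False
    then have "poly (map_poly of_rat f) x \<noteq> 0" "poly (map_poly of_rat f) y \<noteq> 0"
      using p min_poly_dvd by blast+
    then show ?thesis by (simp add: order_0I)
  qed
qed

section \<open>Integrality of minimal polynomials\<close>

text \<open>Gauss's lemma. After clearing denominators by \<open>a\<close> and \<open>b\<close> the
  contents multiply to \<open>a * b\<close>. As the factors are monic, the contents divide the
  leading coefficients \<open>a\<close> and \<open>b\<close>, so \<open>a\<close> must divide all of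
  \<open>P\<close>.\<close>

lemma monic_rat_factor_int:
  fixes f :: "int poly" and p s :: "rat poly"
  assumes f: "lead_coeff f = 1" and fact: "map_poly of_int f = p * s" and p: "lead_coeff p = 1"
  shows "\<exists>g. p = map_poly of_int g"
proof -
  have clear: "\<exists>a P. a > 0 \<and> smult (of_int a) q = map_poly of_int P" for q :: "rat poly"
  proof (induction q)
    case 0
    show ?case by (intro exI[of _ 1] exI[of _ 0]) simp
  next
    case (pCons c q)
    then obtain a P where a: "a > 0" "smult (of_int a) q = map_poly of_int P" by blast
    obtain m d where c: "c = of_int m / of_int d" "d > 0"
      by (cases c) (auto simp: Fract_of_int_quotient)
    have "smult (of_int (a * d)) (pCons c q) = map_poly of_int (pCons (a * m) (smult d P))"
      using c a(2)[symmetric] by (simp add: hom_distribs mult.commute)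
    then show ?case using a(1) c(2) by (meson mult_pos_pos)
  qed
  obtain a P where a: "a > 0" "smult (of_int a) p = map_poly of_int P" using clear by blast
  obtain b S where b: "b > 0" "smult (of_int b) s = map_poly of_int S" using clear by blast
  have s: "lead_coeff s = 1"
    using arg_cong[OF fact, of lead_coeff] f p by (simp add: lead_coeff_mult)
  have lP: "lead_coeff P = a" and lS: "lead_coeff S = b"
    using arg_cong[OF a(2), of lead_coeff] arg_cong[OF b(2), of lead_coeff] p s a(1) b(1) by simp_all
  have "map_poly rat_of_int (P * S) = smult (of_int (a * b)) (map_poly of_int f)"
    using a b fact by (simp add: of_int_poly_hom.hom_mult mult.commute flip: a(2) b(2))
  also have "\<dots> = map_poly of_int (smult (a * b) f)"
    by (simp add: of_int_hom.map_poly_hom_smult)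
  finally have "P * S = smult (a * b) f"
    by (simp only: of_int_poly_hom.eq_iff)
  then have "content (P * S) = a * b * content f" using a b by (simp add: content_smult)
  moreover have "content f = 1"
  proof -
    have "is_unit (content f)" using f content_dvd_coeff[of f "degree f"] by simp
    then show ?thesis by (metis is_unit_normalize normalize_content)
  qed
  ultimately have ab: "content P * content S = a * b" by (simp add: content_mult)
  have dvd: "content P dvd a" "content S dvd b"
    using content_dvd_coeff[of P "degree P"] content_dvd_coeff[of S "degree S"] lP lS by auto
  have "a dvd content P"
  proof -
    obtain t where t: "b = content S * t" using dvd by blast
    then have "content S \<noteq> 0" using b by auto
    moreover have "content P * content S = (a * t) * content S" using ab t by (simp add: ac_simps)
    ultimately show ?thesis by simp
  qed
  then have "[:a:] dvd P"
    by (meson const_poly_dvd_iff_dvd_content)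
  then obtain g where "P = [:a:] * g" by (rule dvdE)
  then have "P = smult a g" by simp
  then have "smult (of_int a) p = smult (of_int a) (map_poly of_int g)"
    using a by (simp add: of_int_hom.map_poly_hom_smult)
  then have "p = map_poly of_int g" using a(1) smult_cancel[of "rat_of_int a" p] by simp
  then show ?thesis ..
qed

lemma min_poly_int:
  assumes "is_min_poly_Q p x" "algebraic_int x"
  shows "\<exists>g. p = map_poly of_int g"
proof -
  obtain f :: "int poly" where f: "poly (map_poly of_int f) x = 0" "lead_coeff f = 1"
    using assms(2) by (auto simp: algebraic_int_altdef_ipoly)
  have "map_poly of_rat (map_poly of_int f) = (map_poly of_int f :: complex poly)"
    by (simp add: map_poly_map_poly o_def)
  with f(1) assms(1) have "p dvd map_poly of_int f" by (metis min_poly_dvd)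
  then obtain s where "map_poly of_int f = p * s" by auto
  then show ?thesis
    using monic_rat_factor_int f(2) assms(1) by (auto simp: is_min_poly_Q_def)
qed

lemma min_poly_prod_conjugates:
  assumes p: "is_min_poly_Q p x"
  shows "map_poly of_rat p = (\<Prod>y | alg_conjugate x y. [:-y, 1:])"
proof -
  let ?p = "map_poly of_rat p :: complex poly"
  have roots: "{y. poly ?p y = 0} = {y. alg_conjugate x y}"
    unfolding alg_conjugate_def using p by (blast dest: min_poly_unique[OF p])
  have "rsquarefree ?p"
    unfolding rsquarefree_def
  proof (intro conjI allI)
    show "?p \<noteq> 0" using min_poly_nonzero[OF p] by simp
    show "order y ?p = 0 \<or> order y ?p = 1" for y
      using min_poly_simple_root[OF min_poly_conjugate[OF p]] order_0I by blast
  qed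
  then have "smult (lead_coeff ?p) (\<Prod>y | poly ?p y = 0. [:-y, 1:]) = ?p"
    by (rule complex_poly_decompose_rsquarefree)
  then show ?thesis using p by (simp add: roots is_min_poly_Q_def)
qed

text \<open>The set is a disjoint union of conjugacy classes, each of which contributes a minimal
  polynomial with integer coefficients. This is where the polynomials \<open>f j\<close> come
  from.\<close>

lemma prod_conjugate_closed_int:
  assumes "finite R" "\<And>x. x \<in> R \<Longrightarrow> algebraic_int x"
    and "\<And>x y. x \<in> R \<Longrightarrow> alg_conjugate x y \<Longrightarrow> y \<in> R"
  shows "\<exists>f :: int poly. map_poly of_int f = (\<Prod>x\<in>R. [:-x, 1:])"
  using assms
proof (induction "card R" arbitrary: R rule: less_induct)
  case (less R)
  show ?case
  proof (cases "R = {}")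
    case True
    then show ?thesis by (intro exI[of _ 1]) simp
  next
    case False
    then obtain x where x: "x \<in> R" by blast
    let ?C = "{y. alg_conjugate x y}"
    have alg: "algebraic y" if "y \<in> R" for y using less.prems(2)[OF that] by blast
    obtain p where p: "is_min_poly_Q p x" using min_poly_exists alg[OF x] by blast
    obtain g where g: "p = map_poly of_int g" using min_poly_int[OF p] less.prems(2)[OF x] by blast
    have C: "?C \<subseteq> R" "x \<in> ?C"
      using less.prems(3)[OF x] alg_conjugate_refl[OF alg[OF x]] by auto
    have "card (R - ?C) < card R"
      using C x less.prems(1) by (intro psubset_card_mono) auto
    moreover have "y \<in> R - ?C" if "z \<in> R - ?C" "alg_conjugate z y" for y z
      using that less.prems(3) alg_conjugate_sym alg_conjugate_trans by blast
    ultimately obtain h :: "int poly" where h: "map_poly of_int h = (\<Prod>x\<in>R - ?C. [:-x, 1:] :: complex poly)"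
      using less.hyps[of "R - ?C"] less.prems by blast
    have "(map_poly of_int g :: complex poly) = map_poly of_rat p"
      by (simp add: g map_poly_map_poly o_def)
    then have "(map_poly of_int (g * h) :: complex poly) = (\<Prod>x\<in>?C. [:-x, 1:]) * (\<Prod>x\<in>R - ?C. [:-x, 1:])"
      by (simp add: of_int_poly_hom.hom_mult h min_poly_prod_conjugates[OF p])
    also have "\<dots> = (\<Prod>x\<in>R. [:-x, 1:])"
      using prod.subset_diff[OF C(1) less.prems(1), of "\<lambda>x. [:-x, 1:]"] by (simp add: mult.commute)
    finally show ?thesis by blast
  qed
qed

section \<open>Dense subgroups of Euclidean space\<close>

text \<open>A basic open set of the product constrains every coordinate; on this subspace those from
  \<open>d\<close> on are 0 for \<open>x\<close> and \<open>y\<close> alike, so only finitely many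
  radii matter.\<close>

lemma openin_Euclidean_space_box:
  assumes "openin (Euclidean_space d) U" "y \<in> U"
  obtains \<epsilon> where "\<epsilon> > 0"
    "\<And>x. x \<in> topspace (Euclidean_space d) \<Longrightarrow> (\<And>i. i < d \<Longrightarrow> \<bar>x i - y i\<bar> < \<epsilon>) \<Longrightarrow> x \<in> U"
proof -
  obtain T where T: "openin (product_topology (\<lambda>_. euclideanreal) UNIV) T"
    and U: "U = T \<inter> {x. \<forall>i\<ge>d. x i = 0}"
    using assms(1) by (auto simp: Euclidean_space_def openin_subtopology)
  then have "y \<in> T" using assms(2) by auto
  then obtain V where "\<forall>i\<in>UNIV. openin euclideanreal (V i)"
    and V: "y \<in> Pi\<^sub>E UNIV V" "Pi\<^sub>E UNIV V \<subseteq> T"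
    using T unfolding openin_product_topology_alt by blast
  then have V_open: "\<And>i. open (V i)" by simp
  have "\<exists>e>0. \<forall>t. \<bar>t - y i\<bar> < e \<longrightarrow> t \<in> V i" for i
    using V_open[of i] V(1) unfolding open_dist by (auto simp: dist_real_def PiE_iff)
  then obtain e where e: "\<And>i. e i > 0" "\<And>i t. \<bar>t - y i\<bar> < e i \<Longrightarrow> t \<in> V i" by metis
  \<comment> \<open>The 1 keeps the minimum defined for \<open>d = 0\<close>.\<close>
  define \<epsilon> where "\<epsilon> = Min (insert 1 (e ` {..<d}))"
  have "\<epsilon> > 0" using e(1) by (auto simp: \<epsilon>_def)
  moreover have "x \<in> U" if x: "x \<in> topspace (Euclidean_space d)" "\<And>i. i < d \<Longrightarrow> \<bar>x i - y i\<bar> < \<epsilon>" for x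
  proof -
    have "x i \<in> V i" for i
    proof (cases "i < d")
      case True
      then have "\<epsilon> \<le> e i" by (auto simp: \<epsilon>_def)
      then show ?thesis using x(2)[OF True] e(2) by fastforce
    next
      case False
      then have "x i = y i" using x(1) assms(2) by (auto simp: U topspace_Euclidean_space)
      then show ?thesis using V(1) by (auto simp: PiE_iff)
    qed
    then show ?thesis using V(2) x(1) by (auto simp: U topspace_Euclidean_space PiE_iff)
  qed
  ultimately show thesis using that by blast
qed

lemma openin_Euclidean_space_ball:
  "openin (Euclidean_space d) {x \<in> topspace (Euclidean_space d). (\<Sum>i<d. (x i - y i)\<^sup>2) < r}"
proof -
  have "continuous_map (Euclidean_space d) euclideanreal (\<lambda>x. x i)" for i
    unfolding Euclidean_space_def
    by (intro continuous_map_from_subtopology continuous_map_product_projection) simp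
  then have "continuous_map (Euclidean_space d) euclideanreal (\<lambda>x. \<Sum>i<d. (x i - y i)\<^sup>2)"
    by (intro continuous_map_sum continuous_map_real_pow continuous_map_diff continuous_map_const[THEN iffD2]) auto
  then have "openin (Euclidean_space d) {x \<in> topspace (Euclidean_space d). (\<Sum>i<d. (x i - y i)\<^sup>2) \<in> {..<r}}"
    by (rule openin_continuous_map_preimage) (simp flip: open_openin)
  then show ?thesis by simp
qed

text \<open>Coordinatewise approximation is the form in which density is used below, both as a
  consequence of genericity and as a goal of the construction.\<close>

lemma dense_in_Euclidean_space_iff:
  assumes "G \<subseteq> topspace (Euclidean_space d)"
  shows "Euclidean_space d closure_of G = topspace (Euclidean_space d) \<longleftrightarrow>
    (\<forall>y\<in>topspace (Euclidean_space d). \<forall>\<epsilon>>0. \<exists>g\<in>G. \<forall>i<d. \<bar>g i - y i\<bar> < \<epsilon>)"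
proof
  assume L: "Euclidean_space d closure_of G = topspace (Euclidean_space d)"
  show "\<forall>y\<in>topspace (Euclidean_space d). \<forall>\<epsilon>>0. \<exists>g\<in>G. \<forall>i<d. \<bar>g i - y i\<bar> < \<epsilon>"
  proof (intro ballI allI impI)
    fix y and \<epsilon> :: real assume y: "y \<in> topspace (Euclidean_space d)" and "\<epsilon> > 0"
    define T where "T = {x \<in> topspace (Euclidean_space d). (\<Sum>i<d. (x i - y i)\<^sup>2) < \<epsilon>\<^sup>2}"
    have "openin (Euclidean_space d) T" unfolding T_def by (rule openin_Euclidean_space_ball)
    moreover have "y \<in> T" using y \<open>\<epsilon> > 0\<close> by (simp add: T_def)
    moreover have "y \<in> Euclidean_space d closure_of G" using y L by simp
    ultimately obtain g where g: "g \<in> G" "g \<in> T" by (meson in_closure_of)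
    have "\<bar>g i - y i\<bar> < \<epsilon>" if "i < d" for i
    proof -
      have "(g i - y i)\<^sup>2 \<le> (\<Sum>i<d. (g i - y i)\<^sup>2)"
        using that by (intro member_le_sum) auto
      then have "(g i - y i)\<^sup>2 < \<epsilon>\<^sup>2" using g(2) by (simp add: T_def)
      then show ?thesis using \<open>\<epsilon> > 0\<close> by (metis abs_le_square_iff abs_of_pos linorder_not_le)
    qed
    with g show "\<exists>g\<in>G. \<forall>i<d. \<bar>g i - y i\<bar> < \<epsilon>" by blast
  qed
next
  assume R: "\<forall>y\<in>topspace (Euclidean_space d). \<forall>\<epsilon>>0. \<exists>g\<in>G. \<forall>i<d. \<bar>g i - y i\<bar> < \<epsilon>"
  have "y \<in> Euclidean_space d closure_of G" if y: "y \<in> topspace (Euclidean_space d)" for y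
    unfolding in_closure_of
  proof (intro conjI allI impI)
    fix T assume T: "y \<in> T \<and> openin (Euclidean_space d) T"
    then obtain \<epsilon> where \<epsilon>: "\<epsilon> > 0"
      "\<And>x. x \<in> topspace (Euclidean_space d) \<Longrightarrow> (\<And>i. i < d \<Longrightarrow> \<bar>x i - y i\<bar> < \<epsilon>) \<Longrightarrow> x \<in> T"
      using openin_Euclidean_space_box by metis
    with R y assms show "\<exists>y. y \<in> G \<and> y \<in> T" by (meson subsetD)
  qed (use y in auto)
  then show "Euclidean_space d closure_of G = topspace (Euclidean_space d)"
    by (intro subset_antisym closure_of_subset_topspace subsetI)
qed

section \<open>A dichotomy for subgroups of real space\<close>

text \<open>Short nonzero elements, scaled to maximum norm 1, accumulate at a direction
  \<open>u\<close>. Their integer multiples are closely spaced along almost this direction, so they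
  approximate all points of the line through \<open>u\<close>.\<close>

lemma subgroup_line_limit:
  fixes G :: "('i \<Rightarrow> real) set"
  assumes I: "finite I" and zero: "(\<lambda>_. 0) \<in> G"
    and add: "\<And>g h. g \<in> G \<Longrightarrow> h \<in> G \<Longrightarrow> (\<lambda>i. g i + h i) \<in> G"
    and uminus: "\<And>g. g \<in> G \<Longrightarrow> (\<lambda>i. - g i) \<in> G"
    and small: "\<And>\<delta>. \<delta> > 0 \<Longrightarrow> \<exists>g\<in>G. (\<exists>i\<in>I. g i \<noteq> 0) \<and> (\<forall>i\<in>I. \<bar>g i\<bar> < \<delta>)"
  shows "\<exists>u. \<exists>l\<in>I. u l \<noteq> 0 \<and> (\<forall>t. \<forall>\<eta>>0. \<exists>g\<in>G. \<forall>i\<in>I. \<bar>g i - t * u i\<bar> < \<eta>)"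
proof -
  have mult_nat: "(\<lambda>i. of_nat k * g i) \<in> G" if "g \<in> G" for g k
  proof (induction k)
    case (Suc k)
    from add[OF this that] show ?case by (simp add: algebra_simps)
  qed (use zero in simp)
  have mult_int: "(\<lambda>i. of_int k * g i) \<in> G" if "g \<in> G" for g k
    using mult_nat[OF that, of "nat k"] uminus[OF mult_nat[OF that, of "nat (- k)"]]
    by (cases "k \<ge> 0") auto
  have "\<exists>g\<in>G. (\<exists>i\<in>I. g i \<noteq> 0) \<and> (\<forall>i\<in>I. \<bar>g i\<bar> < 1 / real (Suc n))" for n
    by (rule small) simp
  then obtain g where g: "\<And>n. g n \<in> G" "\<And>n. \<exists>i\<in>I. g n i \<noteq> 0" "\<And>n i. i \<in> I \<Longrightarrow> \<bar>g n i\<bar> < 1 / real (Suc n)"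
    by metis
  then have I0: "I \<noteq> {}" by blast
  define N where "N n = Max ((\<lambda>i. \<bar>g n i\<bar>) ` I)" for n
  have N_ge: "\<bar>g n i\<bar> \<le> N n" if "i \<in> I" for n i
    unfolding N_def using I that by (intro Max_ge) auto
  have N_pos: "N n > 0" for n
  proof -
    obtain i where "i \<in> I" "g n i \<noteq> 0" using g(2) by blast
    then show ?thesis using N_ge[of i n] by linarith
  qed
  have N_in: "N n \<in> (\<lambda>i. \<bar>g n i\<bar>) ` I" for n
    unfolding N_def using I I0 by (intro Max_in) auto
  have N_less: "N n < 1 / real (Suc n)" for n
    using N_in[of n] g(3)[of _ n] by auto
  define v where "v n i = g n i / N n" for n i
  have v_le: "\<bar>v n i\<bar> \<le> 1" if "i \<in> I" for n i
    using N_ge[OF that, of n] N_pos[of n] by (simp add: v_def)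
  have v_sum: "(\<Sum>i\<in>I. \<bar>v n i\<bar>) \<ge> 1" for n
  proof -
    obtain i where i: "i \<in> I" "N n = \<bar>g n i\<bar>" using N_in[of n] by auto
    then have "\<bar>v n i\<bar> = 1" using N_pos[of n] by (simp add: v_def)
    then show ?thesis using member_le_sum[of i I "\<lambda>i. \<bar>v n i\<bar>"] I i by simp
  qed
  have bounded: "bounded ((\<lambda>x. x i) ` range v)" if "i \<in> I" for i
    using v_le[OF that] by (auto simp: bounded_iff)
  obtain u r where r: "strict_mono r" and u: "\<And>\<epsilon>. \<epsilon> > 0 \<Longrightarrow>
      eventually (\<lambda>n. \<forall>i\<in>I. dist (v (r n) i) (u i) < \<epsilon>) sequentially"
    using compact_lemma_general[of I "\<lambda>x i. x i" v "\<lambda>x. x"] I bounded by blast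
  have "\<exists>l\<in>I. u l \<noteq> 0"
  proof (rule ccontr)
    assume "\<not> ?thesis"
    then have u0: "u i = 0" if "i \<in> I" for i using that by auto
    have "0 < 1 / real (card I)" using I I0 by (simp add: card_gt_0_iff)
    from u[OF this] obtain n where n: "\<And>i. i \<in> I \<Longrightarrow> \<bar>v (r n) i\<bar> < 1 / real (card I)"
      by (auto simp: eventually_sequentially dist_real_def u0)
    have "(\<Sum>i\<in>I. \<bar>v (r n) i\<bar>) < (\<Sum>i\<in>I. 1 / real (card I))"
      using n I I0 by (intro sum_strict_mono) auto
    also have "\<dots> = 1" using I I0 by simp
    finally show False using v_sum[of "r n"] by simp
  qed
  then obtain l where l: "l \<in> I" "u l \<noteq> 0" by blast
  moreover have "\<exists>h\<in>G. \<forall>i\<in>I. \<bar>h i - t * u i\<bar> < \<eta>" if \<eta>: "\<eta> > 0" for t \<eta>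
  proof -
    \<comment> \<open>The error has two parts: rounding \<open>t\<close> to a multiple of
      \<open>N m\<close> costs less than \<open>\<eta> / 2\<close>, and the deviation of the
      direction costs \<open>\<bar>t\<bar> * e\<close>, at most \<open>\<eta> / 2\<close>. The
      summand 1 covers \<open>t = 0\<close>.\<close>
    define e where "e = \<eta> / (2 * (\<bar>t\<bar> + 1))"
    have e: "e > 0" "\<bar>t\<bar> * e \<le> \<eta> / 2" using \<eta> by (auto simp: e_def field_simps)
    obtain M where M: "1 / real (Suc M) < \<eta> / 2"
      using \<eta> by (metis half_gt_zero_iff nat_approx_posE)
    obtain n0 where n0: "\<And>n i. n \<ge> n0 \<Longrightarrow> i \<in> I \<Longrightarrow> \<bar>v (r n) i - u i\<bar> < e"
      using u[OF e(1)] by (auto simp: eventually_sequentially dist_real_def)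
    define n where "n = max n0 M"
    define m where "m = r n"
    have "M \<le> m" using seq_suble[OF r, of n] by (simp add: m_def n_def)
    then have "1 / real (Suc m) \<le> 1 / real (Suc M)" by (simp add: frac_le)
    then have Nm: "N m < \<eta> / 2" using N_less[of m] M by linarith
    define k where "k = \<lfloor>t / N m\<rfloor>"
    have "of_int k \<le> t / N m" "t / N m < of_int k + 1" unfolding k_def by linarith+
    then have k: "of_int k * N m \<le> t" "t < of_int k * N m + N m"
      using N_pos[of m] by (auto simp: field_simps)
    have "\<bar>of_int k * g m i - t * u i\<bar> < \<eta>" if i: "i \<in> I" for i
    proof -
      have "of_int k * g m i - t * u i = (of_int k * N m - t) * v m i + t * (v m i - u i)"
        using N_pos[of m] by (simp add: v_def field_simps)
      also have "\<bar>\<dots>\<bar> \<le> \<bar>of_int k * N m - t\<bar> * \<bar>v m i\<bar> + \<bar>t\<bar> * \<bar>v m i - u i\<bar>"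
        by (metis abs_mult abs_triangle_ineq)
      also have "\<dots> \<le> N m * 1 + \<bar>t\<bar> * e"
        using k v_le[OF i, of m] n0[of n i] i N_pos[of m]
        by (intro add_mono mult_mono) (auto simp: m_def n_def)
      also have "\<dots> < \<eta>" using Nm e(2) by simp
      finally show ?thesis .
    qed
    then show ?thesis
      by (intro bexI[of _ "\<lambda>i. of_int k * g m i"] mult_int[OF g(1)]) simp
  qed
  ultimately show ?thesis by blast
qed

text \<open>Kronecker's dichotomy, by induction on the dimension. If \<open>G\<close> has
  arbitrarily short nonzero elements, its closure contains a line, and density of the projection
  along this line lifts to \<open>G\<close>. Otherwise \<open>G\<close> is discrete and a nearly
  shortest \<open>u\<close> serves as direction: a dense projection would produce a nonzero element
  that is too short. In both cases a functional on the projection extends to \<open>I\<close>; in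
  dimension one, discreteness makes all elements multiples of \<open>u\<close>.\<close>

theorem subgroup_dense_or_integral_functional:
  fixes G :: "('i \<Rightarrow> real) set"
  assumes "finite I" "(\<lambda>_. 0) \<in> G"
    and "\<And>g h. g \<in> G \<Longrightarrow> h \<in> G \<Longrightarrow> (\<lambda>i. g i + h i) \<in> G"
    and "\<And>g. g \<in> G \<Longrightarrow> (\<lambda>i. - g i) \<in> G"
  shows "(\<forall>y. \<forall>\<epsilon>>0. \<exists>g\<in>G. \<forall>i\<in>I. \<bar>g i - y i\<bar> < \<epsilon>) \<or>
    (\<exists>c. (\<exists>i\<in>I. c i \<noteq> 0) \<and> (\<forall>g\<in>G. (\<Sum>i\<in>I. c i * g i) \<in> \<int>))"
  using assms
proof (induction "card I" arbitrary: I G rule: less_induct)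
  case (less I G)
  note I = less.prems(1) and zero = less.prems(2) and add = less.prems(3) and um = less.prems(4)
  let ?dual = "\<lambda>I G. \<exists>c. (\<exists>i\<in>I. c i \<noteq> 0) \<and> (\<forall>g\<in>G. (\<Sum>i\<in>I. c i * g i) \<in> \<int>)"
  text \<open>Projecting along \<open>u\<close> onto the hyperplane where the coordinate \<open>l\<close> vanishes.\<close>
  have project: "?dual I G \<or> (\<forall>y. \<forall>\<epsilon>>0. \<exists>g\<in>G. \<forall>i\<in>I - {l}. \<bar>g i - g l / u l * u i - y i\<bar> < \<epsilon>)"
    if l: "l \<in> I" "u l \<noteq> 0" for u l
  proof -
    define \<pi> where "\<pi> g = (\<lambda>i. g i - g l / u l * u i)" for g
    have \<pi>_add: "(\<lambda>i. \<pi> g i + \<pi> h i) = \<pi> (\<lambda>i. g i + h i)" for g h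
      by (auto simp: \<pi>_def add_divide_distrib algebra_simps)
    have \<pi>_um: "(\<lambda>i. - \<pi> g i) = \<pi> (\<lambda>i. - g i)" for g
      by (auto simp: \<pi>_def algebra_simps)
    have "(\<forall>y. \<forall>\<epsilon>>0. \<exists>g\<in>\<pi> ` G. \<forall>i\<in>I - {l}. \<bar>g i - y i\<bar> < \<epsilon>) \<or> ?dual (I - {l}) (\<pi> ` G)"
    proof (rule less.hyps)
      show "card (I - {l}) < card I" using I l by (meson card_Diff1_less)
      show "finite (I - {l})" using I by simp
      show "(\<lambda>_. 0) \<in> \<pi> ` G" by (rule image_eqI[OF _ zero]) (simp add: \<pi>_def)
      show "(\<lambda>i. g i + h i) \<in> \<pi> ` G" if "g \<in> \<pi> ` G" "h \<in> \<pi> ` G" for g h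
        using that add by (auto simp: \<pi>_add)
      show "(\<lambda>i. - g i) \<in> \<pi> ` G" if "g \<in> \<pi> ` G" for g
        using that um by (auto simp: \<pi>_um)
    qed
    then show ?thesis
    proof
      assume "?dual (I - {l}) (\<pi> ` G)"
      then obtain c where c: "\<exists>i\<in>I - {l}. c i \<noteq> 0" "\<And>g. g \<in> G \<Longrightarrow> (\<Sum>i\<in>I - {l}. c i * \<pi> g i) \<in> \<int>"
        by auto
      \<comment> \<open>The entry at \<open>l\<close> is chosen to make the functional vanish on
        \<open>u\<close>, so that it takes the same value on \<open>g\<close> and on its
        projection.\<close>
      define c' where "c' = c(l := - (\<Sum>i\<in>I - {l}. c i * u i) / u l)"
      have "(\<Sum>i\<in>I. c' i * g i) = (\<Sum>i\<in>I - {l}. c i * \<pi> g i)" for g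
      proof -
        have "(\<Sum>i\<in>I. c' i * g i) = c' l * g l + (\<Sum>i\<in>I - {l}. c' i * g i)"
          using I l by (simp add: sum.remove)
        also have "(\<Sum>i\<in>I - {l}. c' i * g i) = (\<Sum>i\<in>I - {l}. c i * g i)"
          by (intro sum.cong) (auto simp: c'_def)
        also have "c' l * g l = - (\<Sum>i\<in>I - {l}. c i * (g l / u l * u i))"
          by (simp add: c'_def sum_distrib_left sum_distrib_right sum_divide_distrib ac_simps)
        finally show ?thesis by (simp add: \<pi>_def right_diff_distrib sum_subtractf)
      qed
      moreover have "\<exists>i\<in>I. c' i \<noteq> 0" using c(1) by (auto simp: c'_def)
      ultimately show ?thesis using c(2) by (intro disjI1 exI[of _ c']) auto
    qed (auto simp: \<pi>_def)
  qed
  show ?case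
  proof (cases "\<exists>g\<in>G. \<exists>i\<in>I. g i \<noteq> 0")
    case False
    show ?thesis
    proof (cases "I = {}")
      case True
      then show ?thesis using zero by auto
    next
      case 2: False
      have "?dual I G" using False 2 by (intro exI[of _ "\<lambda>_. 1"]) auto
      then show ?thesis ..
    qed
  next
    case nontrivial: True
    show ?thesis
    proof (cases "\<forall>\<delta>>0. \<exists>g\<in>G. (\<exists>i\<in>I. g i \<noteq> 0) \<and> (\<forall>i\<in>I. \<bar>g i\<bar> < \<delta>)")
      case True
      then have "\<exists>u. \<exists>l\<in>I. u l \<noteq> 0 \<and> (\<forall>t. \<forall>\<eta>>0. \<exists>g\<in>G. \<forall>i\<in>I. \<bar>g i - t * u i\<bar> < \<eta>)"
        by (intro subgroup_line_limit[OF I zero]) (simp_all add: add um)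
      then obtain u l where l: "l \<in> I" "u l \<noteq> 0"
        and u: "\<And>t \<eta>. \<eta> > 0 \<Longrightarrow> \<exists>g\<in>G. \<forall>i\<in>I. \<bar>g i - t * u i\<bar> < \<eta>"
        by blast
      from project[of l u, OF l] show ?thesis
      proof
        assume D: "\<forall>y. \<forall>\<epsilon>>0. \<exists>g\<in>G. \<forall>i\<in>I - {l}. \<bar>g i - g l / u l * u i - y i\<bar> < \<epsilon>"
        have "\<exists>g\<in>G. \<forall>i\<in>I. \<bar>g i - y i\<bar> < \<epsilon>" if \<epsilon>: "\<epsilon> > 0" for y \<epsilon>
        proof -
          have "\<epsilon> / 2 > 0" using \<epsilon> by simp
          from D[rule_format, OF this, of "\<lambda>i. y i - y l / u l * u i"] obtain g where g: "g \<in> G"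
            "\<And>i. i \<in> I - {l} \<Longrightarrow> \<bar>g i - g l / u l * u i - (y i - y l / u l * u i)\<bar> < \<epsilon> / 2"
            by blast
          \<comment> \<open>Moving along \<open>u\<close> by \<open>t\<close> corrects the
            coordinate \<open>l\<close> exactly; the other coordinates then differ from
            \<open>y\<close> as the projections do.\<close>
          define t where "t = (y l - g l) / u l"
          have t: "\<bar>y i - g i - t * u i\<bar> < \<epsilon> / 2" if "i \<in> I" for i
          proof (cases "i = l")
            case False
            have "y i - g i - t * u i = - (g i - g l / u l * u i - (y i - y l / u l * u i))"
              by (simp add: t_def algebra_simps diff_divide_distrib)
            then show ?thesis using g(2)[of i] that False by (metis abs_minus_cancel Diff_iff singletonD)
          qed (use l \<epsilon> in \<open>simp add: t_def\<close>)
          obtain h where h: "h \<in> G" "\<And>i. i \<in> I \<Longrightarrow> \<bar>h i - t * u i\<bar> < \<epsilon> / 2"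
            using u[of "\<epsilon> / 2" t] \<epsilon> by auto
          have "\<bar>(g i + h i) - y i\<bar> < \<epsilon>" if "i \<in> I" for i
            using t[OF that] h(2)[OF that] by linarith
          then show ?thesis
            by (intro bexI[of _ "\<lambda>i. g i + h i"] add g(1) h(1)) simp
        qed
        then show ?thesis by blast
      qed blast
    next
      case False
      then obtain \<delta> where "\<delta> > 0" and *: "\<not> (\<exists>g\<in>G. (\<exists>i\<in>I. g i \<noteq> 0) \<and> (\<forall>i\<in>I. \<bar>g i\<bar> < \<delta>))"
        by blast
      then have \<delta>: "\<delta> > 0" "\<And>g. g \<in> G \<Longrightarrow> \<exists>i\<in>I. g i \<noteq> 0 \<Longrightarrow> \<exists>i\<in>I. \<bar>g i\<bar> \<ge> \<delta>"
        by (meson linorder_not_le)+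
      have I0: "I \<noteq> {}" using nontrivial by auto
      define N where "N g = Max ((\<lambda>i. \<bar>g i\<bar>) ` I)" for g :: "'i \<Rightarrow> real"
      have N_ge: "\<bar>g i\<bar> \<le> N g" if "i \<in> I" for g i
        unfolding N_def using I that by (intro Max_ge) auto
      have N_in: "\<exists>i\<in>I. N g = \<bar>g i\<bar>" for g
      proof -
        have "N g \<in> (\<lambda>i. \<bar>g i\<bar>) ` I" unfolding N_def using I I0 by (intro Max_in) auto
        then show ?thesis by auto
      qed
      define S where "S = N ` {g\<in>G. \<exists>i\<in>I. g i \<noteq> 0}"
      have S: "S \<noteq> {}" "\<And>x. x \<in> S \<Longrightarrow> x \<ge> \<delta>"
      proof -
        show "S \<noteq> {}" using nontrivial by (auto simp: S_def)
        fix x assume "x \<in> S"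
        then obtain g where "g \<in> G" "\<exists>i\<in>I. g i \<noteq> 0" "x = N g" by (auto simp: S_def)
        then show "x \<ge> \<delta>" using \<delta>(2)[of g] N_ge[of _ g] by force
      qed
      have bdd: "bdd_below S" using S(2) by (auto simp: bdd_below_def)
      define m where "m = Inf S"
      have m: "m \<ge> \<delta>" unfolding m_def using S by (intro cInf_greatest) auto
      have m_le: "m \<le> N g" if "g \<in> G" "\<exists>i\<in>I. g i \<noteq> 0" for g
        unfolding m_def using that bdd by (intro cInf_lower) (auto simp: S_def)
      \<comment> \<open>The infimum need not be attained, but a factor below 2 is enough:
        subtracting the nearest multiple of \<open>u\<close> leaves at most half of
        \<open>N u\<close>, here less than \<open>3 / 4 * m\<close>.\<close>
      have "Inf S < 3 / 2 * m" using m \<delta>(1) by (simp add: m_def)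
      then obtain x where "x \<in> S" "x < 3 / 2 * m"
        using cInf_lessD[OF S(1)] by blast
      then obtain u where u: "u \<in> G" "\<exists>i\<in>I. u i \<noteq> 0" "N u < 3 / 2 * m"
        by (auto simp: S_def)
      obtain l where l: "l \<in> I" "N u = \<bar>u l\<bar>" using N_in by blast
      have ul: "u l \<noteq> 0" using m_le[OF u(1,2)] m \<delta>(1) l(2) by auto
      have reduce: "\<exists>h\<in>G. \<bar>h l\<bar> \<le> N u / 2 \<and> (\<exists>k::int. h = (\<lambda>i. g i - of_int k * u i))
          \<and> (\<forall>i\<in>I. \<bar>h i - (g i - g l / u l * u i)\<bar> \<le> N u / 2)" if g: "g \<in> G" for g
      proof -
        have mult_nat: "(\<lambda>i. of_nat k * u i) \<in> G" for k
        proof (induction k)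
          case (Suc k)
          from add[OF this u(1)] show ?case by (simp add: algebra_simps)
        qed (use zero in simp)
        have mult_int: "(\<lambda>i. of_int k * u i) \<in> G" for k
          using mult_nat[of "nat k"] um[OF mult_nat[of "nat (- k)"]]
          by (cases "k \<ge> 0") auto
        define k where "k = round (g l / u l)"
        have k: "\<bar>g l / u l - of_int k\<bar> \<le> 1 / 2"
          unfolding k_def using of_int_round_abs_le[of "g l / u l"] by linarith
        have *: "\<bar>(g l / u l - of_int k) * u i\<bar> \<le> N u / 2" if "i \<in> I" for i
          using mult_mono[OF k N_ge[OF that, of u]] by (simp add: abs_mult)
        have "(\<lambda>i. g i + - (of_int k * u i)) \<in> G"
          by (intro add g um mult_int)
        moreover have "\<bar>g l - of_int k * u l\<bar> \<le> N u / 2"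
          using *[OF l(1)] ul by (simp add: left_diff_distrib)
        moreover have "\<bar>(g i - of_int k * u i) - (g i - g l / u l * u i)\<bar> \<le> N u / 2" if "i \<in> I" for i
          using *[OF that] by (simp add: left_diff_distrib)
        ultimately show ?thesis
          by (intro bexI[of _ "\<lambda>i. g i - of_int k * u i"]) auto
      qed
      show ?thesis
      proof (cases "I = {l}")
        case True
        have "g l / u l \<in> \<int>" if g: "g \<in> G" for g
        proof -
          obtain h k where h: "h \<in> G" "\<bar>h l\<bar> \<le> N u / 2" "h = (\<lambda>i. g i - of_int k * u i)"
            using reduce[OF g] by blast
          have "N h = \<bar>h l\<bar>" by (simp add: N_def True)
          then have "\<not> m \<le> N h" using h(2) u(3) m \<delta>(1) by linarith
          then have "h l = 0" using m_le[OF h(1)] l(1) by blast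
          then have "g l / u l = of_int k" using h(3) ul by (simp add: field_simps)
          then show ?thesis by simp
        qed
        then have "?dual I G" using ul by (intro exI[of _ "\<lambda>_. 1 / u l"]) (simp add: True)
        then show ?thesis ..
      next
        case False
        then obtain j where j: "j \<in> I - {l}" using l by blast
        have "\<not> (\<forall>y. \<forall>\<epsilon>>0. \<exists>g\<in>G. \<forall>i\<in>I - {l}. \<bar>g i - g l / u l * u i - y i\<bar> < \<epsilon>)"
        proof
          assume D: "\<forall>y. \<forall>\<epsilon>>0. \<exists>g\<in>G. \<forall>i\<in>I - {l}. \<bar>g i - g l / u l * u i - y i\<bar> < \<epsilon>"
          \<comment> \<open>Centre and radius are both \<open>m / 16\<close>, so the projected
            coordinates lie strictly between 0 and \<open>m / 8\<close>. They are nonzero, yet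
            together with the \<open>3 / 4 * m\<close> from the reduction they stay below
            \<open>m\<close>, which forces the reduced element to vanish and \<open>g\<close> to be
            a multiple of \<open>u\<close>.\<close>
          have "m / 16 > 0" using m \<delta>(1) by simp
          from D[rule_format, OF this, of "\<lambda>_. m / 16"] obtain g where g: "g \<in> G"
            "\<And>i. i \<in> I - {l} \<Longrightarrow> \<bar>g i - g l / u l * u i - m / 16\<bar> < m / 16" by blast
          obtain h k where h: "h \<in> G" "\<bar>h l\<bar> \<le> N u / 2" "h = (\<lambda>i. g i - of_int k * u i)"
            "\<And>i. i \<in> I \<Longrightarrow> \<bar>h i - (g i - g l / u l * u i)\<bar> \<le> N u / 2"
            using reduce[OF g(1)] by blast
          have "\<bar>h i\<bar> < m" if "i \<in> I" for i
          proof (cases "i = l")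
            case True
            then show ?thesis using h(2) u(3) m \<delta>(1) by simp
          next
            case False
            then have "i \<in> I - {l}" using that by blast
            from g(2)[OF this] h(4)[OF that] u(3) m \<delta>(1) show ?thesis by arith
          qed
          then have "N h < m" using N_in[of h] by auto
          then have "\<not> m \<le> N h" by simp
          then have h0: "h i = 0" if "i \<in> I" for i using m_le[OF h(1)] that by blast
          then have "g l = of_int k * u l" "g j = of_int k * u j"
            using h0[of l] h0[of j] h(3) l(1) j by simp_all
          then have "g j - g l / u l * u j = 0" using ul by simp
          then show False using g(2)[OF j] \<open>m / 16 > 0\<close> by simp
        qed
        then show ?thesis using project[of l u] l(1) ul by blast
      qed
    qed
  qed
qed

section \<open>The spectrum of a self-similarity\<close>

text \<open>Every integer vector is a sum of differences of window points \<open>W\<close>, and the number of summands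
  is controlled by the size of its image under \<open>q\<close>.\<close>

lemma window_chain_induct:
  fixes q :: "nat \<Rightarrow> nat \<Rightarrow> real" and W :: "(nat \<Rightarrow> int) set"
  assumes dense: "\<And>y \<epsilon>. \<epsilon> > 0 \<Longrightarrow> \<exists>r :: nat \<Rightarrow> int. \<forall>i<d. \<bar>(\<Sum>j<s. q i j * of_int (r j)) - y i\<bar> < \<epsilon>"
    and eps: "\<epsilon> > 0"
    and W: "\<And>r. (\<And>i. i < d \<Longrightarrow> \<bar>(\<Sum>j<s. q i j * of_int (r j)) - y i\<bar> < \<epsilon>) \<Longrightarrow> r \<in> W"
    and base: "\<And>a b. a \<in> W \<Longrightarrow> b \<in> W \<Longrightarrow> \<Phi> 0 (\<lambda>j. a j - b j)"
    and step: "\<And>m r a b. \<Phi> m r \<Longrightarrow> a \<in> W \<Longrightarrow> b \<in> W \<Longrightarrow> \<Phi> (Suc m) (\<lambda>j. r j + (a j - b j))"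
  shows "\<exists>\<eta>>0. \<forall>m r. (\<forall>i<d. \<bar>\<Sum>j<s. q i j * of_int (r j)\<bar> \<le> real (Suc m) * \<eta>) \<longrightarrow> \<Phi> m r"
proof -
  define Q where "Q r i = (\<Sum>j<s. q i j * of_int (r j))" for r :: "nat \<Rightarrow> int" and i
  have Q_add: "Q (\<lambda>j. a j + b j) i = Q a i + Q b i" for a b i
    by (simp add: Q_def algebra_simps sum.distrib)
  have Q_diff: "Q (\<lambda>j. a j - b j) i = Q a i - Q b i" for a b i
    by (simp add: Q_def algebra_simps sum_subtractf)
  \<comment> \<open>Half of \<open>\<epsilon>\<close> absorbs the distance of \<open>b\<close> from
    the centre; the other half is \<open>2 * \<eta>\<close>, the size of an increment that keeps
    \<open>b\<close> in \<open>W\<close>.\<close>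
  define \<eta> where "\<eta> = \<epsilon> / 4"
  have \<eta>: "\<eta> > 0" using eps by (simp add: \<eta>_def)
  obtain b where b: "\<And>i. i < d \<Longrightarrow> \<bar>Q b i - y i\<bar> < \<epsilon> / 2"
    using dense[of "\<epsilon> / 2" y] eps by (auto simp: Q_def)
  have bW: "b \<in> W"
  proof (rule W)
    show "\<bar>(\<Sum>j<s. q i j * of_int (b j)) - y i\<bar> < \<epsilon>" if "i < d" for i
      using b[OF that] eps by (simp add: Q_def)
  qed
  have small: "(\<lambda>j. b j + r j) \<in> W" if r: "\<And>i. i < d \<Longrightarrow> \<bar>Q r i\<bar> \<le> 2 * \<eta>" for r
  proof (rule W)
    show "\<bar>(\<Sum>j<s. q i j * of_int (b j + r j)) - y i\<bar> < \<epsilon>" if i: "i < d" for i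
    proof -
      have "\<bar>Q (\<lambda>j. b j + r j) i - y i\<bar> < \<epsilon>"
        using b[OF i] r[OF i] unfolding Q_add \<eta>_def by linarith
      then show ?thesis by (simp add: Q_def)
    qed
  qed
  have "\<Phi> m r" if "\<And>i. i < d \<Longrightarrow> \<bar>Q r i\<bar> \<le> real (Suc m) * \<eta>" for m r
    using that
  proof (induction m arbitrary: r)
    case 0
    have "(\<lambda>j. b j + r j) \<in> W"
    proof (rule small)
      show "\<bar>Q r i\<bar> \<le> 2 * \<eta>" if "i < d" for i using 0[OF that] \<eta> by simp
    qed
    from base[OF this bW] show ?case by simp
  next
    case (Suc m)
    \<comment> \<open>Chosen so that \<open>c * (m + 2) = m + 1 / 2\<close>: after rounding with
      error \<open>\<eta> / 2\<close> the vector \<open>r1\<close> falls under the induction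
      hypothesis, and the remainder is at most \<open>3 / 2 * \<eta> + \<eta> / 2\<close>, which a
      single further difference bridges.\<close>
    define c where "c = (real m + 1 / 2) / (real m + 2)"
    have c: "0 \<le> c" "1 - c = (3 / 2) / (real m + 2)" by (auto simp: c_def field_simps)
    obtain r1 where r1: "\<And>i. i < d \<Longrightarrow> \<bar>Q r1 i - c * Q r i\<bar> < \<eta> / 2"
      using dense[of "\<eta> / 2" "\<lambda>i. c * Q r i"] \<eta> by (auto simp: Q_def)
    have Qr: "\<bar>Q r i\<bar> \<le> (real m + 2) * \<eta>" if "i < d" for i
      using Suc.prems[OF that] by (simp add: algebra_simps)
    have "\<bar>Q r1 i\<bar> \<le> real (Suc m) * \<eta>" if i: "i < d" for i
    proof -
      have "\<bar>c * Q r i\<bar> \<le> c * ((real m + 2) * \<eta>)"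
        using c(1) Qr[OF i] by (simp add: abs_mult mult_left_mono)
      also have "\<dots> = (real m + 1 / 2) * \<eta>" by (simp add: c_def)
      finally have "\<bar>c * Q r i\<bar> \<le> (real m + 1 / 2) * \<eta>" .
      moreover have "real (Suc m) * \<eta> = (real m + 1 / 2) * \<eta> + \<eta> / 2" by (simp add: algebra_simps)
      ultimately show ?thesis using r1[OF i] by linarith
    qed
    then have "\<Phi> m r1" by (rule Suc.IH)
    moreover have "(\<lambda>j. b j + (r j - r1 j)) \<in> W"
    proof (rule small)
      show "\<bar>Q (\<lambda>j. r j - r1 j) i\<bar> \<le> 2 * \<eta>" if i: "i < d" for i
      proof -
        have "0 \<le> 1 - c" by (simp add: c(2))
        then have "\<bar>(1 - c) * Q r i\<bar> \<le> (1 - c) * ((real m + 2) * \<eta>)"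
          using mult_left_mono[OF Qr[OF i], of "1 - c"] by (simp only: abs_mult abs_of_nonneg)
        also have "\<dots> = 3 / 2 * \<eta>" by (simp add: c(2) field_simps)
        finally have "\<bar>(1 - c) * Q r i\<bar> \<le> 3 / 2 * \<eta>" .
        moreover have "Q r i - Q r1 i = (1 - c) * Q r i - (Q r1 i - c * Q r i)" by (simp add: algebra_simps)
        ultimately show ?thesis using r1[OF i] unfolding Q_diff by linarith
      qed
    qed
    ultimately have "\<Phi> (Suc m) (\<lambda>j. r1 j + ((b j + (r j - r1 j)) - b j))"
      using bW by (rule step)
    then show ?case by simp
  qed
  with \<eta> show ?thesis by (auto simp: Q_def)
qed

text \<open>Rounding a large multiple \<open>t\<close> of \<open>x\<close> to integers leaves a
  \<open>q\<close>-image of size independent of \<open>t\<close>, as \<open>x\<close> is in the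
  kernel. A fixed number of differences from \<open>W\<close> reaches it, so \<open>f\<close> is
  bounded on it; but \<open>f\<close> grows like \<open>t\<close> times its value at
  \<open>x\<close>.\<close>

lemma bounded_functional_vanishes_on_kernel:
  fixes q :: "nat \<Rightarrow> nat \<Rightarrow> real" and W :: "(nat \<Rightarrow> int) set" and f x :: "nat \<Rightarrow> real"
  assumes dense: "\<And>y \<epsilon>. \<epsilon> > 0 \<Longrightarrow> \<exists>r :: nat \<Rightarrow> int. \<forall>i<d. \<bar>(\<Sum>j<s. q i j * of_int (r j)) - y i\<bar> < \<epsilon>"
    and eps: "\<epsilon> > 0"
    and W: "\<And>r. (\<And>i. i < d \<Longrightarrow> \<bar>(\<Sum>j<s. q i j * of_int (r j)) - y i\<bar> < \<epsilon>) \<Longrightarrow> r \<in> W"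
    and f: "\<And>r. r \<in> W \<Longrightarrow> \<bar>\<Sum>j<s. f j * of_int (r j)\<bar> \<le> K"
    and x: "\<And>i. i < d \<Longrightarrow> (\<Sum>j<s. q i j * x j) = 0"
  shows "(\<Sum>j<s. f j * x j) = 0"
proof (rule ccontr)
  define F where "F r = (\<Sum>j<s. f j * of_int (r j))" for r :: "nat \<Rightarrow> int"
  have F_add: "F (\<lambda>j. a j + (b j - c j)) = F a + (F b - F c)" for a b c
    by (simp add: F_def algebra_simps sum.distrib sum_subtractf)
  have F_diff: "F (\<lambda>j. b j - c j) = F b - F c" for b c
    by (simp add: F_def algebra_simps sum_subtractf)
  have "\<exists>\<eta>>0. \<forall>m r. (\<forall>i<d. \<bar>\<Sum>j<s. q i j * of_int (r j)\<bar> \<le> real (Suc m) * \<eta>)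
      \<longrightarrow> \<bar>F r\<bar> \<le> real (Suc m) * (2 * K)"
  proof (rule window_chain_induct[OF dense eps W])
    fix a b assume "a \<in> W" "b \<in> W"
    then show "\<bar>F (\<lambda>j. a j - b j)\<bar> \<le> real (Suc 0) * (2 * K)"
      using f[of a] f[of b] by (simp add: F_diff F_def[symmetric])
  next
    fix m r a b assume "\<bar>F r\<bar> \<le> real (Suc m) * (2 * K)" "a \<in> W" "b \<in> W"
    moreover from this have "\<bar>F a\<bar> \<le> K" "\<bar>F b\<bar> \<le> K" using f by (simp_all add: F_def)
    ultimately show "\<bar>F (\<lambda>j. r j + (a j - b j))\<bar> \<le> real (Suc (Suc m)) * (2 * K)"
      unfolding F_add by (simp add: algebra_simps)
  qed
  then obtain \<eta> where \<eta>: "\<eta> > 0" "\<And>m r. (\<forall>i<d. \<bar>\<Sum>j<s. q i j * of_int (r j)\<bar> \<le> real (Suc m) * \<eta>)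
      \<Longrightarrow> \<bar>F r\<bar> \<le> real (Suc m) * (2 * K)"
    by blast
  define R where "R = (\<Sum>i<d. \<Sum>j<s. \<bar>q i j\<bar>)"
  obtain m where m: "R \<le> real m * \<eta>" using \<eta>(1) by (metis real_arch_simple pos_divide_le_eq)
  define C where "C = real (Suc m) * (2 * K) + (\<Sum>j<s. \<bar>f j\<bar>)"
  assume nz: "(\<Sum>j<s. f j * x j) \<noteq> 0"
  have le: "real t * \<bar>\<Sum>j<s. f j * x j\<bar> \<le> C" for t :: nat
  proof -
    define r where "r j = \<lfloor>real t * x j\<rfloor>" for j
    have r: "real_of_int (r j) = real t * x j - frac (real t * x j)" for j
      by (simp add: r_def frac_def)
    have est: "\<bar>\<Sum>j<s. g j * frac (real t * x j)\<bar> \<le> (\<Sum>j<s. \<bar>g j\<bar>)" for g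
    proof -
      have "\<bar>\<Sum>j<s. g j * frac (real t * x j)\<bar> \<le> (\<Sum>j<s. \<bar>g j * frac (real t * x j)\<bar>)" by (rule sum_abs)
      also have "\<dots> \<le> (\<Sum>j<s. \<bar>g j\<bar>)"
        by (intro sum_mono) (simp add: abs_mult mult_left_le[OF less_imp_le[OF frac_lt_1]])
      finally show ?thesis .
    qed
    have lin: "(\<Sum>j<s. g j * of_int (r j)) = real t * (\<Sum>j<s. g j * x j) - (\<Sum>j<s. g j * frac (real t * x j))" for g
      by (simp add: r sum_distrib_left right_diff_distrib sum_subtractf ac_simps)
    have "\<bar>\<Sum>j<s. q i j * of_int (r j)\<bar> \<le> real (Suc m) * \<eta>" if i: "i < d" for i
    proof -
      have "\<bar>\<Sum>j<s. q i j * of_int (r j)\<bar> \<le> (\<Sum>j<s. \<bar>q i j\<bar>)"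
        using est[of "q i"] by (simp add: lin x[OF i])
      also have "\<dots> \<le> R" unfolding R_def using i by (intro member_le_sum) (auto intro: sum_nonneg)
      finally show ?thesis using m \<eta>(1) by (simp add: algebra_simps)
    qed
    then have "\<bar>F r\<bar> \<le> real (Suc m) * (2 * K)" using \<eta>(2) by blast
    moreover have "real t * \<bar>\<Sum>j<s. f j * x j\<bar> = \<bar>F r + (\<Sum>j<s. f j * frac (real t * x j))\<bar>"
      by (simp add: F_def lin abs_mult)
    ultimately show ?thesis using est[of f] unfolding C_def by linarith
  qed
  obtain t where "C < real t * \<bar>\<Sum>j<s. f j * x j\<bar>"
    using nz reals_Archimedean3[of "\<bar>\<Sum>j<s. f j * x j\<bar>"] by auto
  with le[of t] show False by simp
qed

text \<open>\<open>w i\<close> is the \<open>i\<close>-th iterate of \<open>w 0\<close> under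
  \<open>B\<close>. When a linear factor is split off \<open>p\<close>, leaving \<open>q\<close>,
  either \<open>q(B)\<close> applied to \<open>w 0\<close> is an eigenvector for the root split off,
  or it is 0 and \<open>q\<close> replaces \<open>p\<close>.\<close>

lemma annihilating_poly_eigenvector:
  fixes B :: "nat \<Rightarrow> nat \<Rightarrow> complex" and w :: "nat \<Rightarrow> nat \<Rightarrow> complex"
  assumes w: "\<And>i j. j < d \<Longrightarrow> w (Suc i) j = (\<Sum>k<d. B j k * w i k)"
    and "p \<noteq> 0" "\<And>j. j < d \<Longrightarrow> (\<Sum>i\<le>degree p. coeff p i * w i j) = 0"
    and nz: "\<exists>j<d. w 0 j \<noteq> 0"
  shows "\<exists>\<nu> x. poly p \<nu> = 0 \<and> (\<exists>j<d. x j \<noteq> 0) \<and> (\<forall>j<d. (\<Sum>k<d. B j k * x k) = \<nu> * x j)"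
  using assms(2,3)
proof (induction "degree p" arbitrary: p)
  case 0
  then obtain c where "p = [:c:]" by (metis degree_eq_zeroE)
  with 0 nz show ?case by auto
next
  case (Suc m)
  then have "\<not> constant (poly p)" by (simp add: constant_degree)
  then obtain \<nu> where \<nu>: "poly p \<nu> = 0" using fundamental_theorem_of_algebra by blast
  then obtain q where q: "p = [:-\<nu>, 1:] * q" by (metis dvdE poly_eq_0_iff_dvd)
  have q0: "q \<noteq> 0" using Suc.prems(1) q by auto
  have deg: "degree p = Suc (degree q)" using q0 unfolding q by (subst degree_mult_eq) auto
  define x where "x j = (\<Sum>i\<le>degree q. coeff q i * w i j)" for j
  have eig: "(\<Sum>k<d. B j k * x k) = \<nu> * x j" if j: "j < d" for j
  proof -
    have shift: "(\<Sum>i\<le>Suc (degree q). coeff (pCons 0 q) i * w i j) = (\<Sum>i\<le>degree q. coeff q i * w (Suc i) j)"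
      by (subst sum.atMost_Suc_shift) simp
    have "(\<Sum>i\<le>Suc (degree q). coeff p i * w i j)
        = (\<Sum>i\<le>Suc (degree q). coeff (pCons 0 q) i * w i j) - \<nu> * (\<Sum>i\<le>Suc (degree q). coeff q i * w i j)"
      by (simp only: q mult_pCons_left) (simp add: algebra_simps sum_distrib_left sum_subtractf)
    also have "(\<Sum>i\<le>Suc (degree q). coeff q i * w i j) = x j"
      by (simp add: x_def coeff_eq_0)
    finally have "(\<Sum>i\<le>degree q. coeff q i * w (Suc i) j) = \<nu> * x j"
      using Suc.prems(2)[OF j] shift deg by simp
    moreover have "(\<Sum>k<d. B j k * x k) = (\<Sum>i\<le>degree q. coeff q i * w (Suc i) j)"
      unfolding x_def w[OF j] sum_distrib_left by (subst sum.swap) (simp add: ac_simps)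
    ultimately show ?thesis by simp
  qed
  show ?case
  proof (cases "\<exists>j<d. x j \<noteq> 0")
    case True
    then show ?thesis using \<nu> eig by blast
  next
    case False
    then have "\<exists>\<nu> x. poly q \<nu> = 0 \<and> (\<exists>j<d. x j \<noteq> 0) \<and> (\<forall>j<d. (\<Sum>k<d. B j k * x k) = \<nu> * x j)"
      using Suc.hyps(2) deg q0 by (intro Suc.hyps(1)) (auto simp: x_def)
    then show ?thesis unfolding q by auto
  qed
qed

lemma window_generates:
  fixes q :: "nat \<Rightarrow> nat \<Rightarrow> real" and W :: "(nat \<Rightarrow> int) set"
  assumes dense: "\<And>y \<epsilon>. \<epsilon> > 0 \<Longrightarrow> \<exists>r :: nat \<Rightarrow> int. \<forall>i<d. \<bar>(\<Sum>j<s. q i j * of_int (r j)) - y i\<bar> < \<epsilon>"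
    and eps: "\<epsilon> > 0"
    and W: "\<And>r. (\<And>i. i < d \<Longrightarrow> \<bar>(\<Sum>j<s. q i j * of_int (r j)) - y i\<bar> < \<epsilon>) \<Longrightarrow> r \<in> W"
    and base: "\<And>a b. a \<in> W \<Longrightarrow> b \<in> W \<Longrightarrow> \<Phi> (\<lambda>j. a j - b j)"
    and step: "\<And>r a b. \<Phi> r \<Longrightarrow> a \<in> W \<Longrightarrow> b \<in> W \<Longrightarrow> \<Phi> (\<lambda>j. r j + (a j - b j))"
  shows "\<Phi> r"
proof -
  have "\<exists>\<eta>>0. \<forall>m r. (\<forall>i<d. \<bar>\<Sum>j<s. q i j * of_int (r j)\<bar> \<le> real (Suc m) * \<eta>) \<longrightarrow> \<Phi> r"
    by (rule window_chain_induct[OF dense eps W]) (use base step in auto)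
  then obtain \<eta> where \<eta>: "\<eta> > 0"
    "\<And>m r. \<forall>i<d. \<bar>\<Sum>j<s. q i j * of_int (r j)\<bar> \<le> real (Suc m) * \<eta> \<Longrightarrow> \<Phi> r" by blast
  obtain m where "(\<Sum>i<d. \<bar>\<Sum>j<s. q i j * of_int (r j)\<bar>) / \<eta> \<le> real m"
    using real_arch_simple by blast
  then have m: "(\<Sum>i<d. \<bar>\<Sum>j<s. q i j * of_int (r j)\<bar>) \<le> real m * \<eta>"
    using \<eta>(1) by (simp add: pos_divide_le_eq)
  have "\<bar>\<Sum>j<s. q i j * of_int (r j)\<bar> \<le> real (Suc m) * \<eta>" if "i < d" for i
  proof -
    have "\<bar>\<Sum>j<s. q i j * of_int (r j)\<bar> \<le> (\<Sum>i<d. \<bar>\<Sum>j<s. q i j * of_int (r j)\<bar>)"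
      using that by (intro member_le_sum) auto
    with m \<eta>(1) show ?thesis by (simp add: algebra_simps)
  qed
  then show ?thesis by (intro \<eta>(2)[of r m] allI impI)
qed

section \<open>From an invariant set to an integer matrix\<close>

lemma mult_mat_vec_nth:
  assumes "L \<in> carrier_mat m s" "i < m"
  shows "(L *\<^sub>v vec s v) $ i = (\<Sum>j<s. L $$ (i, j) * v j)"
  using assms by (simp add: scalar_prod_def atLeast0LessThan)

lemma lattice_eq_range:
  assumes "L \<in> carrier_mat s s"
  shows "lattice s L = range (\<lambda>r :: nat \<Rightarrow> int. L *\<^sub>v vec s (\<lambda>j. of_int (r j)))"
proof (intro equalityI subsetI)
  fix l assume "l \<in> lattice s L"
  then obtain r where r: "l = L *\<^sub>v r" "r \<in> carrier_vec s" "\<forall>i<s. r $ i \<in> \<int>"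
    by (auto simp: lattice_def)
  define z where "z j = \<lfloor>r $ j\<rfloor>" for j
  have "r = vec s (\<lambda>j. of_int (z j))"
    using r(2,3) by (intro eq_vecI) (auto simp: z_def elim: Ints_cases)
  then have "l = L *\<^sub>v vec s (\<lambda>j. of_int (z j))" using r(1) by simp
  then show "l \<in> range (\<lambda>r :: nat \<Rightarrow> int. L *\<^sub>v vec s (\<lambda>j. of_int (r j)))" by blast
qed (auto simp: lattice_def)

lemma mat_inverse_exists:
  fixes L :: "'a :: field mat"
  assumes "L \<in> carrier_mat s s" "det L \<noteq> 0"
  obtains K where "K \<in> carrier_mat s s" "L * K = 1\<^sub>m s" "K * L = 1\<^sub>m s"
proof -
  have "L \<in> Units (ring_mat TYPE('a) s ())"
    using assms by (rule det_non_zero_imp_unit)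
  then show thesis using that by (auto simp: Units_def ring_mat_def)
qed

lemma char_poly_four_block_diag:
  fixes A B :: "'a :: field mat"
  assumes A: "A \<in> carrier_mat n n" and B: "B \<in> carrier_mat d d"
  shows "char_poly (four_block_mat A (0\<^sub>m n d) (0\<^sub>m d n) B) = char_poly A * char_poly B"
proof -
  have "char_poly_matrix (four_block_mat A (0\<^sub>m n d) (0\<^sub>m d n) B)
      = four_block_mat (char_poly_matrix A) (0\<^sub>m n d) (0\<^sub>m d n) (char_poly_matrix B)"
    using A B by (intro eq_matI) (auto simp: char_poly_matrix_def)
  then show ?thesis
    unfolding char_poly_def
    using A B by (simp add: det_four_block_mat_upper_right_zero[of _ n _ d])
qed

lemma sum_lessThan_add: "(\<Sum>a<n + d. g a) = (\<Sum>a<n. g a) + (\<Sum>k<d. g (n + k :: nat) :: 'a :: comm_monoid_add)"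
  by (induction d) (simp_all add: add.assoc)

text \<open>Collects what the spectral argument needs, with the window eliminated: \<open>N\<close>
  is the action of \<open>A\<close> on lattice coordinates, \<open>B\<close> the map induced on the
  internal space, and the equation between sums intertwines the two. The last conclusion is
  injectivity of \<open>pi_perp\<close> in integer coordinates.\<close>

lemma cps_necessary:
  assumes gen: "generic_cps s n L" and win: "is_window (s - n) \<Omega>" and A: "A \<in> carrier_mat n n"
    and inv: "(\<lambda>x. A *\<^sub>v x) ` cps_set s n L \<Omega> \<subseteq> cps_set s n L \<Omega>"
  obtains N B where "N \<in> carrier_mat s s" "B \<in> carrier_mat (s - n) (s - n)"
    "char_poly (map_mat real_of_int N) = char_poly A * char_poly B"
    "\<And>i j. i < s - n \<Longrightarrow> j < s \<Longrightarrow>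
      (\<Sum>l<s. L $$ (n + i, l) * of_int (N $$ (l, j))) = (\<Sum>k<s - n. B $$ (i, k) * L $$ (n + k, j))"
    "\<And>\<beta>. eigenvalue (cmat B) \<beta> \<Longrightarrow> cmod \<beta> \<le> 1"
    "\<And>z :: nat \<Rightarrow> int. \<exists>j<s. z j \<noteq> 0 \<Longrightarrow> \<exists>i<s - n. (\<Sum>j<s. L $$ (n + i, j) * of_int (z j)) \<noteq> 0"
proof -
  define d where "d = s - n"
  have n: "1 \<le> n" "n < s" and L: "L \<in> carrier_mat s s" "det L \<noteq> 0"
    and inj_par: "inj_on (pi_par n) (lattice s L)" and inj_perp: "inj_on (pi_perp s n) (lattice s L)"
    and closure: "Euclidean_space d closure_of (pi_perp s n ` lattice s L) = topspace (Euclidean_space d)"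
    using gen by (auto simp: generic_cps_def d_def)
  have s: "s = n + d" using n by (simp add: d_def)
  obtain K where K: "K \<in> carrier_mat s s" "L * K = 1\<^sub>m s" "K * L = 1\<^sub>m s"
    using mat_inverse_exists[OF L] .
  have LK: "(\<Sum>j<s. L $$ (a, j) * K $$ (j, b)) = (if a = b then 1 else 0)" if "a < s" "b < s" for a b
  proof -
    have "(L * K) $$ (a, b) = (\<Sum>j<s. L $$ (a, j) * K $$ (j, b))"
      using L(1) K(1) that by (simp add: scalar_prod_def atLeast0LessThan)
    then show ?thesis using that by (simp add: K(2))
  qed
  define q where "q i j = L $$ (n + i, j)" for i j
  define vz where "vz r = vec s (\<lambda>j. real_of_int (r j))" for r :: "nat \<Rightarrow> int"
  define P where "P r i = (\<Sum>j<s. L $$ (i, j) * of_int (r j))" for r :: "nat \<Rightarrow> int" and i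
  define Q where "Q r i = (\<Sum>j<s. q i j * of_int (r j))" for r :: "nat \<Rightarrow> int" and i
  have Lv: "(L *\<^sub>v vz r) $ i = P r i" if "i < s" for r i
    unfolding vz_def P_def using L(1) that by (rule mult_mat_vec_nth)
  have lat: "lattice s L = range (\<lambda>r. L *\<^sub>v vz r)"
    unfolding vz_def using L(1) by (rule lattice_eq_range)
  have par: "pi_par n (L *\<^sub>v vz r) = vec n (P r)" for r
    using n Lv by (intro eq_vecI) (auto simp: pi_par_def)
  have perp: "pi_perp s n (L *\<^sub>v vz r) = (\<lambda>i. if i < d then Q r i else 0)" for r
    using n Lv by (auto simp: pi_perp_def d_def Q_def P_def q_def)
  have L_inj: "r j = r' j" if "L *\<^sub>v vz r = L *\<^sub>v vz r'" "j < s" for r r' j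
  proof -
    have "K *\<^sub>v (L *\<^sub>v vz x) = vz x" for x
      using K L by (simp add: vz_def flip: assoc_mult_mat_vec)
    then have "vz r $ j = vz r' $ j" using that(1) by metis
    then show ?thesis using that(2) by (simp add: vz_def)
  qed
  have P_inj: "r j = r' j" if "\<And>i. i < n \<Longrightarrow> P r i = P r' i" "j < s" for r r' j
  proof (rule L_inj[OF _ that(2)])
    have "pi_par n (L *\<^sub>v vz r) = pi_par n (L *\<^sub>v vz r')" using that(1) by (auto simp: par)
    then show "L *\<^sub>v vz r = L *\<^sub>v vz r'" by (rule inj_onD[OF inj_par]) (auto simp: lat)
  qed
  have Q_inj: "r j = r' j" if "\<And>i. i < d \<Longrightarrow> Q r i = Q r' i" "j < s" for r r' j
  proof (rule L_inj[OF _ that(2)])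
    have "pi_perp s n (L *\<^sub>v vz r) = pi_perp s n (L *\<^sub>v vz r')" using that(1) by (auto simp: perp)
    then show "L *\<^sub>v vz r = L *\<^sub>v vz r'" by (rule inj_onD[OF inj_perp]) (auto simp: lat)
  qed
  have P_diff: "P (\<lambda>j. a j - b j) i = P a i - P b i" for a b i
    by (simp add: P_def algebra_simps sum_subtractf)
  have P_add: "P (\<lambda>j. r j + (a j - b j)) i = P r i + (P a i - P b i)" for r a b i
    by (simp add: P_def algebra_simps sum_subtractf sum.distrib)
  have dense: "\<exists>r. \<forall>i<d. \<bar>(\<Sum>j<s. q i j * of_int (r j)) - y i\<bar> < \<epsilon>" if "\<epsilon> > 0" for y and \<epsilon> :: real
  proof -
    have sub: "pi_perp s n ` lattice s L \<subseteq> topspace (Euclidean_space d)"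
      by (auto simp: lat perp topspace_Euclidean_space)
    have D: "\<forall>y\<in>topspace (Euclidean_space d). \<forall>\<epsilon>>0. \<exists>g\<in>pi_perp s n ` lattice s L. \<forall>i<d. \<bar>g i - y i\<bar> < \<epsilon>"
      using closure by (simp only: dense_in_Euclidean_space_iff[OF sub])
    have "(\<lambda>i. if i < d then y i else 0) \<in> topspace (Euclidean_space d)"
      by (simp add: topspace_Euclidean_space)
    from D[rule_format, OF this that] obtain g where
      g: "g \<in> pi_perp s n ` lattice s L" "\<forall>i<d. \<bar>g i - (if i < d then y i else 0)\<bar> < \<epsilon>" ..
    then obtain r where "g = (\<lambda>i. if i < d then Q r i else 0)" by (auto simp: lat perp)
    then show ?thesis using g(2) by (intro exI[of _ r]) (simp add: Q_def)
  qed
  define W where "W = {r. (\<lambda>i. if i < d then Q r i else 0) \<in> \<Omega>}"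
  have win': "\<Omega> \<subseteq> topspace (Euclidean_space d)" "\<exists>B. \<forall>x\<in>\<Omega>. (\<Sum>i<d. (x i)\<^sup>2) \<le> B"
    "Euclidean_space d closure_of (Euclidean_space d interior_of \<Omega>) = Euclidean_space d closure_of \<Omega>"
    "Euclidean_space d closure_of \<Omega> \<noteq> {}"
    using win by (auto simp: is_window_def d_def)
  then have "Euclidean_space d interior_of \<Omega> \<noteq> {}" by (metis closure_of_empty)
  then obtain y where y: "y \<in> Euclidean_space d interior_of \<Omega>" by (meson ex_in_conv)
  obtain \<epsilon> where eps: "\<epsilon> > 0" and box: "\<And>x. x \<in> topspace (Euclidean_space d) \<Longrightarrow>
      (\<And>i. i < d \<Longrightarrow> \<bar>x i - y i\<bar> < \<epsilon>) \<Longrightarrow> x \<in> Euclidean_space d interior_of \<Omega>"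
    using openin_Euclidean_space_box[OF openin_interior_of y] by metis
  have W: "r \<in> W" if "\<And>i. i < d \<Longrightarrow> \<bar>(\<Sum>j<s. q i j * of_int (r j)) - y i\<bar> < \<epsilon>" for r
  proof -
    have "(\<lambda>i. if i < d then Q r i else 0) \<in> Euclidean_space d interior_of \<Omega>"
      using that by (intro box) (auto simp: topspace_Euclidean_space Q_def)
    then show ?thesis unfolding W_def using interior_of_subset[of "Euclidean_space d" \<Omega>] by blast
  qed
  obtain b where b: "\<And>x. x \<in> \<Omega> \<Longrightarrow> (\<Sum>i<d. (x i)\<^sup>2) \<le> b" using win'(2) by blast
  have Q_bound: "\<bar>Q r i\<bar> \<le> b + 1" if "r \<in> W" "i < d" for r i
  proof -
    have "(Q r i)\<^sup>2 \<le> (\<Sum>i<d. (Q r i)\<^sup>2)" using that(2) by (intro member_le_sum[of i "{..<d}" "\<lambda>i. (Q r i)\<^sup>2"]) auto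
    also have "\<dots> \<le> b" using b[of "\<lambda>i. if i < d then Q r i else 0"] that(1) by (simp add: W_def)
    finally have "\<bar>Q r i\<bar>\<^sup>2 \<le> b" by simp
    \<comment> \<open>A bound without square roots: \<open>2 * \<bar>Q r i\<bar>\<close> is at most
      the square plus 1.\<close>
    moreover have "0 \<le> (\<bar>Q r i\<bar> - 1)\<^sup>2" by simp
    ultimately show ?thesis unfolding power2_diff by simp
  qed
  have A_W: "\<exists>r'\<in>W. \<forall>i<n. P r' i = (\<Sum>k<n. A $$ (i, k) * P r k)" if "r \<in> W" for r
  proof -
    have "pi_par n (L *\<^sub>v vz r) = vec n (P r)" "L *\<^sub>v vz r \<in> lattice s L" "pi_perp s n (L *\<^sub>v vz r) \<in> \<Omega>"
      using that unfolding par perp W_def lat by auto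
    then have "vec n (P r) \<in> cps_set s n L \<Omega>" unfolding cps_set_def
      by (intro CollectI exI[of _ "L *\<^sub>v vz r"]) simp
    then have "A *\<^sub>v vec n (P r) \<in> cps_set s n L \<Omega>" using inv by blast
    then obtain l where l: "A *\<^sub>v vec n (P r) = pi_par n l" "l \<in> lattice s L" "pi_perp s n l \<in> \<Omega>"
      unfolding cps_set_def by blast
    then obtain r' where "l = L *\<^sub>v vz r'" by (auto simp: lat)
    with l have r': "A *\<^sub>v vec n (P r) = vec n (P r')" "r' \<in> W"
      by (simp_all add: par perp W_def)
    have "P r' i = (\<Sum>k<n. A $$ (i, k) * P r k)" if "i < n" for i
      using arg_cong[OF r'(1), of "\<lambda>v. v $ i"] that mult_mat_vec_nth[OF A that] by simp
    then show ?thesis using r'(2) by blast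
  qed
  have gen_all: "\<exists>r'. \<forall>i<n. P r' i = (\<Sum>k<n. A $$ (i, k) * P r k)" for r
  proof (rule window_generates[OF dense eps W])
    fix a b assume ab: "a \<in> W" "b \<in> W"
    obtain a' where a': "\<forall>i<n. P a' i = (\<Sum>k<n. A $$ (i, k) * P a k)" using A_W[OF ab(1)] by blast
    obtain b' where b': "\<forall>i<n. P b' i = (\<Sum>k<n. A $$ (i, k) * P b k)" using A_W[OF ab(2)] by blast
    show "\<exists>r'. \<forall>i<n. P r' i = (\<Sum>k<n. A $$ (i, k) * P (\<lambda>j. a j - b j) k)"
      by (rule exI[of _ "\<lambda>j. a' j - b' j"]) (simp add: a' b' P_diff right_diff_distrib sum_subtractf)
  next
    fix r a b assume r: "\<exists>r'. \<forall>i<n. P r' i = (\<Sum>k<n. A $$ (i, k) * P r k)" and ab: "a \<in> W" "b \<in> W"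
    obtain a' where a': "\<forall>i<n. P a' i = (\<Sum>k<n. A $$ (i, k) * P a k)" using A_W[OF ab(1)] by blast
    obtain b' where b': "\<forall>i<n. P b' i = (\<Sum>k<n. A $$ (i, k) * P b k)" using A_W[OF ab(2)] by blast
    obtain r' where r': "\<forall>i<n. P r' i = (\<Sum>k<n. A $$ (i, k) * P r k)" using r by blast
    show "\<exists>r'. \<forall>i<n. P r' i = (\<Sum>k<n. A $$ (i, k) * P (\<lambda>j. r j + (a j - b j)) k)"
      by (rule exI[of _ "\<lambda>j. r' j + (a' j - b' j)"])
        (simp add: a' b' r' P_add distrib_left right_diff_distrib sum.distrib sum_subtractf)
  qed
  \<comment> \<open>\<open>c j\<close> will be column \<open>j\<close> of \<open>N\<close>: the
    lattice point whose physical part is \<open>A\<close> applied to that of the \<open>j\<close>-th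
    basis vector.\<close>
  have "\<forall>j. \<exists>r'. \<forall>i<n. P r' i = (\<Sum>k<n. A $$ (i, k) * P (\<lambda>l. if l = j then 1 else 0) k)"
    using gen_all by blast
  then obtain c where c: "\<And>j i. i < n \<Longrightarrow> P (c j) i = (\<Sum>k<n. A $$ (i, k) * P (\<lambda>l. if l = j then 1 else 0) k)"
    by metis
  have unit: "(\<Sum>l<s. g l * real_of_int (if l = j then 1 else 0)) = g j" if "j < s" for g j
  proof -
    have "(\<Sum>l<s. g l * real_of_int (if l = j then 1 else 0)) = (\<Sum>l<s. if l = j then g l else 0)"
      by (rule sum.cong) auto
    then show ?thesis using that by simp
  qed
  have c: "(\<Sum>l<s. L $$ (i, l) * of_int (c j l)) = (\<Sum>k<n. A $$ (i, k) * L $$ (k, j))"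
    if "i < n" "j < s" for i j
    using c[OF that(1), of j] unit[OF that(2)] by (simp add: P_def)
  define Nf where "Nf r l = (\<Sum>j<s. c j l * r j)" for r :: "nat \<Rightarrow> int" and l
  have lin_N: "(\<Sum>l<s. g l * of_int (Nf r l)) = (\<Sum>j<s. (\<Sum>l<s. g l * of_int (c j l)) * of_int (r j))"
    for g :: "nat \<Rightarrow> 'a::comm_ring_1" and r
    unfolding Nf_def of_int_sum of_int_mult sum_distrib_left sum_distrib_right
    by (subst sum.swap) (simp add: ac_simps)
  have P_N: "P (Nf r) i = (\<Sum>k<n. A $$ (i, k) * P r k)" if "i < n" for r i
  proof -
    have "P (Nf r) i = (\<Sum>j<s. (\<Sum>k<n. A $$ (i, k) * L $$ (k, j)) * of_int (r j))"
      unfolding P_def lin_N using c[OF that] by simp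
    also have "\<dots> = (\<Sum>k<n. A $$ (i, k) * P r k)"
      unfolding P_def sum_distrib_left sum_distrib_right by (subst sum.swap) (simp add: ac_simps)
    finally show ?thesis .
  qed
  \<comment> \<open>Invariance provides a window point \<open>r'\<close> over the image; injectivity
    of \<open>pi_par\<close> identifies it with \<open>Nf r\<close> in the entries below
    \<open>s\<close>, and membership in \<open>W\<close> depends on no others.\<close>
  have N_W: "Nf r \<in> W" if r: "r \<in> W" for r
  proof -
    obtain r' where r': "r' \<in> W" "\<forall>i<n. P r' i = (\<Sum>k<n. A $$ (i, k) * P r k)" using A_W[OF r] by blast
    then have "r' j = Nf r j" if "j < s" for j
      using P_inj[of r' "Nf r" j] that P_N by simp
    then have "Q r' i = Q (Nf r) i" for i unfolding Q_def by (intro sum.cong[OF refl]) simp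
    then have "Q r' = Q (Nf r)" by (rule ext)
    then show ?thesis using r'(1) unfolding W_def mem_Collect_eq by (simp only:)
  qed
  define f where "f i j = (\<Sum>l<s. q i l * of_int (c j l))" for i j
  \<comment> \<open>The internal part of \<open>Nf r\<close>, as a linear form in \<open>r\<close>,
    is bounded on \<open>W\<close>. The first \<open>n\<close> columns of \<open>K\<close> lie in
    the kernel of the internal part, so the form vanishes on them: the lower left block of
    \<open>L * N * K\<close> is 0.\<close>
  have fK: "(\<Sum>j<s. f i j * K $$ (j, a)) = 0" if i: "i < d" and a: "a < n" for i a
  proof (rule bounded_functional_vanishes_on_kernel[OF dense eps W])
    show "\<bar>\<Sum>j<s. f i j * of_int (r j)\<bar> \<le> b + 1" if "r \<in> W" for r
      using Q_bound[OF N_W[OF that] i] by (simp add: Q_def lin_N f_def)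
    show "(\<Sum>j<s. q i' j * K $$ (j, a)) = 0" if "i' < d" for i'
      using LK[of "n + i'" a] that a s by (simp add: q_def)
  qed
  define B where "B = mat d d (\<lambda>(i, k). \<Sum>j<s. f i j * K $$ (j, n + k))"
  have KL: "(\<Sum>a<s. K $$ (j', a) * L $$ (a, j)) = (if j' = j then 1 else 0)" if "j' < s" "j < s" for j j'
  proof -
    have "(K * L) $$ (j', j) = (\<Sum>a<s. K $$ (j', a) * L $$ (a, j))"
      using L(1) K(1) that by (simp add: scalar_prod_def atLeast0LessThan)
    then show ?thesis using that by (simp add: K(3))
  qed
  have qN: "f i j = (\<Sum>k<d. B $$ (i, k) * q k j)" if i: "i < d" and j: "j < s" for i j
  proof -
    have "f i j = (\<Sum>j'<s. f i j' * (\<Sum>a<s. K $$ (j', a) * L $$ (a, j)))"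
    proof -
      have "(\<Sum>j'<s. f i j' * (\<Sum>a<s. K $$ (j', a) * L $$ (a, j))) = (\<Sum>j'<s. if j' = j then f i j' else 0)"
        using j by (intro sum.cong) (auto simp: KL)
      then show ?thesis using j by simp
    qed
    also have "\<dots> = (\<Sum>a<n + d. (\<Sum>j'<s. f i j' * K $$ (j', a)) * L $$ (a, j))"
      unfolding sum_distrib_left sum_distrib_right s[symmetric] by (subst sum.swap) (simp add: ac_simps)
    also have "\<dots> = (\<Sum>k<d. B $$ (i, k) * q k j)"
      using i by (simp add: sum_lessThan_add fK B_def q_def)
    finally show ?thesis .
  qed
  define N where "N = mat s s (\<lambda>(l, j). c j l)"
  define F where "F = four_block_mat A (0\<^sub>m n d) (0\<^sub>m d n) B"
  have carriers: "N \<in> carrier_mat s s" "B \<in> carrier_mat d d" "F \<in> carrier_mat s s"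
    "map_mat real_of_int N \<in> carrier_mat s s"
    using A by (auto simp: N_def B_def F_def s)
  have LN: "L * map_mat real_of_int N = F * L"
  proof (rule eq_matI)
    fix i j assume "i < dim_row (F * L)" "j < dim_col (F * L)"
    then have ij: "i < s" "j < s" using carriers L by auto
    have l: "(L * map_mat real_of_int N) $$ (i, j) = (\<Sum>l<s. L $$ (i, l) * of_int (c j l))"
      using ij L(1) carriers by (simp add: scalar_prod_def atLeast0LessThan N_def)
    have "(F * L) $$ (i, j) = (\<Sum>a<n + d. F $$ (i, a) * L $$ (a, j))"
      using ij L(1) carriers by (simp add: scalar_prod_def atLeast0LessThan s)
    also have "\<dots> = (\<Sum>a<n. F $$ (i, a) * L $$ (a, j)) + (\<Sum>k<d. F $$ (i, n + k) * L $$ (n + k, j))"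
      by (rule sum_lessThan_add)
    also have "\<dots> = (L * map_mat real_of_int N) $$ (i, j)"
    proof (cases "i < n")
      case True
      then show ?thesis using A carriers c[OF True ij(2)] by (simp add: l F_def)
    next
      case False
      then have i: "i - n < d" "n + (i - n) = i" using ij s by auto
      show ?thesis using A carriers False qN[OF i(1) ij(2)] i by (simp add: l F_def f_def q_def)
    qed
    finally show "(L * map_mat real_of_int N) $$ (i, j) = (F * L) $$ (i, j)" by simp
  qed (use L carriers in auto)
  have "similar_mat (map_mat real_of_int N) F"
  proof (rule similar_matI)
    show "{map_mat real_of_int N, F, K, L} \<subseteq> carrier_mat s s" using carriers K L by auto
    have "map_mat real_of_int N = K * (L * map_mat real_of_int N)"
      using K L carriers by (simp flip: assoc_mult_mat)
    then show "map_mat real_of_int N = K * F * L"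
      unfolding LN using K L carriers by (simp add: assoc_mult_mat[of _ s s _ s _ s])
  qed (use K in auto)
  then have char: "char_poly (map_mat real_of_int N) = char_poly A * char_poly B"
    using char_poly_similar char_poly_four_block_diag[OF A carriers(2)] by (metis F_def)
  \<comment> \<open>A left eigenvector \<open>v\<close> of \<open>B\<close> turns into a linear form
    \<open>G\<close> on integer vectors with \<open>G (Nf r) = \<beta> * G r\<close>. Orbits stay in
    \<open>W\<close>, where \<open>G\<close> is bounded, so for expanding \<beta> it vanishes on
    \<open>W\<close>, then on all integer vectors; as the rows of \<open>L\<close> are independent,
    \<open>v\<close> is 0.\<close>
  have eig: "cmod \<beta> \<le> 1" if "eigenvalue (cmat B) \<beta>" for \<beta>
  proof (rule ccontr)
    assume "\<not> cmod \<beta> \<le> 1"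
    then have \<beta>: "cmod \<beta> > 1" by simp
    have cB: "cmat B \<in> carrier_mat d d" using carriers by (simp add: cmat_def)
    then have "eigenvalue (transpose_mat (cmat B)) \<beta>"
      using that by (metis char_poly_transpose_mat eigenvalue_root_char_poly transpose_carrier_mat)
    then obtain v where v: "v \<in> carrier_vec d" "v \<noteq> 0\<^sub>v d" "transpose_mat (cmat B) *\<^sub>v v = \<beta> \<cdot>\<^sub>v v"
      using cB by (auto simp: eigenvalue_def eigenvector_def)
    have vB: "(\<Sum>i<d. v $ i * of_real (B $$ (i, k))) = \<beta> * v $ k" if "k < d" for k
    proof -
      have "(transpose_mat (cmat B) *\<^sub>v v) $ k = (\<Sum>i<d. v $ i * of_real (B $$ (i, k)))"
        using that carriers v(1) by (simp add: scalar_prod_def atLeast0LessThan cmat_def mult.commute)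
      then show ?thesis using that v by simp
    qed
    define g where "g j = (\<Sum>i<d. v $ i * of_real (q i j))" for j
    define G where "G r = (\<Sum>j<s. g j * of_int (r j))" for r :: "nat \<Rightarrow> int"
    have gN: "(\<Sum>l<s. g l * of_int (c j l)) = \<beta> * g j" if j: "j < s" for j
    proof -
      have "(\<Sum>l<s. g l * of_int (c j l)) = (\<Sum>i<d. v $ i * of_real (f i j))"
        unfolding g_def f_def of_real_sum sum_distrib_left sum_distrib_right
        by (subst sum.swap) (simp add: ac_simps)
      also have "\<dots> = (\<Sum>i<d. \<Sum>k<d. v $ i * of_real (B $$ (i, k)) * of_real (q k j))"
        by (intro sum.cong refl) (simp add: qN j sum_distrib_left mult.assoc)
      also have "\<dots> = (\<Sum>k<d. (\<Sum>i<d. v $ i * of_real (B $$ (i, k))) * of_real (q k j))"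
        unfolding sum_distrib_right by (rule sum.swap)
      also have "\<dots> = \<beta> * g j"
        by (simp add: vB g_def sum_distrib_left mult.assoc)
      finally show ?thesis .
    qed
    have GN: "G (Nf r) = \<beta> * G r" for r
      unfolding G_def lin_N by (simp add: gN sum_distrib_left mult.assoc)
    have GQ: "G r = (\<Sum>i<d. v $ i * of_real (Q r i))" for r
      unfolding G_def g_def Q_def of_real_sum sum_distrib_left sum_distrib_right
      by (subst sum.swap) (simp add: mult.assoc)
    define C where "C = (\<Sum>i<d. cmod (v $ i) * (b + 1))"
    have G_bound: "cmod (G r) \<le> C" if "r \<in> W" for r
    proof -
      have "cmod (G r) \<le> (\<Sum>i<d. cmod (v $ i * of_real (Q r i)))" unfolding GQ by (rule norm_sum)
      also have "\<dots> \<le> C"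
        unfolding C_def using Q_bound[OF that] by (intro sum_mono) (simp add: norm_mult mult_left_mono)
      finally show ?thesis .
    qed
    have GW: "G r = 0" if r: "r \<in> W" for r
    proof (rule ccontr)
      assume nz: "G r \<noteq> 0"
      have pow: "(Nf ^^ t) r \<in> W \<and> G ((Nf ^^ t) r) = \<beta> ^ t * G r" for t
        by (induction t) (auto simp: r N_W GN)
      have le: "cmod \<beta> ^ t * cmod (G r) \<le> C" for t
        using G_bound[of "(Nf ^^ t) r"] pow[of t] by (simp add: norm_mult norm_power)
      obtain t where "C / cmod (G r) < cmod \<beta> ^ t" using real_arch_pow[OF \<beta>] by blast
      then show False using le[of t] nz by (simp add: field_simps)
    qed
    have G_diff: "G (\<lambda>j. a j - b j) = G a - G b" for a b
      by (simp add: G_def algebra_simps sum_subtractf)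
    have G_add: "G (\<lambda>j. r j + (a j - b j)) = G r + (G a - G b)" for r a b
      by (simp add: G_def algebra_simps sum_subtractf sum.distrib)
    have G0: "G r = 0" for r
      by (rule window_generates[OF dense eps W]) (simp_all add: G_diff G_add GW)
    have g0: "g j = 0" if j: "j < s" for j
    proof -
      have "G (\<lambda>l. if l = j then 1 else 0) = (\<Sum>l<s. if l = j then g l else 0)"
        unfolding G_def by (intro sum.cong) auto
      then show ?thesis using j G0 by simp
    qed
    have "v $ k = 0" if k: "k < d" for k
    proof -
      have qK: "(\<Sum>j<s. q i j * K $$ (j, n + k)) = (if i = k then 1 else 0)" if "i < d" for i
        using LK[of "n + i" "n + k"] that k s by (simp add: q_def)
      have "(\<Sum>j<s. g j * of_real (K $$ (j, n + k))) = (\<Sum>i<d. v $ i * of_real (\<Sum>j<s. q i j * K $$ (j, n + k)))"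
        unfolding g_def of_real_sum sum_distrib_left sum_distrib_right
        by (subst sum.swap) (simp add: mult.assoc)
      also have "\<dots> = (\<Sum>i<d. if i = k then v $ i else 0)"
        by (intro sum.cong refl) (simp add: qK del: of_real_sum)
      also have "\<dots> = v $ k" using k by simp
      finally show ?thesis by (simp add: g0)
    qed
    then have "v = 0\<^sub>v d" using v(1) by (intro eq_vecI) auto
    then show False using v(2) by simp
  qed
  show thesis
  proof (rule that[of N B])
    show "N \<in> carrier_mat s s" "B \<in> carrier_mat (s - n) (s - n)" using carriers by (simp_all add: d_def)
    show "char_poly (map_mat real_of_int N) = char_poly A * char_poly B" by (rule char)
    show "(\<Sum>l<s. L $$ (n + i, l) * of_int (N $$ (l, j))) = (\<Sum>k<s - n. B $$ (i, k) * L $$ (n + k, j))"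
      if "i < s - n" "j < s" for i j
      using qN[of i j] that by (simp add: f_def q_def N_def d_def)
    show "cmod \<beta> \<le> 1" if "eigenvalue (cmat B) \<beta>" for \<beta> using eig that .
    show "\<exists>i<s - n. (\<Sum>j<s. L $$ (n + i, j) * of_int (z j)) \<noteq> 0" if "\<exists>j<s. z j \<noteq> 0" for z :: "nat \<Rightarrow> int"
    proof (rule ccontr)
      assume "\<not> ?thesis"
      then have "Q z i = Q (\<lambda>_. 0) i" if "i < d" for i using that by (simp add: Q_def q_def d_def)
      then have "z j = 0" if "j < s" for j using Q_inj[of z "\<lambda>_. 0" j] that by simp
      then show False using that by blast
    qed
  qed
qed

section \<open>Multiplicities of conjugate eigenvalues\<close>

interpretation of_real_poly_hom: map_poly_inj_idom_hom "of_real :: real \<Rightarrow> complex" ..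

lemma common_denominator:
  fixes v :: "nat \<Rightarrow> rat"
  shows "\<exists>D>0. \<forall>k<m. \<exists>z. of_int D * v k = of_int z"
proof (induction m)
  case 0
  show ?case by (intro exI[of _ 1]) simp
next
  case (Suc m)
  then obtain D where D: "D > 0" "\<forall>k<m. \<exists>z. of_int D * v k = of_int z" by blast
  obtain a b where v: "v m = of_int a / of_int b" "b > 0"
    by (cases "v m") (auto simp: Fract_of_int_quotient)
  have "\<exists>z. of_int (D * b) * v k = of_int z" if "k < Suc m" for k
  proof (cases "k = m")
    case True
    then show ?thesis using v by (intro exI[of _ "D * a"]) simp
  next
    case False
    with D(2) that obtain z where "of_int D * v k = of_int z" by (metis less_SucE)
    then show ?thesis by (intro exI[of _ "b * z"]) (simp add: mult.assoc mult.left_commute)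
  qed
  then show ?case using D(1) v(2) by (meson mult_pos_pos)
qed

text \<open>Entries of the \<open>i\<close>-th matrix power of \<open>N\<close>, by recursion on
  functions, so that the same integers can be cast entrywise to rational and complex
  numbers.\<close>

primrec pow_entry :: "'a :: comm_semiring_1 mat \<Rightarrow> nat \<Rightarrow> nat \<Rightarrow> nat \<Rightarrow> 'a" where
  "pow_entry N 0 l k = (if l = k then 1 else 0)"
| "pow_entry N (Suc i) l k = (\<Sum>m<dim_row N. N $$ (l, m) * pow_entry N i m k)"

text \<open>The rational matrix obtained by inserting \<open>N\<close> into \<open>p\<close> kills a
  complex eigenvector, so its determinant is 0. The determinant does not depend on the field, hence
  there is a rational kernel vector, and clearing denominators makes it integral.\<close>

lemma rational_eigenspace_sum:
  fixes N :: "int mat" and p :: "rat poly"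
  assumes N: "N \<in> carrier_mat s s" and \<mu>: "eigenvalue (map_mat complex_of_int N) \<mu>"
    and p: "poly (map_poly of_rat p) \<mu> = 0"
  shows "\<exists>z :: nat \<Rightarrow> int. (\<exists>k<s. z k \<noteq> 0) \<and>
    (\<forall>l<s. (\<Sum>k<s. (\<Sum>i\<le>degree p. coeff p i * of_int (pow_entry N i l k)) * of_int (z k)) = 0)"
proof -
  define pw where "pw = pow_entry N"
  have pw_Suc: "pw (Suc i) l k = (\<Sum>m<s. N $$ (l, m) * pw i m k)" for i l k
    using N by (simp add: pw_def)
  obtain u where u: "u \<in> carrier_vec s" "u \<noteq> 0\<^sub>v s" "map_mat complex_of_int N *\<^sub>v u = \<mu> \<cdot>\<^sub>v u"
    using \<mu> N by (auto simp: eigenvalue_def eigenvector_def)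
  have Nu: "(\<Sum>m<s. of_int (N $$ (l, m)) * u $ m) = \<mu> * u $ l" if "l < s" for l
  proof -
    have "(map_mat complex_of_int N *\<^sub>v u) $ l = (\<Sum>m<s. of_int (N $$ (l, m)) * u $ m)"
      using that u(1) N by (simp add: scalar_prod_def atLeast0LessThan)
    then show ?thesis using that u by simp
  qed
  have pow: "(\<Sum>k<s. of_int (pw i l k) * u $ k) = \<mu> ^ i * u $ l" if "l < s" for i l
    using that
  proof (induction i arbitrary: l)
    case 0
    have "(\<Sum>k<s. of_int (pw 0 l k) * u $ k) = (\<Sum>k<s. if k = l then u $ k else 0)"
      by (intro sum.cong) (auto simp: pw_def)
    then show ?case using 0 by simp
  next
    case (Suc i)
    have "(\<Sum>k<s. of_int (pw (Suc i) l k) * u $ k)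
        = (\<Sum>m<s. of_int (N $$ (l, m)) * (\<Sum>k<s. of_int (pw i m k) * u $ k))"
      unfolding pw_Suc of_int_sum sum_distrib_left sum_distrib_right
      by (subst sum.swap) (simp add: mult.assoc)
    also have "\<dots> = (\<Sum>m<s. \<mu> ^ i * (of_int (N $$ (l, m)) * u $ m))"
      using Suc.IH by (intro sum.cong) auto
    also have "\<dots> = \<mu> ^ Suc i * u $ l"
      using Nu[OF Suc.prems] by (simp add: sum_distrib_left[symmetric])
    finally show ?case .
  qed
  define R where "R = mat s s (\<lambda>(l, k). \<Sum>i\<le>degree p. coeff p i * of_int (pw i l k))"
  have R: "R \<in> carrier_mat s s" by (simp add: R_def)
  let ?R = "map_mat complex_of_rat R"
  have "?R *\<^sub>v u = 0\<^sub>v s"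
  proof (rule eq_vecI)
    fix l assume "l < dim_vec (0\<^sub>v s :: complex vec)"
    then have l: "l < s" by simp
    have "(?R *\<^sub>v u) $ l = (\<Sum>k<s. (\<Sum>i\<le>degree p. of_rat (coeff p i) * of_int (pw i l k)) * u $ k)"
      using l u(1) by (simp add: R_def scalar_prod_def atLeast0LessThan of_rat_sum of_rat_mult)
    also have "\<dots> = (\<Sum>i\<le>degree p. of_rat (coeff p i) * (\<Sum>k<s. of_int (pw i l k) * u $ k))"
      unfolding sum_distrib_left sum_distrib_right by (subst sum.swap) (simp add: mult.assoc)
    also have "\<dots> = (\<Sum>i\<le>degree p. of_rat (coeff p i) * \<mu> ^ i) * u $ l"
      by (simp add: pow[OF l] sum_distrib_right mult.assoc)
    also have "(\<Sum>i\<le>degree p. of_rat (coeff p i) * \<mu> ^ i) = 0"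
      using p by (simp add: poly_altdef coeff_map_poly)
    finally show "(?R *\<^sub>v u) $ l = 0\<^sub>v s $ l" using l by simp
  qed (simp add: R_def)
  then have "det ?R = 0"
    using det_0_iff_vec_prod_zero[of ?R s] R u by auto
  then have "det R = 0" using of_rat_hom.hom_det[of R] by (metis of_rat_eq_0_iff)
  then obtain v where v: "v \<in> carrier_vec s" "v \<noteq> 0\<^sub>v s" "R *\<^sub>v v = 0\<^sub>v s"
    using det_0_iff_vec_prod_zero[OF R] by blast
  obtain D where D: "D > 0" "\<And>k. k < s \<Longrightarrow> \<exists>z. of_int D * v $ k = of_int z"
    using common_denominator[of s "\<lambda>k. v $ k"] by blast
  then obtain z where z: "\<And>k. k < s \<Longrightarrow> of_int (z k) = of_int D * v $ k" by metis
  show ?thesis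
  proof (intro exI[of _ z] conjI allI impI)
    obtain k where "k < s" "v $ k \<noteq> 0" using v(1,2) by (metis carrier_vecD eq_vecI index_zero_vec)
    then have "of_int (z k) \<noteq> (0 :: rat)" using D(1) z by simp
    then show "\<exists>k<s. z k \<noteq> 0" using \<open>k < s\<close> by auto
    fix l assume l: "l < s"
    have "(\<Sum>k<s. (\<Sum>i\<le>degree p. coeff p i * of_int (pw i l k)) * of_int (z k))
        = of_int D * (\<Sum>k<s. R $$ (l, k) * v $ k)"
      using l by (simp add: z R_def sum_distrib_left mult.left_commute)
    also have "(\<Sum>k<s. R $$ (l, k) * v $ k) = (R *\<^sub>v v) $ l"
      using l v(1) R by (simp add: scalar_prod_def atLeast0LessThan)
    finally show "(\<Sum>k<s. (\<Sum>i\<le>degree p. coeff p i * of_int (pow_entry N i l k)) * of_int (z k)) = 0"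
      using v(3) l by (simp add: pw_def)
  qed
qed

lemma char_poly_cmat: "A \<in> carrier_mat n n \<Longrightarrow> char_poly (cmat A) = map_poly of_real (char_poly A)"
  unfolding cmat_def by (rule of_real_hom.char_poly_hom)

lemma eigenvalue_cmat_iff_alg_mult:
  assumes "A \<in> carrier_mat n n"
  shows "eigenvalue (cmat A) \<mu> \<longleftrightarrow> alg_mult A \<mu> > 0"
proof -
  have c: "cmat A \<in> carrier_mat n n" using assms by (simp add: cmat_def)
  then have "char_poly (cmat A) \<noteq> 0" using degree_monic_char_poly[OF c] by auto
  then show ?thesis
    using eigenvalue_root_char_poly[OF c] by (simp add: alg_mult_def order_root)
qed

theorem cps_spectrum:
  assumes A: "A \<in> carrier_mat n n" and gen: "generic_cps s n L" and win: "is_window (s - n) \<Omega>"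
    and inv: "(\<lambda>x. A *\<^sub>v x) ` cps_set s n L \<Omega> \<subseteq> cps_set s n L \<Omega>"
  shows "\<And>l. eigenvalue (cmat A) l \<Longrightarrow> algebraic_int l"
    and "\<And>l \<mu>. eigenvalue (cmat A) l \<Longrightarrow> alg_conjugate l \<mu> \<Longrightarrow> cmod \<mu> > 1 \<Longrightarrow>
      eigenvalue (cmat A) \<mu> \<and> (\<forall>\<nu>. alg_conjugate \<mu> \<nu> \<longrightarrow> alg_mult A \<mu> \<ge> alg_mult A \<nu>) \<and>
      (\<exists>\<nu>. alg_conjugate \<mu> \<nu> \<and> alg_mult A \<mu> > alg_mult A \<nu>)"
proof -
  obtain N B where N: "N \<in> carrier_mat s s" and B: "B \<in> carrier_mat (s - n) (s - n)"
    and char: "char_poly (map_mat real_of_int N) = char_poly A * char_poly B"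
    and LN: "\<And>i j. i < s - n \<Longrightarrow> j < s \<Longrightarrow>
      (\<Sum>l<s. L $$ (n + i, l) * of_int (N $$ (l, j))) = (\<Sum>k<s - n. B $$ (i, k) * L $$ (n + k, j))"
    and eigB: "\<And>\<beta>. eigenvalue (cmat B) \<beta> \<Longrightarrow> cmod \<beta> \<le> 1"
    and inj: "\<And>z :: nat \<Rightarrow> int. \<exists>j<s. z j \<noteq> 0 \<Longrightarrow> \<exists>i<s - n. (\<Sum>j<s. L $$ (n + i, j) * of_int (z j)) \<noteq> 0"
    by (rule cps_necessary[OF gen win A inv]) (rule that)
  define d where "d = s - n"
  define \<chi> where "\<chi> = char_poly N"
  have \<chi>: "map_poly complex_of_int \<chi> = char_poly (cmat A) * char_poly (cmat B)"
  proof -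
    have "map_poly complex_of_int \<chi> = map_poly complex_of_real (map_poly real_of_int \<chi>)"
      by (simp add: map_poly_map_poly o_def)
    also have "map_poly real_of_int \<chi> = char_poly (map_mat real_of_int N)"
      unfolding \<chi>_def by (rule of_int_hom.char_poly_hom[OF N, symmetric])
    finally show ?thesis
      by (simp add: char of_real_poly_hom.hom_mult char_poly_cmat[OF A] char_poly_cmat[OF B])
  qed
  have \<chi>_monic: "lead_coeff \<chi> = 1" using degree_monic_char_poly[OF N] by (simp add: \<chi>_def)
  have \<chi>0: "map_poly complex_of_int \<chi> \<noteq> 0" using \<chi>_monic by auto
  have ord: "order \<nu> (map_poly complex_of_int \<chi>) = alg_mult A \<nu> + alg_mult B \<nu>" for \<nu>
    using \<chi>0 unfolding \<chi> alg_mult_def by (rule order_mult)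
  have ord_conj: "alg_mult A x + alg_mult B x = alg_mult A y + alg_mult B y" if "alg_conjugate x y" for x y
  proof -
    have "map_poly of_rat (map_poly rat_of_int \<chi>) = map_poly complex_of_int \<chi>"
      by (simp add: map_poly_map_poly o_def)
    moreover have "map_poly rat_of_int \<chi> \<noteq> 0" using \<chi>_monic by auto
    ultimately show ?thesis using order_alg_conjugate[OF that, of "map_poly rat_of_int \<chi>"] ord by metis
  qed
  show "algebraic_int l" if "eigenvalue (cmat A) l" for l
  proof -
    have "order l (map_poly complex_of_int \<chi>) \<noteq> 0"
      using that by (simp add: ord eigenvalue_cmat_iff_alg_mult[OF A])
    then have "poly (map_poly complex_of_int \<chi>) l = 0" using order_root by blast
    then show ?thesis using \<chi>_monic by (auto simp: algebraic_int_altdef_ipoly)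
  qed
  fix l \<mu>
  assume l: "eigenvalue (cmat A) l" and conj: "alg_conjugate l \<mu>" and \<mu>: "cmod \<mu> > 1"
  have B\<mu>: "alg_mult B \<mu> = 0"
    using eigB[of \<mu>] \<mu> eigenvalue_cmat_iff_alg_mult[OF B] by fastforce
  then have A\<mu>: "alg_mult A \<mu> > 0"
    using ord_conj[OF conj] l eigenvalue_cmat_iff_alg_mult[OF A] by simp
  \<comment> \<open>Otherwise no conjugate of \<mu> is an eigenvalue of \<open>B\<close>. But an
    integer vector \<open>z\<close> killed by \<open>p(N)\<close> has a nonzero internal image
    \<open>w 0\<close>, which is killed by \<open>p(B)\<close>, and this yields an eigenvector of
    \<open>B\<close> for a root of \<open>p\<close>.\<close>
  have strict: "\<exists>\<nu>. alg_conjugate \<mu> \<nu> \<and> alg_mult A \<mu> > alg_mult A \<nu>"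
  proof (rule ccontr)
    assume contra: "\<not> ?thesis"
    have B0: "\<not> eigenvalue (cmat B) \<nu>" if "alg_conjugate \<mu> \<nu>" for \<nu>
      using contra ord_conj[OF that] that B\<mu> eigenvalue_cmat_iff_alg_mult[OF B] by fastforce
    obtain p where p: "is_min_poly_Q p \<mu>"
      using conj by (meson alg_conjugate_def alg_conjugate_sym)
    have NC: "map_mat complex_of_int N \<in> carrier_mat s s" using N by simp
    have "poly (map_poly complex_of_int \<chi>) \<mu> = 0"
      using ord[of \<mu>] A\<mu> order_root by fastforce
    then have N\<mu>: "eigenvalue (map_mat complex_of_int N) \<mu>"
      unfolding eigenvalue_root_char_poly[OF NC] \<chi>_def by (simp only: of_int_hom.char_poly_hom[OF N])
    define pw where "pw = pow_entry N"
    have pw0: "pw 0 l k = (if l = k then 1 else 0)"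
      and pw_Suc: "pw (Suc i) l k = (\<Sum>m<s. N $$ (l, m) * pw i m k)" for i l k
      using N by (simp_all add: pw_def)
    have p\<mu>: "poly (map_poly of_rat p) \<mu> = 0" using p by (simp add: is_min_poly_Q_def)
    obtain z :: "nat \<Rightarrow> int" where z: "\<exists>k<s. z k \<noteq> 0"
      and pz: "\<And>l. l < s \<Longrightarrow> (\<Sum>k<s. (\<Sum>i\<le>degree p. coeff p i * of_int (pw i l k)) * of_int (z k)) = 0"
      using rational_eigenspace_sum[OF N N\<mu> p\<mu>] unfolding pw_def by blast
    define y where "y i l = (\<Sum>k<s. pw i l k * z k)" for i l
    have y_Suc: "y (Suc i) l = (\<Sum>m<s. N $$ (l, m) * y i m)" for i l
      unfolding y_def pw_Suc sum_distrib_left sum_distrib_right by (subst sum.swap) (simp add: mult.assoc)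
    define w where "w i j = complex_of_real (\<Sum>l<s. L $$ (n + j, l) * of_int (y i l))" for i j
    have "\<exists>\<nu> x. poly (map_poly complex_of_rat p) \<nu> = 0 \<and> (\<exists>j<d. x j \<noteq> 0) \<and>
        (\<forall>j<d. (\<Sum>k<d. complex_of_real (B $$ (j, k)) * x k) = \<nu> * x j)"
    proof (rule annihilating_poly_eigenvector[of d w "\<lambda>j k. complex_of_real (B $$ (j, k))"])
      show "w (Suc i) j = (\<Sum>k<d. of_real (B $$ (j, k)) * w i k)" if j: "j < d" for i j
      proof -
        have "(\<Sum>l<s. L $$ (n + j, l) * of_int (y (Suc i) l))
            = (\<Sum>m<s. (\<Sum>l<s. L $$ (n + j, l) * of_int (N $$ (l, m))) * of_int (y i m))"
          unfolding y_Suc of_int_sum of_int_mult sum_distrib_left sum_distrib_right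
          by (subst sum.swap) (simp add: mult.assoc)
        also have "\<dots> = (\<Sum>m<s. (\<Sum>k<d. B $$ (j, k) * L $$ (n + k, m)) * of_int (y i m))"
          using LN j by (intro sum.cong) (auto simp: d_def)
        also have "\<dots> = (\<Sum>k<d. B $$ (j, k) * (\<Sum>m<s. L $$ (n + k, m) * of_int (y i m)))"
          unfolding sum_distrib_left sum_distrib_right by (subst sum.swap) (simp add: mult.assoc)
        finally show ?thesis by (simp add: w_def)
      qed
      show "map_poly of_rat p \<noteq> (0 :: complex poly)" using min_poly_nonzero[OF p] by simp
      show "(\<Sum>i\<le>degree (map_poly complex_of_rat p). coeff (map_poly of_rat p) i * w i j) = 0" for j
      proof -
        have yz: "(\<Sum>i\<le>degree p. of_rat (coeff p i) * of_int (y i l)) = (0 :: complex)" if "l < s" for l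
        proof -
          have "(\<Sum>i\<le>degree p. of_rat (coeff p i) * of_int (y i l))
              = (of_rat (\<Sum>k<s. (\<Sum>i\<le>degree p. coeff p i * of_int (pw i l k)) * of_int (z k)) :: complex)"
            unfolding y_def of_int_sum of_int_mult of_rat_sum of_rat_mult sum_distrib_left sum_distrib_right
            by (subst sum.swap) (simp add: mult.assoc)
          then show ?thesis by (simp add: pz[OF that])
        qed
        have "(\<Sum>i\<le>degree p. of_rat (coeff p i) * w i j)
            = (\<Sum>l<s. of_real (L $$ (n + j, l)) * (\<Sum>i\<le>degree p. of_rat (coeff p i) * of_int (y i l)))"
          unfolding w_def of_real_sum of_real_mult sum_distrib_left
          by (subst sum.swap) (simp add: mult.left_commute)
        then show ?thesis by (simp add: yz)
      qed
      have "y 0 l = z l" if "l < s" for l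
      proof -
        have "y 0 l = (\<Sum>k<s. if k = l then z k else 0)"
          unfolding y_def pw0 by (intro sum.cong) auto
        then show ?thesis using that by simp
      qed
      then have "w 0 j = of_real (\<Sum>l<s. L $$ (n + j, l) * of_int (z l))" for j
        unfolding w_def by simp
      then show "\<exists>j<d. w 0 j \<noteq> 0"
        using inj[OF z] unfolding d_def by (metis of_real_eq_0_iff)
    qed
    then obtain \<nu> x where \<nu>: "poly (map_poly complex_of_rat p) \<nu> = 0" and x: "\<exists>j<d. x j \<noteq> 0"
      and Bx: "\<And>j. j < d \<Longrightarrow> (\<Sum>k<d. complex_of_real (B $$ (j, k)) * x k) = \<nu> * x j" by blast
    have "eigenvector (cmat B) (vec d x) \<nu>"
      unfolding eigenvector_def
    proof (intro conjI)
      show "vec d x \<in> carrier_vec (dim_row (cmat B))" using B by (simp add: cmat_def d_def)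
      show "vec d x \<noteq> 0\<^sub>v (dim_row (cmat B))"
        using x B by (auto simp: cmat_def d_def vec_eq_iff)
      show "cmat B *\<^sub>v vec d x = \<nu> \<cdot>\<^sub>v vec d x"
        using B Bx by (intro eq_vecI) (auto simp: cmat_def d_def scalar_prod_def atLeast0LessThan)
    qed
    then have "eigenvalue (cmat B) \<nu>" by (auto simp: eigenvalue_def)
    moreover have "alg_conjugate \<mu> \<nu>" using p \<nu> by (auto simp: alg_conjugate_def)
    ultimately show False using B0 by blast
  qed
  have "alg_mult A \<mu> \<ge> alg_mult A \<nu>" if "alg_conjugate \<mu> \<nu>" for \<nu>
    using ord_conj[OF that] B\<mu> by simp
  then show "eigenvalue (cmat A) \<mu> \<and> (\<forall>\<nu>. alg_conjugate \<mu> \<nu> \<longrightarrow> alg_mult A \<mu> \<ge> alg_mult A \<nu>) \<and>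
      (\<exists>\<nu>. alg_conjugate \<mu> \<nu> \<and> alg_mult A \<mu> > alg_mult A \<nu>)"
    using strict A\<mu> eigenvalue_cmat_iff_alg_mult[OF A] by blast
qed

section \<open>Generic reflections\<close>

lemma countable_int_polys: "countable (UNIV :: int poly set)"
proof -
  have "inj (coeffs :: int poly \<Rightarrow> int list)" by (auto intro: injI simp: coeffs_eq_iff)
  then show ?thesis by (rule countableI') 
qed

text \<open>The coefficients against which the reflections must be generic. Values of integer
  polynomials (\<open>b = 1\<close>) serve the injectivity of the projections, quotients by values
  of a derivative serve the density.\<close>

lemma countable_int_poly_quotients:
  assumes "finite S"
  shows "countable {poly (map_poly of_int a) \<nu> / poly (map_poly of_int b) \<nu> | a b \<nu>. \<nu> \<in> (S :: complex set)}"
proof -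
  have "countable (\<Union>a\<in>UNIV. \<Union>b\<in>UNIV. \<Union>\<nu>\<in>S. {poly (map_poly of_int a) \<nu> / poly (map_poly of_int b) \<nu>})"
    using assms by (intro countable_UN countable_int_polys countable_finite) auto
  moreover have "{poly (map_poly of_int a) \<nu> / poly (map_poly of_int b) \<nu> | a b \<nu>. \<nu> \<in> S}
      = (\<Union>a\<in>UNIV. \<Union>b\<in>UNIV. \<Union>\<nu>\<in>S. {poly (map_poly of_int a) \<nu> / poly (map_poly of_int b) \<nu>})"
    by auto
  ultimately show ?thesis by simp
qed

lemma transcendental_real_exists:
  fixes P :: "complex poly set"
  assumes "countable P"
  obtains \<tau> :: real where "\<And>p. p \<in> P \<Longrightarrow> p \<noteq> 0 \<Longrightarrow> poly p (of_real \<tau>) \<noteq> 0"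
proof -
  have "countable (\<Union>p\<in>P - {0}. {t :: real. poly p (of_real t) = 0})"
  proof (intro countable_UN)
    show "countable (P - {0})" using assms by simp
    fix p assume "p \<in> P - {0}"
    then have "finite (complex_of_real -` {z. poly p z = 0})"
      by (intro finite_vimageI poly_roots_finite) (auto intro: injI)
    then show "countable {t :: real. poly p (of_real t) = 0}" by (simp add: vimage_def countable_finite)
  qed
  then have "(\<Union>p\<in>P - {0}. {t :: real. poly p (of_real t) = 0}) \<noteq> UNIV"
    using uncountable_UNIV_real by metis
  then show thesis using that by blast
qed

text \<open>A Householder reflection along \<open>(1, \<tau>, \<tau>\<^sup>2, \<dots>)\<close>: it is its own inverse, and every row is, up to a
  common factor, a polynomial vector in \<open>\<tau>\<close>.\<close>

lemma generic_reflections: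
  fixes F :: "complex set"
  assumes "countable F"
  shows "\<exists>g :: nat \<Rightarrow> nat \<Rightarrow> nat \<Rightarrow> real. (\<forall>k i j. g k i j = g k j i) \<and>
    (\<forall>k i j. i < k \<longrightarrow> j < k \<longrightarrow> (\<Sum>l<k. g k i l * g k l j) = (if i = j then 1 else 0)) \<and>
    (\<forall>k r \<delta>. r < k \<longrightarrow> (\<forall>j<k. \<delta> j \<in> F) \<longrightarrow> (\<Sum>j<k. of_real (g k r j) * \<delta> j) = 0 \<longrightarrow> (\<forall>j<k. \<delta> j = 0))"
proof -
  \<comment> \<open>\<open>D k\<close> times the product of row \<open>r\<close> with \<delta>, read
    as a polynomial in \<open>\<tau>\<close>. There are only countably many of them, so one
    \<open>\<tau>\<close> avoids the roots of all nonzero ones.\<close>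
  define \<Phi> :: "nat \<Rightarrow> nat \<Rightarrow> (nat \<Rightarrow> complex) \<Rightarrow> complex poly" where
    "\<Phi> k r \<delta> = (\<Sum>i<k. monom (\<delta> r) (2 * i)) - (\<Sum>j<k. monom (2 * \<delta> j) (r + j))" for k r \<delta>
  define P where "P = (\<lambda>(k, r, xs). \<Phi> k r (\<lambda>j. xs ! j)) ` (UNIV \<times> UNIV \<times> lists F)"
  have "countable P" unfolding P_def
    by (intro countable_image countable_SIGMA countable_lists assms) auto
  then obtain \<tau> where \<tau>: "\<And>p. p \<in> P \<Longrightarrow> p \<noteq> 0 \<Longrightarrow> poly p (of_real \<tau>) \<noteq> 0"
    using transcendental_real_exists by blast
  define D where "D k = (\<Sum>i<k. \<tau> ^ (2 * i))" for k
  have D_pos: "D k > 0" if "0 < k" for k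
  proof -
    have "\<tau> ^ (2 * 0) \<le> D k" unfolding D_def
      using that by (intro member_le_sum) (auto simp: power_mult)
    then show ?thesis by simp
  qed
  define g where "g k i j = (if i = j then 1 else 0) - 2 * \<tau> ^ (i + j) / D k" for k i j :: nat
  show ?thesis
  proof (intro exI[of _ g] conjI allI impI)
    show "g k i j = g k j i" for k i j by (simp add: g_def add.commute)
    show "(\<Sum>l<k. g k i l * g k l j) = (if i = j then 1 else 0)" if ij: "i < k" "j < k" for k i j
    proof -
      have "(\<Sum>l<k. g k i l * g k l j) = (\<Sum>l<k. (if l = i then (if i = j then 1 else 0) else 0))
          - (\<Sum>l<k. if l = i then 2 * \<tau> ^ (i + j) / D k else 0) - (\<Sum>l<k. if l = j then 2 * \<tau> ^ (i + j) / D k else 0)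
          + (\<Sum>l<k. 4 * \<tau> ^ (i + j) / (D k * D k) * \<tau> ^ (2 * l))"
        unfolding sum_subtractf[symmetric] sum.distrib[symmetric]
      proof (rule sum.cong[OF refl])
        fix l
        have "\<tau> ^ (i + l) * \<tau> ^ (l + j) = \<tau> ^ (i + j) * \<tau> ^ (2 * l)"
          by (metis (no_types, lifting) add.assoc add.commute mult_2 power_add)
        then show "g k i l * g k l j = (if l = i then if i = j then 1 else 0 else 0) -
          (if l = i then 2 * \<tau> ^ (i + j) / D k else 0) - (if l = j then 2 * \<tau> ^ (i + j) / D k else 0) +
          4 * \<tau> ^ (i + j) / (D k * D k) * \<tau> ^ (2 * l)"
          by (auto simp: g_def algebra_simps)
      qed
      also have "(\<Sum>l<k. 4 * \<tau> ^ (i + j) / (D k * D k) * \<tau> ^ (2 * l)) = 4 * \<tau> ^ (i + j) / (D k * D k) * D k"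
        unfolding D_def by (rule sum_distrib_left[symmetric])
      also have "\<dots> = 4 * \<tau> ^ (i + j) / D k" using D_pos[of k] ij by simp
      finally show ?thesis using ij by simp
    qed
    fix k r \<delta> j
    assume r: "r < k" and \<delta>: "\<forall>j<k. \<delta> j \<in> F" and zero: "(\<Sum>j<k. of_real (g k r j) * \<delta> j) = 0" and j: "j < k"
    have "\<Phi> k r \<delta> = \<Phi> k r (\<lambda>j. map \<delta> [0..<k] ! j)"
      using r by (simp add: \<Phi>_def)
    moreover have "map \<delta> [0..<k] \<in> lists F" using \<delta> by auto
    ultimately have "\<Phi> k r \<delta> \<in> P"
      unfolding P_def by (intro image_eqI[of _ _ "(k, r, map \<delta> [0..<k])"]) auto
    moreover have "poly (\<Phi> k r \<delta>) (of_real \<tau>) = of_real (D k) * (\<Sum>j<k. of_real (g k r j) * \<delta> j)"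
    proof -
      have "of_real (D k) * (\<Sum>j<k. of_real (g k r j) * \<delta> j)
          = (\<Sum>j<k. (if j = r then of_real (D k) * \<delta> r else 0) - 2 * \<delta> j * of_real \<tau> ^ (r + j))"
        unfolding sum_distrib_left
      proof (rule sum.cong[OF refl])
        fix j
        have "D k * g k r j = (if j = r then D k else 0) - 2 * \<tau> ^ (r + j)"
          using D_pos[of k] r by (simp add: g_def right_diff_distrib)
        then have "complex_of_real (D k * g k r j) = of_real ((if j = r then D k else 0) - 2 * \<tau> ^ (r + j))"
          by simp
        then show "of_real (D k) * (of_real (g k r j) * \<delta> j)
            = (if j = r then of_real (D k) * \<delta> r else 0) - 2 * \<delta> j * of_real \<tau> ^ (r + j)"
          by (simp add: mult.assoc[symmetric] left_diff_distrib split: if_splits)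
      qed
      also have "\<dots> = of_real (D k) * \<delta> r - (\<Sum>j<k. 2 * \<delta> j * of_real \<tau> ^ (r + j))"
        using r by (simp add: sum_subtractf)
      also have "\<dots> = poly (\<Phi> k r \<delta>) (of_real \<tau>)"
        by (simp add: \<Phi>_def D_def poly_sum poly_monom sum_distrib_left mult.commute)
      finally show ?thesis ..
    qed
    ultimately have "\<Phi> k r \<delta> = 0" using \<tau>[of "\<Phi> k r \<delta>"] zero by auto
    then have eq: "(\<Sum>i<k. monom (\<delta> r) (2 * i)) = (\<Sum>j<k. monom (2 * \<delta> j) (r + j))"
      by (simp add: \<Phi>_def)
    have coeff: "(\<Sum>i<k. coeff (monom (\<delta> r) (2 * i)) m) = (\<Sum>j<k. coeff (monom (2 * \<delta> j) (r + j)) m)" for m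
      using arg_cong[OF eq, of "\<lambda>p. coeff p m"] by (simp only: coeff_sum)
    have right: "(\<Sum>j<k. coeff (monom (2 * \<delta> j) (r + j)) (r + j')) = 2 * \<delta> j'" if "j' < k" for j'
    proof -
      have "(\<Sum>j<k. coeff (monom (2 * \<delta> j) (r + j)) (r + j')) = (\<Sum>j<k. if j = j' then 2 * \<delta> j else 0)"
        by (intro sum.cong) auto
      then show ?thesis using that by simp
    qed
    have left: "(\<Sum>i<k. coeff (monom (\<delta> r) (2 * i)) 0) = \<delta> r"
    proof -
      have "(\<Sum>i<k. coeff (monom (\<delta> r) (2 * i)) 0) = (\<Sum>i<k. if i = 0 then \<delta> r else 0)"
        by (intro sum.cong) auto
      then show ?thesis using r by simp
    qed
    \<comment> \<open>Comparison of constant coefficients: the left side gives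
      \<open>\<delta> r\<close>, the right side 0 for \<open>r > 0\<close> and
      \<open>2 * \<delta> 0\<close> for \<open>r = 0\<close>. Once \<open>\<delta> r\<close> is 0,
      the whole left side is, and every \<open>\<delta> j\<close> can be read off on the
      right.\<close>
    have "\<delta> r = 0"
    proof (cases "r = 0")
      case True
      then show ?thesis using coeff[of 0] left right[of 0] r by simp
    next
      case False
      then have "(\<Sum>j<k. coeff (monom (2 * \<delta> j) (r + j)) 0) = 0" by (intro sum.neutral) auto
      then show ?thesis using coeff[of 0] left by simp
    qed
    then show "\<delta> j = 0" using coeff[of "r + j"] right[OF j] by simp
  qed
qed

section \<open>Real normal form\<close>

lemma mult_mat_nth:
  assumes "A \<in> carrier_mat n m" "B \<in> carrier_mat m p" "i < n" "j < p"
  shows "(A * B) $$ (i, j) = (\<Sum>k<m. A $$ (i, k) * B $$ (k, j))"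
  using assms by (simp add: scalar_prod_def atLeast0LessThan)

text \<open>If \<open>X\<^sub>1 + \<i> X\<^sub>2\<close> intertwines two real matrices, so does every \<open>X\<^sub>1 + t X\<^sub>2\<close>, and
  \<open>det (X\<^sub>1 + t X\<^sub>2)\<close> is a polynomial in \<open>t\<close> that does not vanish at \<open>\<i>\<close>.\<close>

lemma real_intertwiner:
  fixes A B :: "real mat" and X :: "complex mat"
  assumes A: "A \<in> carrier_mat n n" and B: "B \<in> carrier_mat n n" and X: "X \<in> carrier_mat n n" "det X \<noteq> 0"
    and AX: "cmat A * X = X * cmat B"
  obtains Y :: "real mat" where "Y \<in> carrier_mat n n" "det Y \<noteq> 0" "A * Y = Y * B"
proof -
  define M where "M = mat n n (\<lambda>(i, j). [:complex_of_real (Re (X $$ (i, j))), complex_of_real (Im (X $$ (i, j))):])"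
  define Y where "Y t = mat n n (\<lambda>(i, j). Re (X $$ (i, j)) + t * Im (X $$ (i, j)))" for t
  have det_M: "poly (det M) z = det (map_mat (\<lambda>p. poly p z) M)" for z
    by (rule comm_ring_hom.hom_det[OF poly_hom.comm_ring_hom_axioms, symmetric])
  have "map_mat (\<lambda>p. poly p \<i>) M = X"
    using X(1) by (intro eq_matI) (auto simp: M_def complex_eq_iff)
  then have "poly (det M) \<i> \<noteq> 0" using X(2) by (simp add: det_M)
  then have "det M \<noteq> 0" by auto
  then obtain t :: real where t: "poly (det M) (of_real t) \<noteq> 0"
    using transcendental_real_exists[of "{det M}"] by auto
  have "map_mat (\<lambda>p. poly p (of_real t)) M = map_mat of_real (Y t)"
    by (intro eq_matI) (auto simp: M_def Y_def)
  then have "det (map_mat complex_of_real (Y t)) \<noteq> 0" using t by (simp add: det_M)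
  then have "det (Y t) \<noteq> 0" by (metis of_real_hom.hom_det of_real_0)
  moreover have "A * Y t = Y t * B"
  proof (rule eq_matI)
    fix i j assume "i < dim_row (Y t * B)" "j < dim_col (Y t * B)"
    then have ij: "i < n" "j < n" using B by (auto simp: Y_def)
    have "(cmat A * X) $$ (i, j) = (\<Sum>k<n. of_real (A $$ (i, k)) * X $$ (k, j))"
      using A X ij by (simp add: cmat_def scalar_prod_def atLeast0LessThan)
    moreover have "(X * cmat B) $$ (i, j) = (\<Sum>k<n. X $$ (i, k) * of_real (B $$ (k, j)))"
      using B X ij by (simp add: cmat_def scalar_prod_def atLeast0LessThan)
    ultimately have eq: "(\<Sum>k<n. of_real (A $$ (i, k)) * X $$ (k, j)) = (\<Sum>k<n. X $$ (i, k) * of_real (B $$ (k, j)))"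
      using AX by simp
    have "(\<Sum>k<n. A $$ (i, k) * Re (X $$ (k, j))) = (\<Sum>k<n. Re (X $$ (i, k)) * B $$ (k, j))"
      and "(\<Sum>k<n. A $$ (i, k) * Im (X $$ (k, j))) = (\<Sum>k<n. Im (X $$ (i, k)) * B $$ (k, j))"
      using arg_cong[OF eq, of Re] arg_cong[OF eq, of Im] by simp_all
    then have "(\<Sum>k<n. A $$ (i, k) * (Re (X $$ (k, j)) + t * Im (X $$ (k, j))))
        = (\<Sum>k<n. (Re (X $$ (i, k)) + t * Im (X $$ (i, k))) * B $$ (k, j))"
      by (simp add: distrib_left distrib_right sum.distrib mult.left_commute[of _ t] mult.assoc[of t] flip: sum_distrib_left)
    then show "(A * Y t) $$ (i, j) = (Y t * B) $$ (i, j)"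
      using A B ij by (simp add: Y_def scalar_prod_def atLeast0LessThan)
  qed (use A B in \<open>auto simp: Y_def\<close>)
  moreover have "Y t \<in> carrier_mat n n" by (simp add: Y_def)
  ultimately show thesis using that by blast
qed

text \<open>\<open>\<sigma>\<close> pairs an index with one of the conjugate eigenvalue, so that
  each pair carries the block with rows (Re, Im) and (-Im, Re), and a fixed point a real eigenvalue.
  Encoding by an involution needs no ordering of the eigenvalues.\<close>

definition real_normal_form :: "nat \<Rightarrow> (nat \<Rightarrow> complex) \<Rightarrow> (nat \<Rightarrow> nat) \<Rightarrow> real mat" where
  "real_normal_form n e \<sigma> = mat n n (\<lambda>(a, b). (if a = b then Re (e a) else 0) + (if b = \<sigma> a then Im (e a) else 0))"

lemma similar_real_normal_form:
  fixes A :: "real mat"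
  assumes A: "A \<in> carrier_mat n n" and sim: "similar_mat (cmat A) (mat n n (\<lambda>(a, b). if a = b then e a else 0))"
    and \<sigma>: "\<And>a. a < n \<Longrightarrow> \<sigma> a < n" "\<And>a. a < n \<Longrightarrow> \<sigma> (\<sigma> a) = a" "\<And>a. a < n \<Longrightarrow> e (\<sigma> a) = cnj (e a)"
  obtains Y :: "real mat" where "Y \<in> carrier_mat n n" "det Y \<noteq> 0" "A * Y = Y * real_normal_form n e \<sigma>"
proof -
  let ?B = "real_normal_form n e \<sigma>"
  let ?D = "mat n n (\<lambda>(a, b). if a = b then e a else 0)"
  \<comment> \<open>Column \<open>c\<close> is the unit vector at \<open>c\<close> plus
    \<open>\<i>\<close> times the one at \<open>\<sigma> c\<close>, an eigenvector of the normal
    form for \<open>e c\<close>; for \<open>\<sigma> c = c\<close> the entry is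
    \<open>1 + \<i>\<close>, which still is not 0.\<close>
  define T where "T = mat n n (\<lambda>(a, c). (if a = c then 1 else 0) + (if a = \<sigma> c then \<i> else 0))"
  have B: "?B \<in> carrier_mat n n" by (simp add: real_normal_form_def)
  have cB: "cmat ?B \<in> carrier_mat n n" using B by (simp add: cmat_def)
  have D: "?D \<in> carrier_mat n n" by simp
  have T: "T \<in> carrier_mat n n" by (simp add: T_def)
  have \<sigma>_swap: "\<sigma> a = c \<longleftrightarrow> a = \<sigma> c" if "a < n" "c < n" for a c using \<sigma>(2) that by metis
  have BT: "cmat ?B * T = T * ?D"
  proof (rule eq_matI)
    fix a c assume "a < dim_row (T * ?D)" "c < dim_col (T * ?D)"
    then have ac: "a < n" "c < n" by (auto simp: T_def)
    have "(cmat ?B * T) $$ (a, c)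
        = (\<Sum>b<n. (if b = a then of_real (Re (e a)) * T $$ (a, c) else 0) + (if b = \<sigma> a then of_real (Im (e a)) * T $$ (\<sigma> a, c) else 0))"
      unfolding mult_mat_nth[OF cB T ac]
      using ac by (intro sum.cong) (auto simp: cmat_def real_normal_form_def algebra_simps)
    also have "\<dots> = of_real (Re (e a)) * T $$ (a, c) + of_real (Im (e a)) * T $$ (\<sigma> a, c)"
      using ac \<sigma>(1) by (simp add: sum.distrib)
    also have "\<dots> = T $$ (a, c) * e c"
      using ac \<sigma>(1)[OF ac(1)] \<sigma>(2)[OF ac(1)] \<sigma>(2)[OF ac(2)] \<sigma>(3)[OF ac(2)] \<sigma>_swap[OF ac]
      by (auto simp: T_def complex_eq_iff)
    also have "\<dots> = (\<Sum>b<n. if b = c then T $$ (a, b) * e c else 0)"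
      using ac by simp
    also have "\<dots> = (T * ?D) $$ (a, c)"
      unfolding mult_mat_nth[OF T D ac] using ac by (intro sum.cong) auto
    finally show "(cmat ?B * T) $$ (a, c) = (T * ?D) $$ (a, c)" .
  qed (use B T in \<open>auto simp: cmat_def\<close>)
  \<comment> \<open>A kernel vector satisfies \<open>v $ a = - \<i> * v $ \<sigma> a\<close>;
    applied twice, this gives \<open>v $ a = - v $ a\<close>.\<close>
  have "det T \<noteq> 0"
  proof
    assume "det T = 0"
    then obtain v where v: "v \<in> carrier_vec n" "v \<noteq> 0\<^sub>v n" "T *\<^sub>v v = 0\<^sub>v n"
      using det_0_iff_vec_prod_zero[OF T] by blast
    have Tv: "v $ a + \<i> * v $ \<sigma> a = 0" if a: "a < n" for a
    proof -
      have "(T *\<^sub>v v) $ a = (\<Sum>c<n. (if c = a then v $ a else 0) + (if c = \<sigma> a then \<i> * v $ \<sigma> a else 0))"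
      proof -
        have "(T *\<^sub>v v) $ a = (\<Sum>c<n. T $$ (a, c) * v $ c)"
          using a v(1) T by (simp add: scalar_prod_def atLeast0LessThan)
        also have "\<dots> = (\<Sum>c<n. (if c = a then v $ a else 0) + (if c = \<sigma> a then \<i> * v $ \<sigma> a else 0))"
        proof (intro sum.cong refl)
          fix c assume "c \<in> {..<n}"
          then have c: "c < n" by simp
          have eq: "(a = \<sigma> c) = (c = \<sigma> a)" "(a = c) = (c = a)" using \<sigma>_swap[OF a c] by auto
          have "T $$ (a, c) = (if c = a then 1 else 0) + (if c = \<sigma> a then \<i> else 0)"
            using a c by (simp add: T_def eq)
          then show "T $$ (a, c) * v $ c = (if c = a then v $ a else 0) + (if c = \<sigma> a then \<i> * v $ \<sigma> a else 0)"
            by (simp add: distrib_right)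
        qed
        finally show ?thesis .
      qed
      then show ?thesis using a v(3) \<sigma>(1) by (simp add: sum.distrib)
    qed
    have "v $ a = 0" if a: "a < n" for a
      using Tv[OF a] Tv[OF \<sigma>(1)[OF a]] \<sigma>(2)[OF a] by (auto simp: complex_eq_iff)
    then show False using v(1,2) by (auto simp: vec_eq_iff)
  qed
  then obtain K where K: "K \<in> carrier_mat n n" "T * K = 1\<^sub>m n" "K * T = 1\<^sub>m n"
    using mat_inverse_exists[OF T] by blast
  obtain P Q where PQ: "P \<in> carrier_mat n n" "Q \<in> carrier_mat n n" "P * Q = 1\<^sub>m n" "Q * P = 1\<^sub>m n" "cmat A = P * ?D * Q"
  proof -
    obtain P Q where wit: "similar_mat_wit (cmat A) ?D P Q" using sim by (auto simp: similar_mat_def)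
    have cA: "cmat A \<in> carrier_mat n n" using A by (simp add: cmat_def)
    note w = similar_mat_witD2[OF cA wit]
    show thesis by (rule that[OF w(6) w(7) w(1) w(2) w(3)])
  qed
  have "det P * det Q = 1" using det_mult[OF PQ(1,2)] PQ(3) by simp
  moreover have "det T * det K = 1" using det_mult[OF T K(1)] K(2) by simp
  ultimately have "det P \<noteq> 0" "det K \<noteq> 0" by auto
  then have "det (P * K) \<noteq> 0" using det_mult[OF PQ(1) K(1)] by simp
  moreover have "cmat A * (P * K) = (P * K) * cmat ?B"
  proof -
    have "K * cmat ?B = K * (cmat ?B * (T * K))" using K cB by simp
    also have "\<dots> = K * (cmat ?B * T) * K" using K cB T by (simp add: assoc_mult_mat[of _ n n _ n _ n] mult_carrier_mat[of _ n n _ n])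
    also have "\<dots> = (K * T) * ?D * K" by (simp only: BT assoc_mult_mat[OF K(1) T D])
    also have "\<dots> = ?D * K" unfolding K(3) using K(1) D by simp
    finally have KB: "K * cmat ?B = ?D * K" .
    have "cmat A * (P * K) = P * ?D * (Q * P) * K"
      unfolding PQ(5) using PQ(1,2) D K(1) by (simp add: assoc_mult_mat[of _ n n _ n _ n] mult_carrier_mat[of _ n n _ n])
    also have "\<dots> = P * (?D * K)" unfolding PQ(4) using PQ(1,2) D K(1) by (simp add: assoc_mult_mat[of _ n n _ n _ n] mult_carrier_mat[of _ n n _ n])
    also have "\<dots> = (P * K) * cmat ?B" unfolding KB[symmetric] using PQ(1) K(1) cB by (simp add: assoc_mult_mat[of _ n n _ n _ n] mult_carrier_mat[of _ n n _ n])
    finally show ?thesis .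
  qed
  moreover have "P * K \<in> carrier_mat n n" using PQ K by simp
  ultimately show thesis using real_intertwiner[OF A B] that by blast
qed

section \<open>Construction of a scheme from the spectrum\<close>

lemma alg_conjugate_root_int:
  assumes "alg_conjugate x y" "poly (map_poly of_int q) x = 0"
  shows "poly (map_poly of_int q) y = 0"
proof -
  have "map_poly of_int q = (map_poly of_rat (map_poly of_int q) :: complex poly)"
    by (simp add: map_poly_map_poly o_def)
  then show ?thesis using alg_conjugate_root[OF assms(1), of "map_poly of_int q"] assms(2) by simp
qed

lemma pderiv_prod_linear_root:
  fixes R :: "complex set"
  assumes "finite R" "\<nu> \<in> R"
  shows "poly (pderiv (\<Prod>x\<in>R. [:-x, 1:])) \<nu> \<noteq> 0"
proof -
  define q where "q = (\<Prod>x\<in>R - {\<nu>}. [:-x, 1:])"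
  have "(\<Prod>x\<in>R. [:-x, 1:]) = [:-\<nu>, 1:] * q" unfolding q_def using assms by (rule prod.remove)
  then have "poly (pderiv (\<Prod>x\<in>R. [:-x, 1:])) \<nu> = poly q \<nu>"
    by (simp only: pderiv_mult poly_add poly_mult) (simp add: pderiv_pCons)
  also have "\<dots> \<noteq> 0" using assms by (auto simp: q_def poly_prod)
  finally show ?thesis .
qed

text \<open>Inverting the Vandermonde system over \<open>\<int>\<close>: with \<open>h(x) = \<Sum>\<^sub>\<nu> \<delta>\<^sub>\<nu> f(x) / (x - \<nu>)\<close>, the coefficients of
  \<open>h\<close> are integral combinations of the power sums \<open>t\<^sub>i\<close>, and \<open>h(\<nu>) = \<delta>\<^sub>\<nu> f'(\<nu>)\<close>.\<close>

lemma power_sum_dual_int: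
  fixes f :: "int poly" and R :: "complex set" and \<delta> :: "complex \<Rightarrow> complex" and t :: "nat \<Rightarrow> int"
  assumes "finite R" and f: "map_poly of_int f = (\<Prod>x\<in>R. [:-x, 1:])"
    and t: "\<And>i. i < card R \<Longrightarrow> (\<Sum>\<nu>\<in>R. \<delta> \<nu> * \<nu> ^ i) = of_int (t i)"
  shows "\<exists>h :: int poly. \<forall>\<nu>\<in>R. poly (map_poly of_int h) \<nu> = \<delta> \<nu> * poly (map_poly of_int (pderiv f)) \<nu>"
proof -
  \<comment> \<open>For a root \<nu>, \<open>f(x) / (x - \<nu>)\<close> is the sum over
    \<open>M\<close> of the coefficient of \<open>f\<close> times the sum over \<open>l < M\<close>
    of \<open>x ^ (M - Suc l) * \<nu> ^ l\<close>. Summed against \<delta>, the powers of \<nu> turn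
    into \<open>t l\<close>.\<close>
  define h where "h = (\<Sum>M\<le>degree f. \<Sum>l<M. monom (coeff f M * t l) (M - Suc l))"
  define a where "a M = complex_of_int (coeff f M)" for M
  have deg: "degree f = card R"
  proof -
    have "degree (map_poly complex_of_int f) = card R"
      unfolding f using assms(1) by (subst degree_prod_eq_sum_degree) auto
    then show ?thesis by simp
  qed
  have f_eval: "poly (map_poly of_int f) x = (\<Sum>M\<le>degree f. a M * x ^ M)" for x :: complex
    by (simp add: poly_altdef a_def)
  have pderiv_eval: "poly (map_poly of_int (pderiv f)) x = (\<Sum>M\<le>degree f. a M * (of_nat M * x ^ (M - 1)))" for x :: complex
  proof (cases "degree f")
    case 0
    then show ?thesis by (auto simp: pderiv_eq_0_iff[THEN iffD2])
  next
    case (Suc D)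
    have "degree (pderiv f) = D" by (simp add: degree_pderiv Suc)
    then have "poly (map_poly of_int (pderiv f)) x = (\<Sum>M\<le>D. of_int (of_nat (Suc M) * coeff f (Suc M)) * x ^ M)"
      by (simp add: poly_altdef coeff_pderiv)
    also have "\<dots> = (\<Sum>M\<le>Suc D. a M * (of_nat M * x ^ (M - 1)))"
      by (subst sum.atMost_Suc_shift) (simp add: a_def algebra_simps)
    finally show ?thesis by (simp add: Suc)
  qed
  have "poly (map_poly of_int h) \<mu> = \<delta> \<mu> * poly (map_poly of_int (pderiv f)) \<mu>" if \<mu>: "\<mu> \<in> R" for \<mu>
  proof -
    \<comment> \<open>The value at \<mu> of \<open>f(x) / (x - \<nu>)\<close>: for \<nu> different
      from \<mu> it vanishes, since both are roots, and for \<nu> equal to \<mu> it is the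
      derivative.\<close>
    define K where "K \<nu> = (\<Sum>M\<le>degree f. a M * (\<Sum>l<M. \<mu> ^ (M - Suc l) * \<nu> ^ l))" for \<nu>
    have root: "poly (map_poly of_int f) \<nu> = (0 :: complex)" if "\<nu> \<in> R" for \<nu>
      unfolding f using assms(1) that by (auto simp: poly_prod)
    have K: "K \<nu> = (if \<nu> = \<mu> then poly (map_poly of_int (pderiv f)) \<mu> else 0)" if \<nu>: "\<nu> \<in> R" for \<nu>
    proof (cases "\<nu> = \<mu>")
      case True
      have "(\<Sum>l<M. \<mu> ^ (M - Suc l) * \<mu> ^ l) = of_nat M * \<mu> ^ (M - 1)" for M
      proof -
        have "(\<Sum>l<M. \<mu> ^ (M - Suc l) * \<mu> ^ l) = (\<Sum>l<M. \<mu> ^ (M - 1))"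
          by (intro sum.cong refl) (auto simp flip: power_add)
        then show ?thesis by simp
      qed
      then show ?thesis by (simp add: K_def True pderiv_eval)
    next
      case False
      have "(\<nu> - \<mu>) * K \<nu> = (\<Sum>M\<le>degree f. a M * (\<nu> ^ M - \<mu> ^ M))"
        unfolding K_def sum_distrib_left
        by (intro sum.cong refl) (simp add: power_diff_sumr2 sum_distrib_left mult.left_commute mult.assoc)
      also have "\<dots> = 0"
        using root[OF \<nu>] root[OF \<mu>] by (simp add: f_eval right_diff_distrib sum_subtractf)
      finally show ?thesis using False by simp
    qed
    have "poly (map_poly of_int h) \<mu> = (\<Sum>M\<le>degree f. \<Sum>l<M. a M * of_int (t l) * \<mu> ^ (M - Suc l))"
      by (simp add: h_def of_int_poly_hom.hom_sum poly_sum of_int_hom.map_poly_hom_monom poly_monom a_def)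
    also have "\<dots> = (\<Sum>M\<le>degree f. \<Sum>l<M. \<Sum>\<nu>\<in>R. \<delta> \<nu> * (a M * (\<mu> ^ (M - Suc l) * \<nu> ^ l)))"
    proof (intro sum.cong refl)
      fix M l assume "M \<in> {..degree f}" "l \<in> {..<M}"
      then have "l < card R" by (auto simp: deg)
      then show "a M * of_int (t l) * \<mu> ^ (M - Suc l) = (\<Sum>\<nu>\<in>R. \<delta> \<nu> * (a M * (\<mu> ^ (M - Suc l) * \<nu> ^ l)))"
        by (simp add: t[symmetric] sum_distrib_left sum_distrib_right ac_simps)
    qed
    also have "\<dots> = (\<Sum>M\<le>degree f. \<Sum>\<nu>\<in>R. \<Sum>l<M. \<delta> \<nu> * (a M * (\<mu> ^ (M - Suc l) * \<nu> ^ l)))"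
      by (intro sum.cong refl sum.swap)
    also have "\<dots> = (\<Sum>\<nu>\<in>R. \<Sum>M\<le>degree f. \<Sum>l<M. \<delta> \<nu> * (a M * (\<mu> ^ (M - Suc l) * \<nu> ^ l)))"
      by (rule sum.swap)
    also have "\<dots> = (\<Sum>\<nu>\<in>R. \<delta> \<nu> * K \<nu>)" by (simp add: K_def sum_distrib_left)
    also have "\<dots> = (\<Sum>\<nu>\<in>R. if \<nu> = \<mu> then \<delta> \<mu> * poly (map_poly of_int (pderiv f)) \<mu> else 0)"
      by (intro sum.cong refl) (simp add: K)
    also have "\<dots> = \<delta> \<mu> * poly (map_poly of_int (pderiv f)) \<mu>" using assms(1) \<mu> by simp
    finally show ?thesis .
  qed
  then show ?thesis by blast
qed

section \<open>Coordinates on the sum of rings\<close>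

text \<open>Here \<open>A\<close> enters only through its multiplicities \<open>m\<close>. The
  assumption \<open>m_pos\<close> makes \<open>pi_par\<close> injective and is used again for
  density, \<open>m_less\<close> makes \<open>pi_perp\<close> injective, and \<open>small\<close>
  keeps the internal space from expanding. By \<open>g_indep\<close> no row of \<open>g n\<close>
  annihilates a nonzero vector with entries in the countable set.\<close>

locale conjugate_multiplicities =
  fixes S :: "complex set" and m k :: "complex \<Rightarrow> nat" and f :: "nat \<Rightarrow> int poly" and g :: "nat \<Rightarrow> nat \<Rightarrow> nat \<Rightarrow> real"
  assumes finite_S: "finite S"
    and alg: "\<And>\<nu>. \<nu> \<in> S \<Longrightarrow> algebraic \<nu>"
    and conj_S: "\<And>\<nu> \<mu>. \<nu> \<in> S \<Longrightarrow> alg_conjugate \<nu> \<mu> \<Longrightarrow> \<mu> \<in> S"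
    and k_conj: "\<And>\<nu> \<mu>. \<nu> \<in> S \<Longrightarrow> alg_conjugate \<nu> \<mu> \<Longrightarrow> k \<mu> = k \<nu>"
    and m_cnj: "\<And>\<nu>. m (cnj \<nu>) = m \<nu>"
    and m_le_k: "\<And>\<nu>. \<nu> \<in> S \<Longrightarrow> m \<nu> \<le> k \<nu>"
    and m_pos: "\<And>\<nu>. \<nu> \<in> S \<Longrightarrow> \<exists>\<mu>. alg_conjugate \<nu> \<mu> \<and> m \<mu> > 0"
    and m_less: "\<And>\<nu>. \<nu> \<in> S \<Longrightarrow> \<exists>\<mu>. alg_conjugate \<nu> \<mu> \<and> m \<mu> < k \<mu>"
    and small: "\<And>\<nu>. \<nu> \<in> S \<Longrightarrow> m \<nu> < k \<nu> \<Longrightarrow> cmod \<nu> \<le> 1"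
    and f: "\<And>j. map_poly of_int (f j) = (\<Prod>\<nu>\<in>{\<nu>\<in>S. j < k \<nu>}. [:-\<nu>, 1:])"
    and g_sym: "\<And>n i j. g n i j = g n j i"
    and g_inv: "\<And>n i j. i < n \<Longrightarrow> j < n \<Longrightarrow> (\<Sum>l<n. g n i l * g n l j) = (if i = j then 1 else 0)"
    and g_indep: "\<And>n r \<delta> j. r < n \<Longrightarrow>
      (\<And>j. j < n \<Longrightarrow> \<delta> j \<in> {poly (map_poly of_int a) \<nu> / poly (map_poly of_int b) \<nu> | a b \<nu>. \<nu> \<in> S}) \<Longrightarrow>
      (\<Sum>j<n. of_real (g n r j) * \<delta> j) = 0 \<Longrightarrow> j < n \<Longrightarrow> \<delta> j = 0"
begin

definition R :: "nat \<Rightarrow> complex set" where "R j = {\<nu>\<in>S. j < k \<nu>}"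

text \<open>\<open>x j i\<close> is the coefficient of the \<open>i\<close>-th power in block
  \<open>j\<close>; the values at the roots of \<open>f j\<close> diagonalise multiplication by the
  variable.\<close>

definition eval :: "(nat \<Rightarrow> nat \<Rightarrow> real) \<Rightarrow> nat \<Rightarrow> complex \<Rightarrow> complex" where
  "eval x j \<nu> = (\<Sum>i<card (R j). of_real (x j i) * \<nu> ^ i)"

text \<open>The \<open>k \<nu>\<close> values at \<nu>, one from each block with root \<nu>, are
  coordinates on the eigenspace of \<nu>, and \<open>g\<close> changes its basis. Coordinates below
  \<open>m \<nu>\<close> go to the physical space, the remaining ones to the internal space.\<close>

definition eigen_coord :: "(nat \<Rightarrow> nat \<Rightarrow> real) \<Rightarrow> complex \<Rightarrow> nat \<Rightarrow> complex" where
  "eigen_coord x \<nu> j = (\<Sum>l<k \<nu>. of_real (g (k \<nu>) j l) * eval x l \<nu>)"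

text \<open>For a conjugate pair \<open>\<nu>\<close>, \<open>\<nu>'\<close> the two real numbers \<open>Re z + Im z\<close> and \<open>Re z - Im z\<close> determine \<open>z\<close>;
  for real \<open>\<nu>\<close> both are equal to \<open>z\<close>.\<close>

definition real_coord :: "(nat \<Rightarrow> nat \<Rightarrow> real) \<Rightarrow> complex \<Rightarrow> nat \<Rightarrow> real" where
  "real_coord x \<nu> j = Re (eigen_coord x \<nu> j) + Im (eigen_coord x \<nu> j)"

text \<open>Multiplication by the variable modulo \<open>f j\<close>, in every block \<open>j\<close>.\<close>

definition shift :: "(nat \<Rightarrow> nat \<Rightarrow> 'a :: comm_ring_1) \<Rightarrow> nat \<Rightarrow> nat \<Rightarrow> 'a" where
  "shift x j i = (if i = 0 then 0 else x j (i - 1)) - x j (card (R j) - 1) * of_int (coeff (f j) i)"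

lemma finite_R [simp]: "finite (R j)"
  using finite_S by (simp add: R_def)

lemma f_R: "map_poly of_int (f j) = (\<Prod>\<nu>\<in>R j. [:-\<nu>, 1:])"
  using f by (simp add: R_def)

lemma cnj_S: "\<nu> \<in> S \<Longrightarrow> cnj \<nu> \<in> S"
  using alg alg_conjugate_cnj conj_S by blast

lemma k_cnj: "\<nu> \<in> S \<Longrightarrow> k (cnj \<nu>) = k \<nu>"
  using alg alg_conjugate_cnj k_conj by blast

text \<open>Reduction of the leading term subtracts a multiple of the monic \<open>f j\<close>,
  which vanishes at \<nu>.\<close>

lemma eval_shift:
  assumes "\<nu> \<in> R j"
  shows "eval (shift x) j \<nu> = \<nu> * eval x j \<nu>"
proof -
  have deg: "degree (f j) = card (R j)"
  proof -
    have "degree (map_poly complex_of_int (f j)) = card (R j)"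
      unfolding f_R by (subst degree_prod_eq_sum_degree) auto
    then show ?thesis by simp
  qed
  have "lead_coeff (map_poly complex_of_int (f j)) = 1"
    unfolding f_R by (simp add: lead_coeff_prod)
  then have lead: "coeff (f j) (card (R j)) = 1" using deg by simp
  have "poly (map_poly of_int (f j)) \<nu> = 0"
    unfolding f_R using assms by (auto simp: poly_prod)
  then have root: "(\<Sum>i\<le>card (R j). of_int (coeff (f j) i) * \<nu> ^ i) = 0"
    by (simp add: poly_altdef deg)
  obtain D where D: "card (R j) = Suc D"
    using assms by (metis card_gt_0_iff empty_iff finite_R gr0_implies_Suc)
  have "eval (shift x) j \<nu> = (\<Sum>i<Suc D. of_real (if i = 0 then 0 else x j (i - 1)) * \<nu> ^ i)
      - of_real (x j D) * (\<Sum>i<Suc D. of_int (coeff (f j) i) * \<nu> ^ i)"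
    by (simp add: eval_def shift_def D left_diff_distrib sum_subtractf sum_distrib_left mult.assoc distrib_left)
  also have "(\<Sum>i<Suc D. of_real (if i = 0 then 0 else x j (i - 1)) * \<nu> ^ i) = (\<Sum>i<D. of_real (x j i) * \<nu> ^ Suc i)"
    by (subst sum.lessThan_Suc_shift) simp
  also have "(\<Sum>i<Suc D. of_int (coeff (f j) i) * \<nu> ^ i) = - (\<nu> ^ Suc D)"
    using root lead by (simp add: D lessThan_Suc_atMost add_eq_0_iff)
  finally show ?thesis
    by (simp add: eval_def D sum_distrib_left algebra_simps)
qed

lemma eigen_coord_shift:
  assumes "\<nu> \<in> S"
  shows "eigen_coord (shift x) \<nu> j = \<nu> * eigen_coord x \<nu> j"
proof -
  have "eval (shift x) l \<nu> = \<nu> * eval x l \<nu>" if "l < k \<nu>" for l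
    using assms that by (intro eval_shift) (simp add: R_def)
  then show ?thesis by (simp add: eigen_coord_def sum_distrib_left mult.left_commute)
qed

lemma eigen_coord_cnj:
  assumes "\<nu> \<in> S"
  shows "eigen_coord x (cnj \<nu>) j = cnj (eigen_coord x \<nu> j)"
  by (simp add: eigen_coord_def eval_def k_cnj[OF assms])

lemma real_coord_shift:
  assumes "\<nu> \<in> S"
  shows "real_coord (shift x) \<nu> j = Re \<nu> * real_coord x \<nu> j + Im \<nu> * real_coord x (cnj \<nu>) j"
  unfolding real_coord_def eigen_coord_cnj[OF assms] eigen_coord_shift[OF assms]
  by (simp add: algebra_simps)

lemma eigen_coord_eq_0:
  assumes "\<nu> \<in> S" "real_coord x \<nu> j = 0" "real_coord x (cnj \<nu>) j = 0"
  shows "eigen_coord x \<nu> j = 0"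
  using assms(2,3) unfolding real_coord_def eigen_coord_cnj[OF assms(1)] by (simp add: complex_eq_iff)

lemma g_cancel:
  fixes e :: "nat \<Rightarrow> complex"
  assumes "\<And>j. j < n \<Longrightarrow> (\<Sum>l<n. of_real (g n j l) * e l) = 0" "l < n"
  shows "e l = 0"
proof -
  have "(\<Sum>j<n. of_real (g n l j) * (\<Sum>i<n. of_real (g n j i) * e i)) = (\<Sum>i<n. of_real (\<Sum>j<n. g n l j * g n j i) * e i)"
    unfolding of_real_sum of_real_mult sum_distrib_left sum_distrib_right
    by (subst sum.swap) (simp add: mult.assoc)
  also have "\<dots> = (\<Sum>i<n. if i = l then e i else 0)"
    using g_inv[OF assms(2)] by (intro sum.cong refl) (simp del: of_real_sum)
  also have "\<dots> = e l" using assms(2) by simp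
  finally show ?thesis using assms(1) by simp
qed

lemma eval_eq_0_imp:
  assumes "\<And>\<nu>. \<nu> \<in> R j \<Longrightarrow> eval x j \<nu> = 0" "i < card (R j)"
  shows "x j i = 0"
proof -
  define p where "p = (\<Sum>i<card (R j). monom (complex_of_real (x j i)) i)"
  have p: "poly p \<nu> = eval x j \<nu>" for \<nu>
    by (simp add: p_def eval_def poly_sum poly_monom)
  have "p = 0"
  proof (rule ccontr)
    assume p0: "p \<noteq> 0"
    have "degree p < card (R j)"
      unfolding p_def using assms(2)
      by (intro degree_sum_less) (auto intro: le_less_trans[OF degree_monom_le])
    moreover have "card (R j) \<le> card {\<nu>. poly p \<nu> = 0}"
      using assms(1) p poly_roots_finite[OF p0] by (intro card_mono) auto
    moreover have "card {\<nu>. poly p \<nu> = 0} \<le> degree p" using p0 by (rule card_poly_roots_bound)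
    ultimately show False by simp
  qed
  moreover have "coeff p i = of_real (x j i)"
    using assms(2) by (simp add: p_def coeff_sum)
  ultimately show ?thesis by simp
qed

lemma real_coord_injective:
  assumes "\<And>\<nu> j. \<nu> \<in> S \<Longrightarrow> j < k \<nu> \<Longrightarrow> real_coord x \<nu> j = 0" "i < card (R j)"
  shows "x j i = 0"
proof (rule eval_eq_0_imp[OF _ assms(2)])
  fix \<nu> assume "\<nu> \<in> R j"
  then have \<nu>: "\<nu> \<in> S" "j < k \<nu>" by (auto simp: R_def)
  have "eigen_coord x \<nu> r = 0" if "r < k \<nu>" for r
    using \<nu> that assms(1) cnj_S k_cnj by (intro eigen_coord_eq_0) auto
  then have "(\<Sum>l<k \<nu>. of_real (g (k \<nu>) r l) * eval x l \<nu>) = 0" if "r < k \<nu>" for r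
    using that by (simp add: eigen_coord_def)
  then show "eval x j \<nu> = 0" using \<nu>(2) by (rule g_cancel)
qed

lemma int_poly_value_in_F:
  assumes "\<nu> \<in> S"
  shows "poly (map_poly of_int a) \<nu> / poly (map_poly of_int b) \<nu> \<in>
    {poly (map_poly of_int a) \<nu> / poly (map_poly of_int b) \<nu> | a b \<nu>. \<nu> \<in> S}"
  using assms by blast

text \<open>A nonzero integer block has a nonzero value at some root, and then at all its
  conjugates. Genericity of \<open>g\<close> forbids cancellation between blocks, so already a
  single zero coordinate at a single conjugate is impossible. Injectivity of both projections on
  integer vectors reduces to this.\<close>

lemma eigen_coord_int_nonzero:
  fixes x :: "nat \<Rightarrow> nat \<Rightarrow> int"
  assumes "i < card (R j)" "x j i \<noteq> 0"
  obtains \<nu> where "\<nu> \<in> S" "\<And>\<mu> r. alg_conjugate \<nu> \<mu> \<Longrightarrow> r < k \<mu> \<Longrightarrow> eigen_coord (\<lambda>j i. of_int (x j i)) \<mu> r \<noteq> 0"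
proof -
  let ?x = "\<lambda>j i. real_of_int (x j i)"
  define q where "q l = (\<Sum>i<card (R l). monom (x l i) i)" for l
  have q: "poly (map_poly of_int (q l)) \<nu> = eval ?x l \<nu>" for l \<nu>
    by (simp add: q_def eval_def of_int_poly_hom.hom_sum poly_sum of_int_hom.map_poly_hom_monom poly_monom)
  obtain \<nu> where \<nu>: "\<nu> \<in> R j" "eval ?x j \<nu> \<noteq> 0"
    using eval_eq_0_imp[of j ?x i] assms by auto
  then have \<nu>S: "\<nu> \<in> S" "j < k \<nu>" by (auto simp: R_def)
  have "eigen_coord ?x \<mu> r \<noteq> 0" if \<mu>: "alg_conjugate \<nu> \<mu>" and r: "r < k \<mu>" for \<mu> r
  proof
    assume "eigen_coord ?x \<mu> r = 0"
    then have zero: "(\<Sum>l<k \<mu>. of_real (g (k \<mu>) r l) * eval ?x l \<mu>) = 0" by (simp add: eigen_coord_def)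
    have \<mu>S: "\<mu> \<in> S" "j < k \<mu>" using conj_S[OF \<nu>S(1) \<mu>] k_conj[OF \<nu>S(1) \<mu>] \<nu>S(2) by auto
    have "eval ?x j \<mu> = 0"
    proof (rule g_indep[OF r _ zero \<mu>S(2)])
      show "eval ?x l \<mu> \<in> {poly (map_poly of_int a) \<nu> / poly (map_poly of_int b) \<nu> | a b \<nu>. \<nu> \<in> S}" for l
        using int_poly_value_in_F[OF \<mu>S(1), of "q l" 1] by (simp add: q)
    qed
    then have "poly (map_poly of_int (q j)) \<mu> = 0" by (simp add: q)
    then have "poly (map_poly of_int (q j)) \<nu> = 0"
      using alg_conjugate_root_int alg_conjugate_sym[OF \<mu>] by blast
    then show False using \<nu>(2) by (simp add: q)
  qed
  then show thesis using that \<nu>S(1) by blast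
qed

text \<open>One physical coordinate in the class of \<nu> is enough: index 0 at the conjugate
  provided by \<open>m_pos\<close>.\<close>

lemma real_coord_par_int_injective:
  fixes x :: "nat \<Rightarrow> nat \<Rightarrow> int"
  assumes "\<And>\<nu> j. \<nu> \<in> S \<Longrightarrow> j < m \<nu> \<Longrightarrow> real_coord (\<lambda>j i. of_int (x j i)) \<nu> j = 0" "i < card (R j)"
  shows "x j i = 0"
proof (rule ccontr)
  assume "x j i \<noteq> 0"
  then obtain \<nu> where \<nu>: "\<nu> \<in> S"
    "\<And>\<mu> r. alg_conjugate \<nu> \<mu> \<Longrightarrow> r < k \<mu> \<Longrightarrow> eigen_coord (\<lambda>j i. of_int (x j i)) \<mu> r \<noteq> 0"
    using eigen_coord_int_nonzero[of i j x] assms(2) by blast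
  obtain \<mu> where \<mu>: "alg_conjugate \<nu> \<mu>" "m \<mu> > 0" using m_pos[OF \<nu>(1)] by blast
  have \<mu>S: "\<mu> \<in> S" using conj_S \<nu>(1) \<mu>(1) by blast
  have "eigen_coord (\<lambda>j i. of_int (x j i)) \<mu> 0 = 0"
    using assms(1) \<mu>S \<mu>(2) cnj_S m_cnj by (intro eigen_coord_eq_0) auto
  then show False using \<nu>(2)[OF \<mu>(1), of 0] \<mu>(2) m_le_k[OF \<mu>S] by simp
qed

text \<open>Again one coordinate is enough: the first internal index \<open>m \<mu>\<close> at the
  conjugate provided by \<open>m_less\<close>.\<close>

lemma real_coord_perp_int_injective:
  fixes x :: "nat \<Rightarrow> nat \<Rightarrow> int"
  assumes "\<And>\<nu> j. \<nu> \<in> S \<Longrightarrow> m \<nu> \<le> j \<Longrightarrow> j < k \<nu> \<Longrightarrow> real_coord (\<lambda>j i. of_int (x j i)) \<nu> j = 0" "i < card (R j)"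
  shows "x j i = 0"
proof (rule ccontr)
  assume "x j i \<noteq> 0"
  then obtain \<nu> where \<nu>: "\<nu> \<in> S"
    "\<And>\<mu> r. alg_conjugate \<nu> \<mu> \<Longrightarrow> r < k \<mu> \<Longrightarrow> eigen_coord (\<lambda>j i. of_int (x j i)) \<mu> r \<noteq> 0"
    using eigen_coord_int_nonzero[of i j x] assms(2) by blast
  obtain \<mu> where \<mu>: "alg_conjugate \<nu> \<mu>" "m \<mu> < k \<mu>" using m_less[OF \<nu>(1)] by blast
  have \<mu>S: "\<mu> \<in> S" using conj_S \<nu>(1) \<mu>(1) by blast
  have "eigen_coord (\<lambda>j i. of_int (x j i)) \<mu> (m \<mu>) = 0"
    using assms(1) \<mu>S \<mu>(2) cnj_S m_cnj k_cnj by (intro eigen_coord_eq_0) auto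
  then show False using \<nu>(2)[OF \<mu>] by simp
qed

end

section \<open>Contraction and density in the internal space\<close>

context conjugate_multiplicities
begin

lemma sum_cnj:
  fixes h :: "complex \<Rightarrow> 'b :: comm_monoid_add"
  shows "(\<Sum>\<nu>\<in>S. h (cnj \<nu>)) = (\<Sum>\<nu>\<in>S. h \<nu>)"
  by (rule sum.reindex_bij_witness[of _ cnj cnj]) (auto intro: cnj_S)

text \<open>On a conjugate pair the map is \<open>cmod \<nu>\<close> times a rotation: the cross
  terms of \<nu> and \<open>cnj \<nu>\<close> cancel, because \<open>Im\<close> changes its sign,
  and the squares regroup with weight \<open>(cmod \<nu>)\<^sup>2\<close>. This is at most 1
  wherever an internal coordinate exists.\<close>

lemma perp_norm_le:
  fixes y :: "complex \<Rightarrow> nat \<Rightarrow> real"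
  shows "(\<Sum>\<nu>\<in>S. \<Sum>j\<in>{m \<nu>..<k \<nu>}. (Re \<nu> * y \<nu> j + Im \<nu> * y (cnj \<nu>) j)\<^sup>2)
    \<le> (\<Sum>\<nu>\<in>S. \<Sum>j\<in>{m \<nu>..<k \<nu>}. (y \<nu> j)\<^sup>2)"
proof -
  define Y where "Y \<nu> = (\<Sum>j\<in>{m \<nu>..<k \<nu>}. (y \<nu> j)\<^sup>2)" for \<nu>
  define X where "X \<nu> = (\<Sum>j\<in>{m \<nu>..<k \<nu>}. y \<nu> j * y (cnj \<nu>) j)" for \<nu>
  have X_cnj: "X (cnj \<nu>) = X \<nu>" if "\<nu> \<in> S" for \<nu>
    by (simp add: X_def m_cnj k_cnj[OF that] mult.commute)
  have "(\<Sum>\<nu>\<in>S. 2 * Re \<nu> * Im \<nu> * X \<nu>) = (\<Sum>\<nu>\<in>S. 2 * Re (cnj \<nu>) * Im (cnj \<nu>) * X (cnj \<nu>))"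
    by (rule sum_cnj[symmetric])
  also have "\<dots> = - (\<Sum>\<nu>\<in>S. 2 * Re \<nu> * Im \<nu> * X \<nu>)"
    by (simp add: X_cnj sum_negf)
  finally have cross: "(\<Sum>\<nu>\<in>S. 2 * Re \<nu> * Im \<nu> * X \<nu>) = 0" by simp
  have swap: "(\<Sum>\<nu>\<in>S. (Im \<nu>)\<^sup>2 * Y (cnj \<nu>)) = (\<Sum>\<nu>\<in>S. (Im \<nu>)\<^sup>2 * Y \<nu>)"
    using sum_cnj[of "\<lambda>\<nu>. (Im \<nu>)\<^sup>2 * Y \<nu>"] by simp
  have "(\<Sum>\<nu>\<in>S. \<Sum>j\<in>{m \<nu>..<k \<nu>}. (Re \<nu> * y \<nu> j + Im \<nu> * y (cnj \<nu>) j)\<^sup>2)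
      = (\<Sum>\<nu>\<in>S. (Re \<nu>)\<^sup>2 * Y \<nu> + (Im \<nu>)\<^sup>2 * Y (cnj \<nu>) + 2 * Re \<nu> * Im \<nu> * X \<nu>)"
  proof (rule sum.cong[OF refl])
    fix \<nu> assume \<nu>: "\<nu> \<in> S"
    have "(\<Sum>j\<in>{m \<nu>..<k \<nu>}. (Re \<nu> * y \<nu> j + Im \<nu> * y (cnj \<nu>) j)\<^sup>2)
        = (\<Sum>j\<in>{m \<nu>..<k \<nu>}. (Re \<nu>)\<^sup>2 * (y \<nu> j)\<^sup>2 + (Im \<nu>)\<^sup>2 * (y (cnj \<nu>) j)\<^sup>2 + 2 * Re \<nu> * Im \<nu> * (y \<nu> j * y (cnj \<nu>) j))"
      by (rule sum.cong[OF refl]) (simp add: power2_sum power_mult_distrib)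
    then show "(\<Sum>j\<in>{m \<nu>..<k \<nu>}. (Re \<nu> * y \<nu> j + Im \<nu> * y (cnj \<nu>) j)\<^sup>2)
        = (Re \<nu>)\<^sup>2 * Y \<nu> + (Im \<nu>)\<^sup>2 * Y (cnj \<nu>) + 2 * Re \<nu> * Im \<nu> * X \<nu>"
      by (simp add: X_def Y_def sum.distrib sum_distrib_left m_cnj k_cnj[OF \<nu>])
  qed
  also have "\<dots> = (\<Sum>\<nu>\<in>S. (cmod \<nu>)\<^sup>2 * Y \<nu>)"
    by (simp add: sum.distrib cross swap cmod_power2 distrib_right)
  also have "\<dots> \<le> (\<Sum>\<nu>\<in>S. Y \<nu>)"
  proof (rule sum_mono)
    fix \<nu> assume \<nu>: "\<nu> \<in> S"
    show "(cmod \<nu>)\<^sup>2 * Y \<nu> \<le> Y \<nu>"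
    proof (cases "m \<nu> < k \<nu>")
      case True
      then have "(cmod \<nu>)\<^sup>2 \<le> 1" using small[OF \<nu>] by (simp add: power_le_one)
      moreover have "Y \<nu> \<ge> 0" by (simp add: Y_def sum_nonneg)
      ultimately show ?thesis by (simp add: mult_left_le_one_le)
    qed (simp add: Y_def)
  qed
  finally show ?thesis by (simp add: Y_def)
qed

text \<open>Excludes the integral functionals that would obstruct density. Integrality on monomials
  and the inverted Vandermonde system show that the coefficients \<open>\<delta> \<nu> l\<close> are
  quotients of a value of an integer polynomial \<open>h l\<close> by one of the derivative of
  \<open>f l\<close>, hence in the set of \<open>g_indep\<close>. Being built from internal rows of
  \<open>g\<close>, they are orthogonal to the physical row 0 at a conjugate with
  \<open>m \<mu> > 0\<close>; so they vanish there, and then at all conjugates because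
  \<open>h l\<close> has integer coefficients.\<close>

lemma perp_functional_trivial:
  fixes c :: "complex \<Rightarrow> nat \<Rightarrow> real"
  assumes int: "\<And>x :: nat \<Rightarrow> nat \<Rightarrow> int.
      (\<Sum>\<nu>\<in>S. \<Sum>j\<in>{m \<nu>..<k \<nu>}. c \<nu> j * real_coord (\<lambda>j i. of_int (x j i)) \<nu> j) \<in> \<int>"
    and \<nu>: "\<nu> \<in> S" "m \<nu> \<le> j" "j < k \<nu>"
  shows "c \<nu> j = 0"
proof -
  \<comment> \<open>For complex \<open>z\<close>, \<open>Re z + Im z\<close> is (1 - i)/2 times
    \<open>z\<close> plus (1 + i)/2 times its conjugate; \<open>\<gamma>\<close> collects the terms
    at \<nu>, the second one coming from \<open>cnj \<nu>\<close>.\<close>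
  define \<gamma> where "\<gamma> \<nu> j = (Complex 1 (-1) / 2) * of_real (c \<nu> j) + (Complex 1 1 / 2) * of_real (c (cnj \<nu>) j)" for \<nu> j
  define \<delta> where "\<delta> \<nu> l = (\<Sum>j\<in>{m \<nu>..<k \<nu>}. \<gamma> \<nu> j * of_real (g (k \<nu>) j l))" for \<nu> l
  have total: "complex_of_real (\<Sum>\<nu>\<in>S. \<Sum>j\<in>{m \<nu>..<k \<nu>}. c \<nu> j * real_coord x \<nu> j)
      = (\<Sum>\<nu>\<in>S. \<Sum>l<k \<nu>. \<delta> \<nu> l * eval x l \<nu>)" for x
  proof -
    have rc: "complex_of_real (real_coord x \<nu> j)
        = (Complex 1 (-1) / 2) * eigen_coord x \<nu> j + (Complex 1 1 / 2) * eigen_coord x (cnj \<nu>) j"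
      if "\<nu> \<in> S" for \<nu> j
      by (simp add: real_coord_def eigen_coord_cnj[OF that] complex_eq_iff field_simps)
    have "complex_of_real (\<Sum>\<nu>\<in>S. \<Sum>j\<in>{m \<nu>..<k \<nu>}. c \<nu> j * real_coord x \<nu> j)
        = (\<Sum>\<nu>\<in>S. \<Sum>j\<in>{m \<nu>..<k \<nu>}. (Complex 1 (-1) / 2) * of_real (c \<nu> j) * eigen_coord x \<nu> j)
          + (\<Sum>\<nu>\<in>S. \<Sum>j\<in>{m \<nu>..<k \<nu>}. (Complex 1 1 / 2) * of_real (c \<nu> j) * eigen_coord x (cnj \<nu>) j)"
      unfolding of_real_sum sum.distrib[symmetric] of_real_mult
      by (intro sum.cong refl) (simp add: rc distrib_left mult.left_commute mult.assoc)
    also have "(\<Sum>\<nu>\<in>S. \<Sum>j\<in>{m \<nu>..<k \<nu>}. (Complex 1 1 / 2) * of_real (c \<nu> j) * eigen_coord x (cnj \<nu>) j)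
        = (\<Sum>\<nu>\<in>S. \<Sum>j\<in>{m (cnj \<nu>)..<k (cnj \<nu>)}. (Complex 1 1 / 2) * of_real (c (cnj \<nu>) j) * eigen_coord x (cnj (cnj \<nu>)) j)"
      by (rule sum_cnj[symmetric])
    also have "\<dots> = (\<Sum>\<nu>\<in>S. \<Sum>j\<in>{m \<nu>..<k \<nu>}. (Complex 1 1 / 2) * of_real (c (cnj \<nu>) j) * eigen_coord x \<nu> j)"
      by (rule sum.cong[OF refl]) (simp add: m_cnj k_cnj)
    finally have "complex_of_real (\<Sum>\<nu>\<in>S. \<Sum>j\<in>{m \<nu>..<k \<nu>}. c \<nu> j * real_coord x \<nu> j)
        = (\<Sum>\<nu>\<in>S. \<Sum>j\<in>{m \<nu>..<k \<nu>}. \<gamma> \<nu> j * eigen_coord x \<nu> j)"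
      unfolding sum.distrib[symmetric] \<gamma>_def by (simp add: distrib_right)
    also have "\<dots> = (\<Sum>\<nu>\<in>S. \<Sum>l<k \<nu>. \<delta> \<nu> l * eval x l \<nu>)"
      unfolding \<delta>_def eigen_coord_def sum_distrib_left sum_distrib_right
      by (rule sum.cong[OF refl], subst sum.swap, simp add: mult.assoc)
    finally show ?thesis .
  qed
  have ex_t: "\<exists>t. (\<Sum>\<nu>\<in>R l. \<delta> \<nu> l * \<nu> ^ i) = of_int t" if i: "i < card (R l)" for l i
  proof -
    \<comment> \<open>The monomial of degree \<open>i\<close> in block \<open>l\<close>; the
      functional on it is a single power sum.\<close>
    define x :: "nat \<Rightarrow> nat \<Rightarrow> int" where "x a b = (if a = l \<and> b = i then 1 else 0)" for a b
    have ev: "eval (\<lambda>j i. of_int (x j i)) a \<nu> = (if a = l then \<nu> ^ i else 0)" for a \<nu>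
    proof -
      have "eval (\<lambda>j i. of_int (x j i)) a \<nu> = (\<Sum>b<card (R a). if b = i then (if a = l then \<nu> ^ i else 0) else 0)"
        unfolding eval_def by (intro sum.cong refl) (auto simp: x_def)
      then show ?thesis using i by simp
    qed
    have "(\<Sum>\<nu>\<in>S. \<Sum>a<k \<nu>. \<delta> \<nu> a * eval (\<lambda>j i. of_int (x j i)) a \<nu>) = (\<Sum>\<nu>\<in>S. if l < k \<nu> then \<delta> \<nu> l * \<nu> ^ i else 0)"
    proof (rule sum.cong[OF refl])
      fix \<nu>
      have "(\<Sum>a<k \<nu>. \<delta> \<nu> a * eval (\<lambda>j i. of_int (x j i)) a \<nu>) = (\<Sum>a<k \<nu>. if a = l then \<delta> \<nu> l * \<nu> ^ i else 0)"
        by (intro sum.cong refl) (auto simp: ev)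
      then show "(\<Sum>a<k \<nu>. \<delta> \<nu> a * eval (\<lambda>j i. of_int (x j i)) a \<nu>) = (if l < k \<nu> then \<delta> \<nu> l * \<nu> ^ i else 0)"
        by simp
    qed
    also have "\<dots> = (\<Sum>\<nu>\<in>R l. \<delta> \<nu> l * \<nu> ^ i)"
      unfolding R_def using finite_S by (simp add: sum.inter_filter)
    finally have "(\<Sum>\<nu>\<in>R l. \<delta> \<nu> l * \<nu> ^ i)
        = complex_of_real (\<Sum>\<nu>\<in>S. \<Sum>j\<in>{m \<nu>..<k \<nu>}. c \<nu> j * real_coord (\<lambda>j i. of_int (x j i)) \<nu> j)"
      unfolding total by simp
    then show ?thesis using int[of x] by (auto elim!: Ints_cases simp del: of_real_sum)
  qed
  define t where "t l i = (SOME t. (\<Sum>\<nu>\<in>R l. \<delta> \<nu> l * \<nu> ^ i) = of_int t)" for l i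
  have t: "(\<Sum>\<nu>\<in>R l. \<delta> \<nu> l * \<nu> ^ i) = of_int (t l i)" if "i < card (R l)" for l i
    unfolding t_def by (rule someI_ex[OF ex_t[OF that]])
  have ex_h: "\<exists>h :: int poly. \<forall>\<nu>\<in>R l. poly (map_poly of_int h) \<nu> = \<delta> \<nu> l * poly (map_poly of_int (pderiv (f l))) \<nu>" for l
    by (rule power_sum_dual_int[OF finite_R f_R t])
  define h where "h l = (SOME h :: int poly. \<forall>\<nu>\<in>R l.
      poly (map_poly of_int h) \<nu> = \<delta> \<nu> l * poly (map_poly of_int (pderiv (f l))) \<nu>)" for l
  have h: "poly (map_poly of_int (h l)) \<nu> = \<delta> \<nu> l * poly (map_poly of_int (pderiv (f l))) \<nu>"
    if "\<nu> \<in> R l" for l \<nu>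
    unfolding h_def by (rule someI_ex[OF ex_h, rule_format, OF that])
  have pd: "poly (map_poly of_int (pderiv (f l))) \<nu> \<noteq> (0 :: complex)" if "\<nu> \<in> R l" for l \<nu>
    unfolding of_int_hom.map_poly_pderiv f_R by (rule pderiv_prod_linear_root[OF finite_R that])
  have orth: "(\<Sum>l<k \<nu>. \<delta> \<nu> l * of_real (g (k \<nu>) l i)) = (\<Sum>j\<in>{m \<nu>..<k \<nu>}. if j = i then \<gamma> \<nu> i else 0)"
    if "i < k \<nu>" for \<nu> i
  proof -
    have "(\<Sum>l<k \<nu>. \<delta> \<nu> l * of_real (g (k \<nu>) l i))
        = (\<Sum>j\<in>{m \<nu>..<k \<nu>}. \<gamma> \<nu> j * of_real (\<Sum>l<k \<nu>. g (k \<nu>) j l * g (k \<nu>) l i))"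
      unfolding \<delta>_def of_real_sum of_real_mult sum_distrib_left sum_distrib_right
      by (subst sum.swap) (simp add: mult.assoc)
    also have "\<dots> = (\<Sum>j\<in>{m \<nu>..<k \<nu>}. if j = i then \<gamma> \<nu> i else 0)"
      using that by (intro sum.cong refl) (auto simp: g_inv simp del: of_real_sum)
    finally show ?thesis .
  qed
  have \<delta>0: "\<delta> \<nu> l = 0" if \<nu>: "\<nu> \<in> S" and l: "l < k \<nu>" for \<nu> l
  proof -
    obtain \<mu> where \<mu>: "alg_conjugate \<nu> \<mu>" "m \<mu> > 0" using m_pos[OF \<nu>] by blast
    have \<mu>S: "\<mu> \<in> S" "k \<mu> = k \<nu>" using conj_S[OF \<nu> \<mu>(1)] k_conj[OF \<nu> \<mu>(1)] by auto
    have "0 < k \<mu>" using \<mu>S l by simp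
    have zero: "(\<Sum>l<k \<mu>. of_real (g (k \<mu>) 0 l) * \<delta> \<mu> l) = 0"
      using orth[OF \<open>0 < k \<mu>\<close>] \<mu>(2) by (simp add: g_sym[of "k \<mu>" 0] mult.commute)
    have "\<delta> \<mu> l = 0"
    proof (rule g_indep[OF \<open>0 < k \<mu>\<close> _ zero])
      show "l < k \<mu>" using l \<mu>S by simp
      fix a assume "a < k \<mu>"
      then have a: "\<mu> \<in> R a" using \<mu>S by (simp add: R_def)
      have "\<delta> \<mu> a = poly (map_poly of_int (h a)) \<mu> / poly (map_poly of_int (pderiv (f a))) \<mu>"
        using h[OF a] pd[OF a] by simp
      then show "\<delta> \<mu> a \<in> {poly (map_poly of_int a) \<nu> / poly (map_poly of_int b) \<nu> | a b \<nu>. \<nu> \<in> S}"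
        using int_poly_value_in_F[OF \<mu>S(1)] by simp
    qed
    moreover have "\<mu> \<in> R l" "\<nu> \<in> R l" using \<mu>S \<nu> l by (auto simp: R_def)
    ultimately have "poly (map_poly of_int (h l)) \<mu> = 0" using h by simp
    then have "poly (map_poly of_int (h l)) \<nu> = 0"
      using alg_conjugate_root_int alg_conjugate_sym[OF \<mu>(1)] by blast
    then show ?thesis using h[OF \<open>\<nu> \<in> R l\<close>] pd[OF \<open>\<nu> \<in> R l\<close>] by simp
  qed
  \<comment> \<open>The rows of \<open>g\<close> are orthonormal, so \<gamma> is recovered from
    \<delta>.\<close>
  have "\<gamma> \<nu> j = 0"
    using orth[OF \<nu>(3)] \<nu> by (simp add: \<delta>0)
  \<comment> \<open>The real and imaginary parts of \<gamma> are half the sum and half the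
    difference of \<open>c (cnj \<nu>) j\<close> and \<open>c \<nu> j\<close>.\<close>
  then show ?thesis by (simp add: \<gamma>_def complex_eq_iff)
qed

end

section \<open>Assembling the scheme\<close>

text \<open>The geometric half: \<open>P\<close> and \<open>Q\<close> are the physical and internal
  rows of \<open>L\<close>. The hypothesis \<open>dual\<close> rules out the second alternative of
  the dichotomy for subgroups, and the norm estimate in \<open>inv\<close> keeps images of lattice
  points in the unit ball.\<close>

lemma cps_from_coordinates:
  fixes P Q :: "nat \<Rightarrow> nat \<Rightarrow> real" and A :: "real mat"
  assumes n: "1 \<le> n" "0 < d" and A: "A \<in> carrier_mat n n"
    and inj: "\<And>x :: nat \<Rightarrow> real. (\<And>i. i < n \<Longrightarrow> (\<Sum>j<n + d. P i j * x j) = 0) \<Longrightarrow>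
      (\<And>i. i < d \<Longrightarrow> (\<Sum>j<n + d. Q i j * x j) = 0) \<Longrightarrow> (\<And>j. j < n + d \<Longrightarrow> x j = 0)"
    and par_inj: "\<And>x :: nat \<Rightarrow> int. (\<And>i. i < n \<Longrightarrow> (\<Sum>j<n + d. P i j * of_int (x j)) = 0) \<Longrightarrow>
      (\<And>j. j < n + d \<Longrightarrow> x j = 0)"
    and perp_inj: "\<And>x :: nat \<Rightarrow> int. (\<And>i. i < d \<Longrightarrow> (\<Sum>j<n + d. Q i j * of_int (x j)) = 0) \<Longrightarrow>
      (\<And>j. j < n + d \<Longrightarrow> x j = 0)"
    and dual: "\<And>c :: nat \<Rightarrow> real. (\<And>x :: nat \<Rightarrow> int. (\<Sum>i<d. c i * (\<Sum>j<n + d. Q i j * of_int (x j))) \<in> \<int>) \<Longrightarrow>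
      (\<And>i. i < d \<Longrightarrow> c i = 0)"
    and inv: "\<And>x :: nat \<Rightarrow> int. \<exists>x' :: nat \<Rightarrow> int.
      (\<forall>i<n. (\<Sum>j<n + d. P i j * of_int (x' j)) = (\<Sum>l<n. A $$ (i, l) * (\<Sum>j<n + d. P l j * of_int (x j)))) \<and>
      (\<Sum>i<d. (\<Sum>j<n + d. Q i j * of_int (x' j))\<^sup>2) \<le> (\<Sum>i<d. (\<Sum>j<n + d. Q i j * of_int (x j))\<^sup>2)"
  shows "\<exists>s L \<Omega>. generic_cps s n L \<and> is_window (s - n) \<Omega> \<and>
    (\<lambda>x. A *\<^sub>v x) ` cps_set s n L \<Omega> \<subseteq> cps_set s n L \<Omega>"
proof -
  define s where "s = n + d"
  define L where "L = mat s s (\<lambda>(i, j). if i < n then P i j else Q (i - n) j)"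
  \<comment> \<open>The difference with 0 matches the general form of a ball whose openness is
    known.\<close>
  define \<Omega> where "\<Omega> = {x \<in> topspace (Euclidean_space d). (\<Sum>i<d. (x i - 0)\<^sup>2) < 1}"
  define vz where "vz x = vec s (\<lambda>j. real_of_int (x j))" for x :: "nat \<Rightarrow> int"
  define p where "p x i = (\<Sum>j<s. P i j * of_int (x j))" for x :: "nat \<Rightarrow> int" and i
  define q where "q x i = (\<Sum>j<s. Q i j * of_int (x j))" for x :: "nat \<Rightarrow> int" and i
  have sd: "s - n = d" by (simp add: s_def)
  have L: "L \<in> carrier_mat s s" by (simp add: L_def)
  have Lv: "(L *\<^sub>v vec s x) $ i = (if i < n then (\<Sum>j<s. P i j * x j) else (\<Sum>j<s. Q (i - n) j * x j))"
    if "i < s" for i x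
    unfolding mult_mat_vec_nth[OF L that] using that by (simp add: L_def)
  have lat: "lattice s L = range (\<lambda>x. L *\<^sub>v vz x)"
    unfolding vz_def using L by (rule lattice_eq_range)
  have less_s: "i < s" if "i < n" for i using that by (simp add: s_def)
  have less_s': "n + i < s" if "i < d" for i using that by (simp add: s_def)
  have par: "pi_par n (L *\<^sub>v vz x) = vec n (p x)" for x
    unfolding pi_par_def vz_def by (intro eq_vecI) (auto simp: Lv less_s p_def)
  have perp: "pi_perp s n (L *\<^sub>v vz x) = (\<lambda>i. if i < d then q x i else 0)" for x
    unfolding pi_perp_def vz_def by (rule ext) (auto simp: Lv less_s' q_def sd)
  have p_diff: "p (\<lambda>j. x j - y j) i = p x i - p y i" for x y i
    by (simp add: p_def right_diff_distrib sum_subtractf)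
  have q_diff: "q (\<lambda>j. x j - y j) i = q x i - q y i" for x y i
    by (simp add: q_def right_diff_distrib sum_subtractf)
  have q_add: "q (\<lambda>j. x j + y j) i = q x i + q y i" for x y i
    by (simp add: q_def distrib_left sum.distrib)
  have q_neg: "q (\<lambda>j. - x j) i = - q x i" for x i
    by (simp add: q_def sum_negf)
  have vz_eq: "vz x = vz y" if "\<And>j. j < s \<Longrightarrow> x j = y j" for x y
    using that by (auto simp: vz_def)
  have "det L \<noteq> 0"
  proof
    assume "det L = 0"
    then obtain v where v: "v \<in> carrier_vec s" "v \<noteq> 0\<^sub>v s" "L *\<^sub>v v = 0\<^sub>v s"
      using det_0_iff_vec_prod_zero[OF L] by blast
    have vv: "v = vec s (\<lambda>j. v $ j)" using v(1) by auto
    have Lv0: "(L *\<^sub>v vec s (\<lambda>j. v $ j)) $ i = 0" if "i < s" for i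
      unfolding vv[symmetric] v(3) using that by simp
    have "v $ j = 0" if "j < n + d" for j
    proof (rule inj[of "\<lambda>j. v $ j"])
      show "(\<Sum>j<n + d. P i j * v $ j) = 0" if "i < n" for i
        using Lv0[of i] Lv[of i "\<lambda>j. v $ j"] that by (simp add: s_def)
      show "(\<Sum>j<n + d. Q i j * v $ j) = 0" if "i < d" for i
        using Lv0[of "n + i"] Lv[of "n + i" "\<lambda>j. v $ j"] that by (simp add: s_def)
    qed (rule that)
    then have "v = 0\<^sub>v s" using v(1) by (intro eq_vecI) (auto simp: s_def)
    then show False using v(2) by simp
  qed
  moreover have "inj_on (pi_par n) (lattice s L)"
  proof (rule inj_onI)
    fix l l' assume "l \<in> lattice s L" "l' \<in> lattice s L" and eq: "pi_par n l = pi_par n l'"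
    then obtain x y where xy: "l = L *\<^sub>v vz x" "l' = L *\<^sub>v vz y" by (auto simp: lat)
    have "p x i = p y i" if "i < n" for i
      using eq that unfolding xy par by (metis index_vec)
    then have "x j - y j = 0" if "j < s" for j
      using that p_diff[of x y] by (intro par_inj[of "\<lambda>j. x j - y j"]) (simp_all add: p_def s_def)
    then show "l = l'" unfolding xy using vz_eq[of x y] by simp
  qed
  moreover have "inj_on (pi_perp s n) (lattice s L)"
  proof (rule inj_onI)
    fix l l' assume "l \<in> lattice s L" "l' \<in> lattice s L" and eq: "pi_perp s n l = pi_perp s n l'"
    then obtain x y where xy: "l = L *\<^sub>v vz x" "l' = L *\<^sub>v vz y" by (auto simp: lat)
    have "q x i = q y i" if "i < d" for i
      using fun_cong[OF eq, of i] that unfolding xy perp by simp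
    then have "x j - y j = 0" if "j < s" for j
      using that q_diff[of x y] by (intro perp_inj[of "\<lambda>j. x j - y j"]) (simp_all add: q_def s_def)
    then show "l = l'" unfolding xy using vz_eq[of x y] by simp
  qed
  moreover have "Euclidean_space d closure_of (pi_perp s n ` lattice s L) = topspace (Euclidean_space d)"
  proof -
    have G: "pi_perp s n ` lattice s L = range (\<lambda>x i. if i < d then q x i else 0)"
      unfolding lat image_image perp ..
    have sub: "pi_perp s n ` lattice s L \<subseteq> topspace (Euclidean_space d)"
      unfolding G by (auto simp: topspace_Euclidean_space)
    have disj: "(\<forall>y. \<forall>\<epsilon>>0. \<exists>g\<in>range q. \<forall>i\<in>{..<d}. \<bar>g i - y i\<bar> < \<epsilon>) \<or>
        (\<exists>c. (\<exists>i\<in>{..<d}. c i \<noteq> 0) \<and> (\<forall>g\<in>range q. (\<Sum>i\<in>{..<d}. c i * g i) \<in> \<int>))"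
    proof (rule subgroup_dense_or_integral_functional)
      show "(\<lambda>_. 0) \<in> range q" by (rule range_eqI[of _ _ "\<lambda>_. 0"]) (auto simp: q_def)
      show "(\<lambda>i. a i + b i) \<in> range q" if ab: "a \<in> range q" "b \<in> range q" for a b
      proof -
        obtain x y where "a = q x" "b = q y" using ab by blast
        then show ?thesis by (intro range_eqI[of _ _ "\<lambda>j. x j + y j"]) (auto simp: q_add)
      qed
      show "(\<lambda>i. - a i) \<in> range q" if a: "a \<in> range q" for a
      proof -
        obtain x where "a = q x" using a by blast
        then show ?thesis by (intro range_eqI[of _ _ "\<lambda>j. - x j"]) (auto simp: q_neg)
      qed
    qed simp
    have neg: "\<not> (\<exists>c. (\<exists>i\<in>{..<d}. c i \<noteq> 0) \<and> (\<forall>g\<in>range q. (\<Sum>i\<in>{..<d}. c i * g i) \<in> \<int>))"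
    proof
      assume "\<exists>c. (\<exists>i\<in>{..<d}. c i \<noteq> 0) \<and> (\<forall>g\<in>range q. (\<Sum>i\<in>{..<d}. c i * g i) \<in> \<int>)"
      then obtain c i where i: "i < d" "c i \<noteq> 0" and c: "\<And>x. (\<Sum>i<d. c i * q x i) \<in> \<int>" by auto
      have "c i = 0"
      proof (rule dual[OF _ i(1)])
        show "(\<Sum>i<d. c i * (\<Sum>j<n + d. Q i j * of_int (x j))) \<in> \<int>" for x :: "nat \<Rightarrow> int"
          using c[of x] by (simp add: q_def s_def)
      qed
      then show False using i(2) by simp
    qed
    have "\<forall>y. \<forall>\<epsilon>>0. \<exists>g\<in>range q. \<forall>i\<in>{..<d}. \<bar>g i - y i\<bar> < \<epsilon>"
      by (rule disjE[OF disj]) (assumption, rule notE[OF neg])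
    then have D: "\<exists>x. \<forall>i<d. \<bar>q x i - y i\<bar> < \<epsilon>" if "\<epsilon> > 0" for y \<epsilon>
      using that unfolding bex_simps lessThan_iff Ball_def by blast
    show ?thesis
      unfolding dense_in_Euclidean_space_iff[OF sub] unfolding G
    proof (intro ballI allI impI)
      fix y and \<epsilon> :: real assume "\<epsilon> > 0"
      from D[OF this, of y] obtain x where "\<forall>i<d. \<bar>q x i - y i\<bar> < \<epsilon>" by blast
      then show "\<exists>g\<in>range (\<lambda>x i. if i < d then q x i else 0). \<forall>i<d. \<bar>g i - y i\<bar> < \<epsilon>"
        by (intro bexI[of _ "\<lambda>i. if i < d then q x i else 0"]) auto
    qed
  qed
  ultimately have gen: "generic_cps s n L"
    using n L by (simp add: generic_cps_def sd s_def)
  have openin: "openin (Euclidean_space d) \<Omega>"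
    unfolding \<Omega>_def by (rule openin_Euclidean_space_ball)
  have "(\<lambda>_. 0) \<in> \<Omega>" by (simp add: \<Omega>_def topspace_Euclidean_space)
  moreover have sub: "\<Omega> \<subseteq> topspace (Euclidean_space d)" by (auto simp: \<Omega>_def)
  ultimately have "Euclidean_space d closure_of \<Omega> \<noteq> {}" using closure_of_subset[OF sub] by blast
  moreover have "\<exists>B. \<forall>x\<in>\<Omega>. (\<Sum>i<d. (x i)\<^sup>2) \<le> B"
    by (rule exI[of _ 1]) (auto simp: \<Omega>_def)
  ultimately have win: "is_window (s - n) \<Omega>"
    using sub openin unfolding sd is_window_def by (simp add: interior_of_openin)
  have "(\<lambda>x. A *\<^sub>v x) ` cps_set s n L \<Omega> \<subseteq> cps_set s n L \<Omega>"
  proof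
    fix v assume "v \<in> (\<lambda>x. A *\<^sub>v x) ` cps_set s n L \<Omega>"
    then obtain l where l: "l \<in> lattice s L" "pi_perp s n l \<in> \<Omega>" "v = A *\<^sub>v pi_par n l"
      by (auto simp: cps_set_def)
    then obtain x where x: "l = L *\<^sub>v vz x" by (auto simp: lat)
    obtain x' where x': "\<And>i. i < n \<Longrightarrow> p x' i = (\<Sum>l<n. A $$ (i, l) * p x l)"
      "(\<Sum>i<d. (q x' i)\<^sup>2) \<le> (\<Sum>i<d. (q x i)\<^sup>2)"
      using inv[of x] unfolding p_def q_def s_def by blast
    have "v = pi_par n (L *\<^sub>v vz x')"
      unfolding l(3) x par using A by (intro eq_vecI) (auto simp: x'(1) scalar_prod_def atLeast0LessThan)
    moreover have "pi_perp s n (L *\<^sub>v vz x') \<in> \<Omega>"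
      using l(2) x'(2) unfolding x perp \<Omega>_def by (simp add: topspace_Euclidean_space)
    ultimately show "v \<in> cps_set s n L \<Omega>" unfolding cps_set_def lat by blast
  qed
  with gen win show ?thesis by blast
qed

lemma det_nonzero_cancel:
  fixes Y :: "real mat"
  assumes Y: "Y \<in> carrier_mat n n" "det Y \<noteq> 0" and v: "\<And>i. i < n \<Longrightarrow> (\<Sum>a<n. Y $$ (i, a) * v a) = 0" and a: "a < n"
  shows "v a = 0"
proof -
  have "Y *\<^sub>v vec n v = 0\<^sub>v n"
    using Y(1) v by (intro eq_vecI) (auto simp: scalar_prod_def atLeast0LessThan)
  then have "vec n v = 0\<^sub>v n"
    using det_0_iff_vec_prod_zero[OF Y(1)] Y(2) by (metis vec_carrier)
  then have "vec n v $ a = 0\<^sub>v n $ a" by simp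
  then show ?thesis using a by simp
qed

lemma card_filter: "finite B \<Longrightarrow> card {x \<in> B. P x} = (\<Sum>x\<in>B. if P x then 1 else 0)"
  by (simp add: sum.inter_filter[symmetric])

context conjugate_multiplicities
begin

lemma real_coord_cong:
  assumes "\<And>j i. i < card (R j) \<Longrightarrow> x j i = y j i"
  shows "real_coord x \<nu> j = real_coord y \<nu> j"
  using assms by (simp add: real_coord_def eigen_coord_def eval_def)

lemma real_coord_sum:
  "real_coord (\<lambda>j i. \<Sum>b\<in>B. u b j i * x b) \<nu> j = (\<Sum>b\<in>B. real_coord (u b) \<nu> j * x b)"
proof -
  have "eval (\<lambda>j i. \<Sum>b\<in>B. u b j i * x b) l \<nu> = (\<Sum>b\<in>B. eval (u b) l \<nu> * of_real (x b))" for l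
    unfolding eval_def of_real_sum of_real_mult sum_distrib_right
    by (subst sum.swap) (simp add: ac_simps)
  then have "eigen_coord (\<lambda>j i. \<Sum>b\<in>B. u b j i * x b) \<nu> j = (\<Sum>b\<in>B. eigen_coord (u b) \<nu> j * of_real (x b))"
    unfolding eigen_coord_def sum_distrib_left sum_distrib_right
    by (subst sum.swap) (simp add: sum_distrib_left mult.assoc)
  then show ?thesis
    by (simp add: real_coord_def sum.distrib[symmetric] distrib_right)
qed

lemma of_int_shift: "of_int (shift x j i) = shift (\<lambda>j i. real_of_int (x j i)) j i"
  by (simp add: shift_def)

text \<open>\<open>bij\<close> labels the diagonal entries by eigenvalue and copy; in the proof
  \<open>W\<close> labels the internal coordinates and \<open>J\<close> the integer coefficients.
  The physical coordinates carry the additional factor \<open>Y\<close>, which passes from the real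
  normal form to \<open>A\<close>.\<close>

theorem scheme_exists:
  fixes A :: "real mat" and e :: "nat \<Rightarrow> complex" and h :: "nat \<Rightarrow> nat"
  assumes n: "1 \<le> n" and A: "A \<in> carrier_mat n n"
    and sim: "similar_mat (cmat A) (mat n n (\<lambda>(a, b). if a = b then e a else 0))"
    and bij: "bij_betw (\<lambda>a. (e a, h a)) {..<n} (SIGMA \<nu>:S. {..<m \<nu>})"
  shows "\<exists>s L \<Omega>. generic_cps s n L \<and> is_window (s - n) \<Omega> \<and>
    (\<lambda>x. A *\<^sub>v x) ` cps_set s n L \<Omega> \<subseteq> cps_set s n L \<Omega>"
proof -
  define W where "W = (SIGMA \<nu>:S. {m \<nu>..<k \<nu>})"
  \<comment> \<open>A crude bound on the block index: from \<open>K\<close> on \<open>R j\<close> is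
    empty, so that finitely many blocks suffice in \<open>J\<close>.\<close>
  define K where "K = (\<Sum>\<nu>\<in>S. k \<nu>)"
  define J where "J = (SIGMA j:{..<K}. {..<card (R j)})"
  define d where "d = card W"
  have finite: "finite W" "finite J" using finite_S by (auto simp: W_def J_def)
  have k_le: "k \<nu> \<le> K" if "\<nu> \<in> S" for \<nu>
    unfolding K_def using finite_S that by (intro member_le_sum) auto
  have J: "(j, i) \<in> J \<longleftrightarrow> i < card (R j)" for j i
  proof -
    have "j < K" if "i < card (R j)"
    proof -
      have "R j \<noteq> {}" using that by auto
      then obtain \<nu> where "\<nu> \<in> S" "j < k \<nu>" by (auto simp: R_def)
      then show ?thesis using k_le by fastforce
    qed
    then show ?thesis by (auto simp: J_def)
  qed
  have card_n: "n = (\<Sum>\<nu>\<in>S. m \<nu>)"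
    using bij_betw_same_card[OF bij] finite_S by (simp add: card_SigmaI)
  \<comment> \<open>Double counting of the pairs (j, \<nu>) with \<open>j < k \<nu>\<close>: there
    are as many integer coefficients as real coordinates, which makes \<open>L\<close>
    square.\<close>
  have "card J = (\<Sum>j<K. card (R j))"
    unfolding J_def by (simp add: card_SigmaI)
  also have "\<dots> = (\<Sum>j<K. \<Sum>\<nu>\<in>S. if j < k \<nu> then 1 else 0)"
    unfolding R_def by (intro sum.cong refl card_filter finite_S)
  also have "\<dots> = (\<Sum>\<nu>\<in>S. \<Sum>j<K. if j < k \<nu> then 1 else 0)" by (rule sum.swap)
  also have "\<dots> = (\<Sum>\<nu>\<in>S. k \<nu>)"
  proof (rule sum.cong[OF refl])
    fix \<nu> assume "\<nu> \<in> S"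
    then have "{j \<in> {..<K}. j < k \<nu>} = {..<k \<nu>}" using k_le[of \<nu>] by auto
    then have "card {j \<in> {..<K}. j < k \<nu>} = k \<nu>" by simp
    then show "(\<Sum>j<K. if j < k \<nu> then 1 else 0) = k \<nu>"
      by (simp add: card_filter[symmetric])
  qed
  also have "\<dots> = (\<Sum>\<nu>\<in>S. m \<nu> + (k \<nu> - m \<nu>))" using m_le_k by (intro sum.cong) auto
  also have "\<dots> = n + d"
    using finite_S by (simp add: sum.distrib card_n d_def W_def card_SigmaI)
  finally have card_J: "card J = n + d" .
  obtain \<kappa> where \<kappa>: "bij_betw \<kappa> {..<d} W"
    using ex_bij_betw_nat_finite[OF finite(1)] by (auto simp: d_def atLeast0LessThan)
  obtain \<beta> where \<beta>: "bij_betw \<beta> {..<n + d} J"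
    using ex_bij_betw_nat_finite[OF finite(2)] by (auto simp: card_J atLeast0LessThan)
  have ind_V: "\<exists>a<n. e a = \<nu> \<and> h a = j" if "\<nu> \<in> S" "j < m \<nu>" for \<nu> j
  proof -
    have "(\<nu>, j) \<in> (\<lambda>a. (e a, h a)) ` {..<n}" using bij that by (simp add: bij_betw_def)
    then show ?thesis by auto
  qed
  have V: "e a \<in> S" "h a < m (e a)" if "a < n" for a
    using bij_betwE[OF bij] that by auto
  have ind_W: "\<exists>i<d. \<kappa> i = (\<nu>, j)" if "\<nu> \<in> S" "m \<nu> \<le> j" "j < k \<nu>" for \<nu> j
  proof -
    have "(\<nu>, j) \<in> \<kappa> ` {..<d}" using \<kappa> that by (simp add: bij_betw_def W_def)
    then show ?thesis by auto
  qed
  have d: "0 < d"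
  proof -
    obtain \<mu> where "alg_conjugate (e 0) \<mu>" "m \<mu> < k \<mu>" using m_less[OF V(1)[of 0]] n by auto
    then have "(\<mu>, m \<mu>) \<in> W" using conj_S V(1)[of 0] n by (auto simp: W_def)
    then show ?thesis using finite(1) by (auto simp: d_def card_gt_0_iff)
  qed
  \<comment> \<open>The conjugate eigenvalue with the same copy index, so that the values of
    \<open>real_coord\<close> at the two indices form a pair on which the shift acts as one
    block.\<close>
  define \<sigma> where "\<sigma> a = (SOME b. b < n \<and> e b = cnj (e a) \<and> h b = h a)" for a
  have \<sigma>_all: "\<sigma> a < n \<and> e (\<sigma> a) = cnj (e a) \<and> h (\<sigma> a) = h a" if a: "a < n" for a
    unfolding \<sigma>_def
  proof (rule someI_ex)
    show "\<exists>b. b < n \<and> e b = cnj (e a) \<and> h b = h a"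
      using ind_V[of "cnj (e a)" "h a"] V[OF a] cnj_S[OF V(1)[OF a]] by (simp add: m_cnj)
  qed
  have \<sigma>: "\<sigma> a < n" "e (\<sigma> a) = cnj (e a)" "h (\<sigma> a) = h a" if "a < n" for a
    using \<sigma>_all[OF that] by auto
  have \<sigma>2: "\<sigma> (\<sigma> a) = a" if "a < n" for a
    by (rule inj_onD[OF bij_betw_imp_inj_on[OF bij]]) (simp_all add: \<sigma> that)
  obtain Y :: "real mat" where Y: "Y \<in> carrier_mat n n" "det Y \<noteq> 0" and AY: "A * Y = Y * real_normal_form n e \<sigma>"
    using similar_real_normal_form[OF A sim \<sigma>(1) \<sigma>2 \<sigma>(2)] by blast
  define X where "X x j i = (\<Sum>b<n + d. (if \<beta> b = (j, i) then 1 else 0) * x b)" for x :: "nat \<Rightarrow> real" and j i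
  have X_\<beta>: "X x j i = x b" if "b < n + d" "\<beta> b = (j, i)" for x b j i
  proof -
    have "X x j i = (\<Sum>b'<n + d. if b' = b then x b else 0)"
      unfolding X_def
    proof (rule sum.cong[OF refl])
      fix b' assume "b' \<in> {..<n + d}"
      then have "\<beta> b' = (j, i) \<longleftrightarrow> b' = b"
        using inj_onD[OF bij_betw_imp_inj_on[OF \<beta>], of b' b] that by auto
      then show "(if \<beta> b' = (j, i) then 1 else 0) * x b' = (if b' = b then x b else 0)" by simp
    qed
    then show ?thesis using that by simp
  qed
  have \<beta>_surj: "\<exists>b<n + d. \<beta> b = (j, i)" if "i < card (R j)" for j i
  proof -
    have "(j, i) \<in> \<beta> ` {..<n + d}" using \<beta> that J by (simp add: bij_betw_def)
    then show ?thesis by auto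
  qed
  have \<beta>_J: "snd (\<beta> b) < card (R (fst (\<beta> b)))" if "b < n + d" for b
    using bij_betwE[OF \<beta>] that J[of "fst (\<beta> b)" "snd (\<beta> b)"] by simp
  have X_zero: "x b = 0" if "\<And>j i. i < card (R j) \<Longrightarrow> X x j i = 0" "b < n + d" for x b
    using that(1)[OF \<beta>_J[OF that(2)]] X_\<beta>[OF that(2), of "fst (\<beta> b)" "snd (\<beta> b)" x] by simp
  have X_real: "real_coord (X (\<lambda>b. x (fst (\<beta> b)) (snd (\<beta> b)))) \<nu> j = real_coord x \<nu> j" for x \<nu> j
  proof (rule real_coord_cong)
    fix j i assume "i < card (R j)"
    then obtain b where "b < n + d" "\<beta> b = (j, i)" using \<beta>_surj by blast
    then show "X (\<lambda>b. x (fst (\<beta> b)) (snd (\<beta> b))) j i = x j i" using X_\<beta> by simp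
  qed
  define Z where "Z x j i = (\<Sum>b<n + d. (if \<beta> b = (j, i) then 1 else 0) * x b)" for x :: "nat \<Rightarrow> int" and j i
  have XZ: "X (\<lambda>b. of_int (x b)) = (\<lambda>j i. of_int (Z x j i))" for x
    by (intro ext) (auto simp: X_def Z_def intro!: sum.cong)
  define u where "u b j i = (if \<beta> b = (j, i) then 1 else (0 :: real))" for b and j i :: nat
  define P' where "P' a b = real_coord (u b) (e a) (h a)" for a b
  define Q where "Q i b = real_coord (u b) (fst (\<kappa> i)) (snd (\<kappa> i))" for i b
  \<comment> \<open>\<open>P'\<close> gives the coordinates in which the shift has the real normal
    form; \<open>Y\<close> turns them into those in which it acts as \<open>A\<close>.\<close>
  define P where "P i b = (\<Sum>a<n. Y $$ (i, a) * P' a b)" for i b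
  have lin: "(\<Sum>b<n + d. real_coord (u b) \<nu> j * x b) = real_coord (X x) \<nu> j" for x \<nu> j
    unfolding real_coord_sum[symmetric] by (rule real_coord_cong) (simp add: X_def u_def)
  have P: "(\<Sum>b<n + d. P i b * x b) = (\<Sum>a<n. Y $$ (i, a) * real_coord (X x) (e a) (h a))" for i x
  proof -
    have "(\<Sum>b<n + d. P i b * x b) = (\<Sum>a<n. Y $$ (i, a) * (\<Sum>b<n + d. P' a b * x b))"
      unfolding P_def sum_distrib_left sum_distrib_right by (subst sum.swap) (simp add: mult.assoc)
    then show ?thesis by (simp add: P'_def lin)
  qed
  have Q: "(\<Sum>b<n + d. Q i b * x b) = real_coord (X x) (fst (\<kappa> i)) (snd (\<kappa> i))" for i x
    by (simp add: Q_def lin)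
  have par_zero: "real_coord (X x) \<nu> j = 0"
    if zero: "\<And>i. i < n \<Longrightarrow> (\<Sum>b<n + d. P i b * x b) = 0" and \<nu>: "\<nu> \<in> S" "j < m \<nu>" for x \<nu> j
  proof -
    obtain a where a: "a < n" "e a = \<nu>" "h a = j" using ind_V[OF \<nu>] by blast
    have "real_coord (X x) (e a) (h a) = 0"
      by (rule det_nonzero_cancel[OF Y, of "\<lambda>a. real_coord (X x) (e a) (h a)"]) (use zero a in \<open>simp_all add: P\<close>)
    then show ?thesis by (simp add: a)
  qed
  have perp_zero: "real_coord (X x) \<nu> j = 0"
    if zero: "\<And>i. i < d \<Longrightarrow> (\<Sum>b<n + d. Q i b * x b) = 0" and \<nu>: "\<nu> \<in> S" "m \<nu> \<le> j" "j < k \<nu>" for x \<nu> j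
  proof -
    obtain i where "i < d" "\<kappa> i = (\<nu>, j)" using ind_W[OF \<nu>] by blast
    then show ?thesis using zero[of i] by (simp add: Q)
  qed
  have sum_W: "(\<Sum>i<d. F (fst (\<kappa> i)) (snd (\<kappa> i))) = (\<Sum>\<nu>\<in>S. \<Sum>j\<in>{m \<nu>..<k \<nu>}. F \<nu> j)" for F :: "complex \<Rightarrow> nat \<Rightarrow> real"
  proof -
    have "(\<Sum>i<d. F (fst (\<kappa> i)) (snd (\<kappa> i))) = (\<Sum>w\<in>W. F (fst w) (snd w))"
      using sum.reindex_bij_betw[OF \<kappa>, of "\<lambda>w. F (fst w) (snd w)"] by simp
    also have "\<dots> = (\<Sum>\<nu>\<in>S. \<Sum>j\<in>{m \<nu>..<k \<nu>}. F \<nu> j)"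
      unfolding W_def using finite_S by (subst sum.Sigma) (auto simp: case_prod_unfold)
    finally show ?thesis .
  qed
  show ?thesis
  proof (rule cps_from_coordinates[OF n d A, of P Q])
    show "x b = 0" if "\<And>i. i < n \<Longrightarrow> (\<Sum>b<n + d. P i b * x b) = 0"
      "\<And>i. i < d \<Longrightarrow> (\<Sum>b<n + d. Q i b * x b) = 0" "b < n + d" for x b
    proof (rule X_zero[OF _ that(3)])
      fix j i assume i: "i < card (R j)"
      show "X x j i = 0"
      proof (rule real_coord_injective[OF _ i])
        show "real_coord (X x) \<nu> j = 0" if "\<nu> \<in> S" "j < k \<nu>" for \<nu> j
          using par_zero[of x \<nu> j] perp_zero[of x \<nu> j] that
            \<open>\<And>i. i < n \<Longrightarrow> (\<Sum>b<n + d. P i b * x b) = 0\<close> \<open>\<And>i. i < d \<Longrightarrow> (\<Sum>b<n + d. Q i b * x b) = 0\<close>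
          by (cases "j < m \<nu>") auto
      qed
    qed
    show "x b = 0" if "\<And>i. i < n \<Longrightarrow> (\<Sum>b<n + d. P i b * of_int (x b)) = 0" "b < n + d" for x :: "nat \<Rightarrow> int" and b
    proof -
      have "Z x j i = 0" if "i < card (R j)" for j i
        using par_zero[of "\<lambda>b. of_int (x b)"] \<open>\<And>i. i < n \<Longrightarrow> (\<Sum>b<n + d. P i b * of_int (x b)) = 0\<close> that
        by (intro real_coord_par_int_injective[of "Z x"]) (simp_all add: XZ)
      then have "real_of_int (x b) = 0"
        by (intro X_zero[of "\<lambda>b. of_int (x b)", OF _ that(2)]) (simp add: XZ)
      then show ?thesis by simp
    qed
    show "x b = 0" if "\<And>i. i < d \<Longrightarrow> (\<Sum>b<n + d. Q i b * of_int (x b)) = 0" "b < n + d" for x :: "nat \<Rightarrow> int" and b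
    proof -
      have "Z x j i = 0" if "i < card (R j)" for j i
        using perp_zero[of "\<lambda>b. of_int (x b)"] \<open>\<And>i. i < d \<Longrightarrow> (\<Sum>b<n + d. Q i b * of_int (x b)) = 0\<close> that
        by (intro real_coord_perp_int_injective[of "Z x"]) (simp_all add: XZ)
      then have "real_of_int (x b) = 0"
        by (intro X_zero[of "\<lambda>b. of_int (x b)", OF _ that(2)]) (simp add: XZ)
      then show ?thesis by simp
    qed
    show "c i = 0" if int: "\<And>x :: nat \<Rightarrow> int. (\<Sum>i<d. c i * (\<Sum>b<n + d. Q i b * of_int (x b))) \<in> \<int>" and i: "i < d" for c i
    proof -
      define c' where "c' \<nu> j = c (the_inv_into {..<d} \<kappa> (\<nu>, j))" for \<nu> j
      have c': "c' (fst (\<kappa> i)) (snd (\<kappa> i)) = c i" if "i < d" for i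
        using the_inv_into_f_f[OF bij_betw_imp_inj_on[OF \<kappa>], of i] that by (simp add: c'_def)
      have "\<kappa> i \<in> W" using bij_betwE[OF \<kappa>] i by simp
      then have W: "fst (\<kappa> i) \<in> S" "m (fst (\<kappa> i)) \<le> snd (\<kappa> i)" "snd (\<kappa> i) < k (fst (\<kappa> i))"
        by (auto simp: W_def)
      have "c' (fst (\<kappa> i)) (snd (\<kappa> i)) = 0"
      proof (rule perp_functional_trivial[OF _ W])
        fix x :: "nat \<Rightarrow> nat \<Rightarrow> int"
        have "(\<Sum>\<nu>\<in>S. \<Sum>j\<in>{m \<nu>..<k \<nu>}. c' \<nu> j * real_coord (\<lambda>j i. of_int (x j i)) \<nu> j)
            = (\<Sum>i<d. c' (fst (\<kappa> i)) (snd (\<kappa> i)) * real_coord (\<lambda>j i. of_int (x j i)) (fst (\<kappa> i)) (snd (\<kappa> i)))"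
          by (rule sum_W[symmetric])
        also have "\<dots> = (\<Sum>i<d. c i * (\<Sum>b<n + d. Q i b * of_int (x (fst (\<beta> b)) (snd (\<beta> b)))))"
          unfolding Q using X_real[of "\<lambda>j i. of_int (x j i)"] by (intro sum.cong) (auto simp: c')
        also have "\<dots> \<in> \<int>" by (rule int)
        finally show "(\<Sum>\<nu>\<in>S. \<Sum>j\<in>{m \<nu>..<k \<nu>}. c' \<nu> j * real_coord (\<lambda>j i. of_int (x j i)) \<nu> j) \<in> \<int>" .
      qed
      then show ?thesis using c'[OF i] by simp
    qed
    show "\<exists>x' :: nat \<Rightarrow> int.
      (\<forall>i<n. (\<Sum>b<n + d. P i b * of_int (x' b)) = (\<Sum>l<n. A $$ (i, l) * (\<Sum>b<n + d. P l b * of_int (x b)))) \<and>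
      (\<Sum>i<d. (\<Sum>b<n + d. Q i b * of_int (x' b))\<^sup>2) \<le> (\<Sum>i<d. (\<Sum>b<n + d. Q i b * of_int (x b))\<^sup>2)"
      for x :: "nat \<Rightarrow> int"
    proof -
      \<comment> \<open>The image of \<open>x\<close> under \<open>N\<close>: multiplication by the
        variable in every block.\<close>
      define x' where "x' b = shift (Z x) (fst (\<beta> b)) (snd (\<beta> b))" for b
      define c where "c \<nu> j = real_coord (X (\<lambda>b. of_int (x b))) \<nu> j" for \<nu> j
      have shift: "real_coord (X (\<lambda>b. of_int (x' b))) \<nu> j = Re \<nu> * c \<nu> j + Im \<nu> * c (cnj \<nu>) j" if "\<nu> \<in> S" for \<nu> j
      proof -
        have "(\<lambda>b. real_of_int (x' b)) = (\<lambda>b. shift (X (\<lambda>b. of_int (x b))) (fst (\<beta> b)) (snd (\<beta> b)))"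
          by (simp add: x'_def of_int_shift XZ)
        then have "real_coord (X (\<lambda>b. of_int (x' b))) \<nu> j = real_coord (shift (X (\<lambda>b. of_int (x b)))) \<nu> j"
          using X_real[of "shift (X (\<lambda>b. of_int (x b)))"] by simp
        then show ?thesis by (simp add: real_coord_shift[OF that] c_def)
      qed
      have "(\<Sum>b<n + d. P i b * of_int (x' b)) = (\<Sum>l<n. A $$ (i, l) * (\<Sum>b<n + d. P l b * of_int (x b)))" if i: "i < n" for i
      proof -
        have N: "real_normal_form n e \<sigma> \<in> carrier_mat n n" by (simp add: real_normal_form_def)
        have "(\<Sum>b<n + d. P i b * of_int (x' b)) = (\<Sum>a<n. Y $$ (i, a) * (Re (e a) * c (e a) (h a) + Im (e a) * c (e (\<sigma> a)) (h (\<sigma> a))))"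
          unfolding P using V(1) \<sigma> by (intro sum.cong) (auto simp: shift)
        \<comment> \<open>The shift acts on the coordinates by the rows of the normal form, so that
          \<open>AY\<close> can exchange it for \<open>A\<close>.\<close>
        also have "\<dots> = (\<Sum>a<n. Y $$ (i, a) * (\<Sum>b<n. real_normal_form n e \<sigma> $$ (a, b) * c (e b) (h b)))"
        proof (intro sum.cong refl arg_cong2[of _ _ _ _ "(*)"])
          fix a assume "a \<in> {..<n}"
          then have a: "a < n" "\<sigma> a < n" using \<sigma>(1) by auto
          have "(\<Sum>b<n. real_normal_form n e \<sigma> $$ (a, b) * c (e b) (h b))
              = (\<Sum>b<n. (if b = a then Re (e a) * c (e a) (h a) else 0) + (if b = \<sigma> a then Im (e a) * c (e (\<sigma> a)) (h (\<sigma> a)) else 0))"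
            using a by (intro sum.cong) (auto simp: real_normal_form_def distrib_right)
          then show "Re (e a) * c (e a) (h a) + Im (e a) * c (e (\<sigma> a)) (h (\<sigma> a))
              = (\<Sum>b<n. real_normal_form n e \<sigma> $$ (a, b) * c (e b) (h b))"
            using a by (simp add: sum.distrib)
        qed
        also have "\<dots> = (\<Sum>b<n. (Y * real_normal_form n e \<sigma>) $$ (i, b) * c (e b) (h b))"
          unfolding sum_distrib_left
          by (subst sum.swap) (simp add: mult_mat_nth[OF Y(1) N i] sum_distrib_right mult.assoc)
        also have "\<dots> = (\<Sum>b<n. (\<Sum>l<n. A $$ (i, l) * Y $$ (l, b)) * c (e b) (h b))"
          unfolding AY[symmetric] by (simp add: mult_mat_nth[OF A Y(1) i])
        also have "\<dots> = (\<Sum>l<n. A $$ (i, l) * (\<Sum>b<n + d. P l b * of_int (x b)))"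
          unfolding P c_def[symmetric] sum_distrib_left sum_distrib_right
          by (subst sum.swap) (simp add: mult.assoc)
        finally show ?thesis .
      qed
      moreover have "(\<Sum>i<d. (\<Sum>b<n + d. Q i b * of_int (x' b))\<^sup>2) \<le> (\<Sum>i<d. (\<Sum>b<n + d. Q i b * of_int (x b))\<^sup>2)"
      proof -
        have "(\<Sum>i<d. (\<Sum>b<n + d. Q i b * of_int (x' b))\<^sup>2)
            = (\<Sum>\<nu>\<in>S. \<Sum>j\<in>{m \<nu>..<k \<nu>}. (real_coord (X (\<lambda>b. of_int (x' b))) \<nu> j)\<^sup>2)"
          unfolding Q by (rule sum_W)
        also have "\<dots> = (\<Sum>\<nu>\<in>S. \<Sum>j\<in>{m \<nu>..<k \<nu>}. (Re \<nu> * c \<nu> j + Im \<nu> * c (cnj \<nu>) j)\<^sup>2)"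
          by (intro sum.cong refl) (simp add: shift)
        also have "\<dots> \<le> (\<Sum>\<nu>\<in>S. \<Sum>j\<in>{m \<nu>..<k \<nu>}. (c \<nu> j)\<^sup>2)" by (rule perp_norm_le)
        also have "\<dots> = (\<Sum>i<d. (\<Sum>b<n + d. Q i b * of_int (x b))\<^sup>2)"
          unfolding Q c_def by (rule sum_W[symmetric])
        finally show ?thesis .
      qed
      ultimately show ?thesis by blast
    qed
  qed
qed

end

section \<open>From the spectral conditions to the data of the construction\<close>

lemma algebraic_int_conjugate:
  assumes "algebraic_int x" "alg_conjugate x y"
  shows "algebraic_int y"
proof -
  obtain p :: "int poly" where p: "poly (map_poly of_int p) x = 0" "lead_coeff p = 1"
    using assms(1) by (auto simp: algebraic_int_altdef_ipoly)
  have "poly (map_poly of_int p) y = 0" using alg_conjugate_root_int[OF assms(2) p(1)] .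
  then show ?thesis using p(2) by (auto simp: algebraic_int_altdef_ipoly)
qed

lemma order_prod_list_linear:
  "order z (\<Prod>a\<leftarrow>xs. [:- a, 1:]) = length (filter (\<lambda>a. a = z) xs)" for z :: complex
proof (induction xs)
  case (Cons a xs)
  have "(\<Prod>a\<leftarrow>xs. [:- a, 1:]) \<noteq> 0" for xs :: "complex list"
    unfolding prod_list_zero_iff by auto
  then have "[:- a, 1:] * (\<Prod>a\<leftarrow>xs. [:- a, 1:]) \<noteq> 0"
    by (simp del: mult_pCons_left)
  from order_mult[OF this, of z] Cons.IH show ?case
    by (simp add: order_linear' del: mult_pCons_left)
qed (simp add: order_1_eq_0)

lemma alg_mult_diagonal:
  assumes "A \<in> carrier_mat n n" and "similar_mat (cmat A) (mat n n (\<lambda>(a, b). if a = b then e a else 0))"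
  shows "alg_mult A z = card {a. a < n \<and> e a = z}"
proof -
  let ?D = "mat n n (\<lambda>(a, b). if a = b then e a else 0)"
  have "char_poly (cmat A) = char_poly ?D" using assms(2) by (rule char_poly_similar)
  also have "\<dots> = (\<Prod>a\<leftarrow>diag_mat ?D. [:- a, 1:])"
    by (rule char_poly_upper_triangular[of _ n]) (auto simp: upper_triangular_def)
  also have "diag_mat ?D = map e [0..<n]" by (simp add: diag_mat_def)
  finally have "alg_mult A z = length (filter (\<lambda>a. a = z) (map e [0..<n]))"
    unfolding alg_mult_def by (simp only: order_prod_list_linear)
  also have "\<dots> = card {a. a < n \<and> e a = z}"
    unfolding length_filter_conv_card by (rule arg_cong[of _ _ card]) auto
  finally show ?thesis .
qed

lemma alg_mult_cnj:
  assumes "A \<in> carrier_mat n n"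
  shows "alg_mult A (cnj z) = alg_mult A z"
proof -
  interpret cnj_poly: map_poly_inj_idom_divide_hom cnj
    by unfold_locales auto
  have "map_poly cnj (char_poly (cmat A)) = char_poly (cmat A)"
    unfolding char_poly_cmat[OF assms] by (simp add: map_poly_map_poly o_def)
  then show ?thesis using cnj_poly.order_hom[of z "char_poly (cmat A)"] by (simp add: alg_mult_def)
qed

text \<open>\<open>h\<close> numbers the indices within each fibre of \<open>e\<close>, so that
  equal eigenvalues get different copies of the eigenspace coordinates.\<close>

lemma enumerate_fibres:
  fixes e :: "nat \<Rightarrow> 'b"
  assumes m: "\<And>\<nu>. m \<nu> = card {a. a < n \<and> e a = \<nu>}" and S: "\<And>a. a < n \<Longrightarrow> e a \<in> S"
  shows "\<exists>h :: nat \<Rightarrow> nat. bij_betw (\<lambda>a. (e a, h a)) {..<n} (SIGMA \<nu>:S. {..<m \<nu>})"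
proof -
  have ex: "\<exists>b. bij_betw b {a. a < n \<and> e a = \<nu>} {..<m \<nu>}" for \<nu>
    unfolding m using ex_bij_betw_finite_nat[of "{a. a < n \<and> e a = \<nu>}"] by (simp add: atLeast0LessThan)
  define b where "b \<nu> = (SOME b. bij_betw b {a. a < n \<and> e a = \<nu>} {..<m \<nu>})" for \<nu>
  have b: "bij_betw (b \<nu>) {a. a < n \<and> e a = \<nu>} {..<m \<nu>}" for \<nu>
    unfolding b_def by (rule someI_ex[OF ex])
  have "bij_betw (\<lambda>a. (e a, b (e a) a)) {..<n} (SIGMA \<nu>:S. {..<m \<nu>})"
    unfolding bij_betw_def
  proof
    show "inj_on (\<lambda>a. (e a, b (e a) a)) {..<n}"
    proof (rule inj_onI)
      fix a a' assume "a \<in> {..<n}" "a' \<in> {..<n}" "(e a, b (e a) a) = (e a', b (e a') a')"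
      then show "a = a'"
        using inj_onD[OF bij_betw_imp_inj_on[OF b[of "e a"]], of a a'] by auto
    qed
    show "(\<lambda>a. (e a, b (e a) a)) ` {..<n} = (SIGMA \<nu>:S. {..<m \<nu>})"
    proof (intro equalityI subsetI)
      fix y assume "y \<in> (\<lambda>a. (e a, b (e a) a)) ` {..<n}"
      then obtain a where a: "a < n" "y = (e a, b (e a) a)" by auto
      then have "b (e a) a \<in> {..<m (e a)}" using bij_betwE[OF b[of "e a"]] by blast
      then show "y \<in> (SIGMA \<nu>:S. {..<m \<nu>})" using a S by auto
    next
      fix y assume "y \<in> (SIGMA \<nu>:S. {..<m \<nu>})"
      then obtain \<nu> j where y: "y = (\<nu>, j)" "j < m \<nu>" by auto
      then have "j \<in> b \<nu> ` {a. a < n \<and> e a = \<nu>}" using bij_betw_imp_surj_on[OF b[of \<nu>]] by simp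
      then show "y \<in> (\<lambda>a. (e a, b (e a) a)) ` {..<n}" using y(1) by auto
    qed
  qed
  then show ?thesis by (rule exI[of _ "\<lambda>a. b (e a) a"])
qed

theorem cps_of_spectrum:
  fixes A :: "real mat"
  assumes n: "n \<ge> 1" and A: "A \<in> carrier_mat n n" and diag: "diagonalizable_C A"
    and P1: "\<And>l. eigenvalue (cmat A) l \<Longrightarrow> algebraic_int l"
    and P2: "\<And>\<mu> l. eigenvalue (cmat A) l \<Longrightarrow> alg_conjugate l \<mu> \<Longrightarrow> cmod \<mu> > 1 \<Longrightarrow>
      (\<forall>\<nu>. alg_conjugate \<mu> \<nu> \<longrightarrow> alg_mult A \<mu> \<ge> alg_mult A \<nu>) \<and>
      (\<exists>\<nu>. alg_conjugate \<mu> \<nu> \<and> alg_mult A \<mu> > alg_mult A \<nu>)"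
  shows "\<exists>s L \<Omega>. generic_cps s n L \<and> is_window (s - n) \<Omega> \<and>
    (\<lambda>x. A *\<^sub>v x) ` cps_set s n L \<Omega> \<subseteq> cps_set s n L \<Omega>"
proof -
  obtain D where D: "diagonal_mat D" "similar_mat (cmat A) D" using diag by (auto simp: diagonalizable_C_def)
  have cA: "cmat A \<in> carrier_mat n n" using A by (simp add: cmat_def)
  have D_carrier: "D \<in> carrier_mat n n"
    using D(2) cA by (auto simp: similar_mat_def intro: similar_mat_witD2(5))
  define e where "e a = D $$ (a, a)" for a
  have "D = mat n n (\<lambda>(a, b). if a = b then e a else 0)"
    using D(1) D_carrier by (intro eq_matI) (auto simp: e_def diagonal_mat_def)
  then have sim: "similar_mat (cmat A) (mat n n (\<lambda>(a, b). if a = b then e a else 0))" using D(2) by simp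
  define m where "m = alg_mult A"
  have m_card: "m \<nu> = card {a. a < n \<and> e a = \<nu>}" for \<nu>
    unfolding m_def by (rule alg_mult_diagonal[OF A sim])
  have eig: "eigenvalue (cmat A) \<nu> \<longleftrightarrow> m \<nu> > 0" for \<nu>
    unfolding m_def by (rule eigenvalue_cmat_iff_alg_mult[OF A])
  define S where "S = {y. \<exists>l. eigenvalue (cmat A) l \<and> alg_conjugate l y}"
  \<comment> \<open>In an expanding class the maximum already leaves room, since (P2) makes some
    multiplicity smaller, and it is attained at every expanding member, so none of these enters the
    internal space. In the other classes the 1 makes room, at numbers in the closed unit
    disc.\<close>
  define k where "k \<nu> = Max (m ` {y. alg_conjugate \<nu> y}) + (if \<exists>\<mu>. alg_conjugate \<nu> \<mu> \<and> cmod \<mu> > 1 then 0 else 1)" for \<nu>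
  have "{l. eigenvalue (cmat A) l} = {l. poly (char_poly (cmat A)) l = 0}"
    using eigenvalue_root_char_poly[OF cA] by simp
  moreover have "char_poly (cmat A) \<noteq> 0" using degree_monic_char_poly[OF cA] by auto
  ultimately have "finite {l. eigenvalue (cmat A) l}" using poly_roots_finite by simp
  moreover have "S = (\<Union>l\<in>{l. eigenvalue (cmat A) l}. {y. alg_conjugate l y})" by (auto simp: S_def)
  ultimately have finite_S: "finite S" using finite_alg_conjugates by simp
  have int_S: "algebraic_int \<nu>" if "\<nu> \<in> S" for \<nu>
    using that P1 algebraic_int_conjugate by (auto simp: S_def)
  have conj_S: "\<mu> \<in> S" if "\<nu> \<in> S" "alg_conjugate \<nu> \<mu>" for \<nu> \<mu>
    using that alg_conjugate_trans unfolding S_def by blast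
  have refl_S: "alg_conjugate \<nu> \<nu>" if "\<nu> \<in> S" for \<nu>
    using int_S[OF that] by (intro alg_conjugate_refl) auto
  have k_conj: "k \<mu> = k \<nu>" if "alg_conjugate \<nu> \<mu>" for \<nu> \<mu>
  proof -
    have "alg_conjugate \<mu> y \<longleftrightarrow> alg_conjugate \<nu> y" for y
      using that alg_conjugate_sym alg_conjugate_trans by blast
    then show ?thesis by (simp add: k_def)
  qed
  have m_le_Max: "m \<mu> \<le> Max (m ` {y. alg_conjugate \<nu> y})" if "alg_conjugate \<nu> \<mu>" for \<nu> \<mu>
    using that finite_alg_conjugates by (intro Max_ge) auto
  have m_le_k: "m \<nu> \<le> k \<nu>" if "\<nu> \<in> S" for \<nu>
    using m_le_Max[OF refl_S[OF that]] by (simp add: k_def)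
  have m_less: "\<exists>\<mu>. alg_conjugate \<nu> \<mu> \<and> m \<mu> < k \<mu>" if \<nu>: "\<nu> \<in> S" for \<nu>
  proof (cases "\<exists>\<mu>. alg_conjugate \<nu> \<mu> \<and> cmod \<mu> > 1")
    case True
    then obtain \<mu> where \<mu>: "alg_conjugate \<nu> \<mu>" "cmod \<mu> > 1" by blast
    obtain l where "eigenvalue (cmat A) l" "alg_conjugate l \<mu>"
      using conj_S[OF \<nu> \<mu>(1)] by (auto simp: S_def)
    then obtain \<nu>' where \<nu>': "alg_conjugate \<mu> \<nu>'" "m \<nu>' < m \<mu>" using P2 \<mu>(2) unfolding m_def by blast
    moreover have "m \<mu> \<le> k \<mu>" using m_le_k conj_S[OF \<nu> \<mu>(1)] .
    ultimately show ?thesis using k_conj[OF \<nu>'(1)] alg_conjugate_trans[OF \<mu>(1)] by (metis order_less_le_trans)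
  next
    case False
    then have "k \<nu> = Max (m ` {y. alg_conjugate \<nu> y}) + 1" unfolding k_def by (simp only: if_False)
    then have "m \<nu> < k \<nu>" using m_le_Max[OF refl_S[OF \<nu>]] by linarith
    then show ?thesis using refl_S[OF \<nu>] by blast
  qed
  have small: "cmod \<nu> \<le> 1" if \<nu>: "\<nu> \<in> S" "m \<nu> < k \<nu>" for \<nu>
  proof (rule ccontr)
    assume "\<not> cmod \<nu> \<le> 1"
    then have big: "cmod \<nu> > 1" by simp
    obtain l where "eigenvalue (cmat A) l" "alg_conjugate l \<nu>" using \<nu>(1) by (auto simp: S_def)
    then have "\<forall>\<mu>. alg_conjugate \<nu> \<mu> \<longrightarrow> m \<mu> \<le> m \<nu>" using P2 big unfolding m_def by blast
    then have "Max (m ` {y. alg_conjugate \<nu> y}) \<le> m \<nu>"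
      using refl_S[OF \<nu>(1)] finite_alg_conjugates by (subst Max_le_iff) auto
    moreover have "\<exists>\<mu>. alg_conjugate \<nu> \<mu> \<and> cmod \<mu> > 1" using refl_S[OF \<nu>(1)] big by blast
    then have "k \<nu> = Max (m ` {y. alg_conjugate \<nu> y})" unfolding k_def by (simp only: if_True add_0_right)
    ultimately show False using \<nu>(2) by linarith
  qed
  have ex_f: "\<exists>f :: int poly. map_poly of_int f = (\<Prod>\<nu>\<in>{\<nu>\<in>S. j < k \<nu>}. [:-\<nu>, 1:])" for j
    using finite_S int_S conj_S k_conj by (intro prod_conjugate_closed_int) auto
  define f where "f j = (SOME f :: int poly. map_poly of_int f = (\<Prod>\<nu>\<in>{\<nu>\<in>S. j < k \<nu>}. [:-\<nu>, 1:]))" for j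
  have f: "map_poly of_int (f j) = (\<Prod>\<nu>\<in>{\<nu>\<in>S. j < k \<nu>}. [:-\<nu>, 1:])" for j
    unfolding f_def by (rule someI_ex[OF ex_f])
  define F where "F = {poly (map_poly of_int a) \<nu> / poly (map_poly of_int b) \<nu> | a b \<nu>. \<nu> \<in> S}"
  have "countable F" unfolding F_def by (rule countable_int_poly_quotients[OF finite_S])
  from generic_reflections[OF this] obtain g :: "nat \<Rightarrow> nat \<Rightarrow> nat \<Rightarrow> real" where "(\<forall>k i j. g k i j = g k j i) \<and>
    (\<forall>k i j. i < k \<longrightarrow> j < k \<longrightarrow> (\<Sum>l<k. g k i l * g k l j) = (if i = j then 1 else 0)) \<and>
    (\<forall>k r \<delta>. r < k \<longrightarrow> (\<forall>j<k. \<delta> j \<in> F) \<longrightarrow> (\<Sum>j<k. of_real (g k r j) * \<delta> j) = 0 \<longrightarrow> (\<forall>j<k. \<delta> j = 0))" ..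
  note g = conjunct1[OF this] conjunct1[OF conjunct2[OF this]] conjunct2[OF conjunct2[OF this]]
  interpret conjugate_multiplicities S m k f g
  proof
    show "\<exists>\<mu>. alg_conjugate \<nu> \<mu> \<and> m \<mu> > 0" if "\<nu> \<in> S" for \<nu>
      using that alg_conjugate_sym by (auto simp: S_def eig)
    show "k \<mu> = k \<nu>" if "alg_conjugate \<nu> \<mu>" for \<nu> \<mu> by (rule k_conj[OF that])
    show "m (cnj \<nu>) = m \<nu>" for \<nu> unfolding m_def by (rule alg_mult_cnj[OF A])
    show "algebraic \<nu>" if "\<nu> \<in> S" for \<nu> using int_S[OF that] by auto
    show "\<delta> j = 0"
      if "r < n" "\<And>j. j < n \<Longrightarrow> \<delta> j \<in> {poly (map_poly of_int a) \<nu> / poly (map_poly of_int b) \<nu> | a b \<nu>. \<nu> \<in> S}"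
        "(\<Sum>j<n. of_real (g n r j) * \<delta> j) = 0" "j < n" for n r \<delta> j
      using g(3)[rule_format, of r n \<delta> j] that unfolding F_def by blast
  qed (fact finite_S conj_S m_le_k m_less small f g(1)[rule_format] g(2)[rule_format])+
  have "e a \<in> S" if "a < n" for a
  proof -
    have "m (e a) > 0" using that by (auto simp: m_card card_gt_0_iff)
    then have "eigenvalue (cmat A) (e a)" by (simp add: eig)
    moreover from this have "alg_conjugate (e a) (e a)" using P1 by (intro alg_conjugate_refl) auto
    ultimately show ?thesis by (auto simp: S_def)
  qed
  then obtain h where "bij_betw (\<lambda>a. (e a, h a)) {..<n} (SIGMA \<nu>:S. {..<m \<nu>})"
    using enumerate_fibres[OF m_card] by blast
  then show ?thesis using n A sim by (intro scheme_exists)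
qed

theorem theorem4:
  fixes A :: "real mat" and n :: nat
  assumes "n \<ge> 1"
    and "A \<in> carrier_mat n n"
    and "det A \<noteq> 0"
    and "diagonalizable_C A"
  shows "(\<exists>s L \<Omega>. generic_cps s n L \<and> is_window (s - n) \<Omega> \<and>
            (\<lambda>x. A *\<^sub>v x) ` cps_set s n L \<Omega> \<subseteq> cps_set s n L \<Omega>)
    \<longleftrightarrow>
    ((\<forall>l. eigenvalue (cmat A) l \<longrightarrow> algebraic_int l) \<and>
     (\<forall>\<mu> l. eigenvalue (cmat A) l \<and> alg_conjugate l \<mu> \<and> cmod \<mu> > 1 \<longrightarrow>
        eigenvalue (cmat A) \<mu> \<and>
        (\<forall>\<nu>. alg_conjugate \<mu> \<nu> \<longrightarrow> alg_mult A \<mu> \<ge> alg_mult A \<nu>) \<and>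
        (\<exists>\<nu>. alg_conjugate \<mu> \<nu> \<and> alg_mult A \<mu> > alg_mult A \<nu>)))"
    (is "?scheme \<longleftrightarrow> ?spectrum")
proof
  assume ?scheme
  then obtain s L \<Omega> where "generic_cps s n L" "is_window (s - n) \<Omega>"
    "(\<lambda>x. A *\<^sub>v x) ` cps_set s n L \<Omega> \<subseteq> cps_set s n L \<Omega>" by blast
  note spectrum = cps_spectrum[OF assms(2) this]
  show ?spectrum by (intro conjI allI impI; (elim conjE)?) (use spectrum in blast)+
next
  assume ?spectrum
  then show ?scheme by (intro cps_of_spectrum assms(1,2,4)) blast+
qed

end
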